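(* Let $\mathfrak g$ be a complex Lie algebra and let $\mathcal L\mathfrak g$ be the Lie algebra spanned by elements $X_{\{p\}}$ ($X\in\mathfrak g$, $p\in K$), bilinear in $X$ and $p$ (so $\mathcal L\mathfrak g\cong\mathfrak g\otimes K$), with $[X_{\{p\}},Y_{\{q\}}]=[X,Y]_{\{pq\}}$. Let $\mathcal L\mathfrak g_{\mathrm{ann}}=\{X_{\{p\}}:p\in\mathbb C_{\mathbb Z}^{\mathrm{pol}}\}$-span, let $\mathbb C_0=\mathbb Cm_0$ be its trivial one-dimensional module, and let $$V(\mathfrak g)=\mathcal U(\mathcal L\mathfrak g)\otimes_{\mathcal U(\mathcal L\mathfrak g_{\mathrm{ann}})}\mathbb C_0,\qquad v_0=1\otimes m_0 .$$ Then $V(\mathfrak g)$ is an $H_T$-vertex algebra with vacuum $v_0$, with state-field correspondence such that for each $X\in\mathfrak g$ the vertex operator of $X_{\{1/\tau\}}v_0$ is the current $X(\tau)$, i.e. the distribution $F\mapsto X_{\{F\}}$, $F\in K$.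
   Context: $H_T=\mathbb C[T,T^{-1}]$ is the Hopf algebra with $T$ grouplike and antipode $S(T)=T^{-1}$; $\hat H_T=H_T[\partial_\tau]$ with $\partial_\tau$ primitive, $S(\partial_\tau)=-\partial_\tau$. Coproducts are written $\sum h'\otimes h''$. $\mathbb C_{\mathbb Z}^{\mathrm{pol}}=\mathbb C[\tau]$ is the algebra of polynomial functions on $\mathbb Z$ ($\tau$ is the function $n\mapsto n$), $(Tf)(\tau)=f(\tau+1)$, $\partial_\tau=d/d\tau$. $M$ is the multiplicative set generated by $1$ and the elements $\tau+k$, $k\in\mathbb Z$; $K=M^{-1}\mathbb C_{\mathbb Z}^{\mathrm{pol}}$ (rational functions with poles only at integers), an $\hat H_T$-module. $K=\mathbb C_{\mathbb Z}^{\mathrm{pol}}\oplus K_{\mathrm{Sing}}$ where $K_{\mathrm{Sing}}=\bigoplus_{n\in\mathbb Z,k\ge0}\mathbb C\,(\tau+n)^{-k-1}$, and $h\mapsto S(h)\frac1\tau$ is a linear isomorphism $\hat H_T\to K_{\mathrm{Sing}}$. $\mathrm{Tr}\colon K\to\mathbb C$ is the sum of the residues of $F(\tau)d\tau$ at all integers. A $W$-valued distribution on $K$ is a linear map $D\colon K\to W$; $D_{\mathrm{Hol}}$ (resp. $D_{\mathrm{Sing}}$) agrees with $D$ on $K_{\mathrm{Sing}}$ and vanishes on $\mathbb C_{\mathbb Z}^{\mathrm{pol}}$ (resp. agrees with $D$ on $\mathbb C_{\mathbb Z}^{\mathrm{pol}}$ and vanishes on $K_{\mathrm{Sing}}$).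 For $h\in\hat H_T$, $(h_KD)(F)=D(S(h)F)$. $D$ has rational singularities with kernel $\sum_iw_i\otimes F_i\in W\otimes K_{\mathrm{Sing}}$ if $D(G)=\sum_iw_i\mathrm{Tr}(F_iG)$ for all $G\in\mathbb C_{\mathbb Z}^{\mathrm{pol}}$. A field on $V$ is an $\mathrm{End}(V)$-valued distribution $f(\tau)$ such that for each $v\in V$ the distribution $G\mapsto f(G)v$ has rational singularities. Fields $f,g$ are mutually rational if there is $F\in M$ such that the commutator distribution on $K\otimes K$, $G\otimes G'\mapsto f(G)g(G')-g(G')f(G)$, vanishes on $F(\tau_1-\tau_2)\cdot(K\otimes K)$. An $H_T$-vertex algebra is a vector space $V$ with $1_V\in V$ and a linear map $f\mapsto Y(f,\tau)$ from $V$ to fields on $V$ such that: (Vacuum) $Y(1_V)(F)=\mathrm{Tr}(F)\,\mathrm{id}_V$; $Y(f)(G)1_V=0$ for $G\in\mathbb C_{\mathbb Z}^{\mathrm{pol}}$; $Y(f)(\frac1\tau)1_V=f$. Put $h_Vf=Y(f)(S(h)\frac1\tau)1_V$ for $h\in\hat H_T$, $f\in V$. ($H_T$-covariance) $h_KY(f,\tau)=Y(h_Vf,\tau)$ for $h\in H_T$. (Skew-symmetry) $Y(f,\tau)g=\mathcal R_V(\tau)Y^S(g,\tau)f$ for $f,g\in V$. Here $Y^S(g,\tau)f$ is obtained by substituting $\tau\mapsto-\tau$ in the kernel: it is the distribution $D(F)=-Y(g)(F(-\tau))f$, and, if $\sum_iv_i\otimes F_i$ is the singular kernel of $D$, then $(\mathcal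 R_V(\tau)D)(G)=\sum_i R(v_i)(F_iG)+(R\cdot D_{\mathrm{Hol}})(G)$ for $G\in K$, where $R(v)\colon K\to V$ vanishes on $\mathbb C_{\mathbb Z}^{\mathrm{pol}}$ with $R(v)(S(h)\frac1\tau)=h_Vv$ for $h\in\hat H_T$, and $R\cdot D_{\mathrm{Hol}}$ vanishes on $\mathbb C_{\mathbb Z}^{\mathrm{pol}}$ with $(R\cdot D_{\mathrm{Hol}})(S(h)\frac1\tau)=\sum h'_VD(S(h'')\frac1\tau)$. (Mutual rationality) $Y(f,\tau)$ and $Y(g,\tau)$ are mutually rational for all $f,g\in V$. *)

theory Defs
  imports
    "HOL-Complex_Analysis.Complex_Analysis"
    "HOL-Computational_Algebra.Computational_Algebra"
    "HOL-Library.Poly_Mapping"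
    "HOL-Library.Product_Plus"
begin

section \<open>Complex vector spaces, algebras and Lie algebras\<close>

class complex_vector = ab_group_add +
  fixes scaleC :: "complex \<Rightarrow> 'a \<Rightarrow> 'a" (infixr \<open>*\<^sub>C\<close> 75)
  assumes scaleC_add_right: "a *\<^sub>C (x + y) = a *\<^sub>C x + a *\<^sub>C y"
    and scaleC_add_left: "(a + b) *\<^sub>C x = a *\<^sub>C x + b *\<^sub>C x"
    and scaleC_scaleC: "a *\<^sub>C b *\<^sub>C x = (a * b) *\<^sub>C x"
    and scaleC_one: "1 *\<^sub>C x = x"

interpretation complex_vector: vector_space "scaleC :: complex \<Rightarrow> 'a \<Rightarrow> 'a::complex_vector"
  by unfold_locales (rule scaleC_add_right scaleC_add_left scaleC_scaleC scaleC_one)+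

abbreviation clinear :: "('a::complex_vector \<Rightarrow> 'b::complex_vector) \<Rightarrow> bool"
  where "clinear \<equiv> Vector_Spaces.linear scaleC scaleC"

abbreviation cspan :: "'a::complex_vector set \<Rightarrow> 'a set"
  where "cspan \<equiv> complex_vector.span"

class complex_algebra_1 = complex_vector + ring_1 +
  assumes mult_scaleC_left: "(c *\<^sub>C x) * y = c *\<^sub>C (x * y)"
    and mult_scaleC_right: "x * (c *\<^sub>C y) = c *\<^sub>C (x * y)"

class complex_comm_algebra_1 = complex_algebra_1 + comm_ring_1

class complex_lie_algebra = complex_vector +
  fixes lie_bracket :: "'a \<Rightarrow> 'a \<Rightarrow> 'a"
  assumes lie_add_left: "lie_bracket (x + y) z = lie_bracket x z + lie_bracket y z"
    and lie_add_right: "lie_bracket x (y + z) = lie_bracket x y + lie_bracket x z"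
    and lie_scale_left: "lie_bracket (c *\<^sub>C x) y = c *\<^sub>C lie_bracket x y"
    and lie_scale_right: "lie_bracket x (c *\<^sub>C y) = c *\<^sub>C lie_bracket x y"
    and lie_self: "lie_bracket x x = 0"
    and lie_jacobi: "lie_bracket x (lie_bracket y z) + lie_bracket y (lie_bracket z x)
                     + lie_bracket z (lie_bracket x y) = 0"

lemma clinearI:
  assumes "\<And>x y. f (x + y) = f x + f y" "\<And>c x. f (c *\<^sub>C x) = c *\<^sub>C f x"
  shows "clinear f"
  using assms by (simp add: Vector_Spaces.linear_iff complex_vector.vector_space_axioms)

lemma clinear_add: "clinear f \<Longrightarrow> f (x + y) = f x + f y"
  and clinear_scale: "clinear f \<Longrightarrow> f (c *\<^sub>C x) = c *\<^sub>C f x"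
  by (simp_all add: Vector_Spaces.linear_iff)

lemma clinear_zero: "clinear f \<Longrightarrow> f 0 = 0"
  using clinear_scale[of f 0 0] by simp

lemma clinear_minus: "clinear f \<Longrightarrow> f (- x) = - f x"
  using clinear_scale[of f "-1" x] by simp

lemma clinear_diff: "clinear f \<Longrightarrow> f (x - y) = f x - f y"
  using clinear_add[of f x "- y"] by (simp add: clinear_minus)

lemma clinear_vanishes_on_span:
  assumes "clinear f" "\<And>x. x \<in> S \<Longrightarrow> f x = 0" "x \<in> cspan S"
  shows "f x = 0"
  using assms(3)
  by (induction rule: complex_vector.span_induct_alt)
     (simp_all add: assms clinear_zero clinear_add clinear_scale)

lemma clinear_preserves_span:
  assumes "clinear f" "\<And>x. x \<in> S \<Longrightarrow> f x \<in> cspan S'" "x \<in> cspan S"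
  shows "f x \<in> cspan S'"
  using assms(3)
  by (induction rule: complex_vector.span_induct_alt)
     (simp_all add: assms clinear_zero clinear_add clinear_scale
        complex_vector.span_zero complex_vector.span_add complex_vector.span_scale)

lemma clinear_functional_one:
  fixes x :: "'a::complex_vector"
  assumes "x \<noteq> 0"
  obtains g :: "'a \<Rightarrow> 'b::complex_vector" where "clinear g" "g x = y"
proof -
  interpret vector_space_pair "scaleC :: complex \<Rightarrow> 'a \<Rightarrow> 'a" "scaleC :: complex \<Rightarrow> 'b \<Rightarrow> 'b"
    by unfold_locales
  have "complex_vector.independent {x}"
    using assms by simp
  from linear_independent_extend[OF this, of "\<lambda>_. y"] show ?thesis
    using that by auto
qed

instantiation complex :: complex_comm_algebra_1
begin
definition scaleC_complex :: "complex \<Rightarrow> complex \<Rightarrow> complex" where "scaleC_complex = (*)"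
instance by standard (simp_all add: scaleC_complex_def algebra_simps)
end


section \<open>Free vector spaces and monoid algebras\<close>

instantiation poly_mapping :: (type, complex_vector) complex_vector
begin

lift_definition scaleC_poly_mapping :: "complex \<Rightarrow> ('a \<Rightarrow>\<^sub>0 'b) \<Rightarrow> ('a \<Rightarrow>\<^sub>0 'b)"
  is "\<lambda>c f k. c *\<^sub>C f k"
  by (erule finite_subset[rotated]) auto

instance
  by standard (transfer; simp add: scaleC_add_right scaleC_add_left scaleC_scaleC scaleC_one)+

end

lemma lookup_scaleC: "Poly_Mapping.lookup (c *\<^sub>C p) k = c *\<^sub>C Poly_Mapping.lookup p k"
  by transfer simp

lemma scaleC_single: "c *\<^sub>C Poly_Mapping.single k a = Poly_Mapping.single k (c *\<^sub>C a)"
  by (rule poly_mapping_eqI) (simp add: lookup_scaleC lookup_single when_def)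

definition lin_ext :: "('a \<Rightarrow> 'b::complex_vector) \<Rightarrow> ('a \<Rightarrow>\<^sub>0 complex) \<Rightarrow> 'b"
  where "lin_ext f p = (\<Sum>k\<in>Poly_Mapping.keys p. Poly_Mapping.lookup p k *\<^sub>C f k)"

lemma lin_ext_superset:
  assumes "finite A" "Poly_Mapping.keys p \<subseteq> A"
  shows "lin_ext f p = (\<Sum>k\<in>A. Poly_Mapping.lookup p k *\<^sub>C f k)"
  unfolding lin_ext_def using assms
  by (intro sum.mono_neutral_left) (auto simp: in_keys_iff)

lemma clinear_lin_ext: "clinear (lin_ext f)"
proof (rule clinearI)
  fix p q :: "'a \<Rightarrow>\<^sub>0 complex" and c
  let ?A = "Poly_Mapping.keys p \<union> Poly_Mapping.keys q"
  have "lin_ext f (p + q) = (\<Sum>k\<in>?A. Poly_Mapping.lookup (p + q) k *\<^sub>C f k)"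
    by (rule lin_ext_superset) (use keys_add[of p q] in auto)
  then show "lin_ext f (p + q) = lin_ext f p + lin_ext f q"
    by (simp add: lin_ext_superset[of ?A] lookup_add scaleC_add_left sum.distrib)
  have "lin_ext f (c *\<^sub>C p) = (\<Sum>k\<in>Poly_Mapping.keys p. Poly_Mapping.lookup (c *\<^sub>C p) k *\<^sub>C f k)"
    by (rule lin_ext_superset) (auto simp: in_keys_iff lookup_scaleC)
  then show "lin_ext f (c *\<^sub>C p) = c *\<^sub>C lin_ext f p"
    by (simp add: lin_ext_def lookup_scaleC scaleC_complex_def
        complex_vector.scale_sum_right flip: scaleC_scaleC)
qed

lemma lin_ext_single: "lin_ext f (Poly_Mapping.single k c) = c *\<^sub>C f k"
  by (simp add: lin_ext_def)

lemma free_induct [case_names zero single add]: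
  fixes p :: "'a \<Rightarrow>\<^sub>0 complex"
  assumes "P 0" "\<And>k c. P (Poly_Mapping.single k c)" "\<And>p q. P p \<Longrightarrow> P q \<Longrightarrow> P (p + q)"
  shows "P p"
proof -
  have "P (\<Sum>k\<in>A. Poly_Mapping.single k (Poly_Mapping.lookup p k))" if "finite A" for A
    using that by induction (auto intro: assms)
  moreover have "p = (\<Sum>k\<in>Poly_Mapping.keys p. Poly_Mapping.single k (Poly_Mapping.lookup p k))"
  proof (rule poly_mapping_eqI)
    fix j
    have "(\<Sum>k\<in>Poly_Mapping.keys p. Poly_Mapping.lookup (Poly_Mapping.single k (Poly_Mapping.lookup p k)) j)
        = (\<Sum>k\<in>Poly_Mapping.keys p. if k = j then Poly_Mapping.lookup p k else 0)"
      by (intro sum.cong) (auto simp: lookup_single when_def)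
    also have "\<dots> = Poly_Mapping.lookup p j"
      by (simp add: in_keys_iff)
    finally show "Poly_Mapping.lookup p j = Poly_Mapping.lookup (\<Sum>k\<in>Poly_Mapping.keys p. Poly_Mapping.single k (Poly_Mapping.lookup p k)) j"
      by (simp add: lookup_sum)
  qed
  ultimately show ?thesis by (metis finite_keys)
qed


lemma scaleC_as_mult:
  fixes p :: "'a::monoid_add \<Rightarrow>\<^sub>0 'b::complex_algebra_1"
  shows "c *\<^sub>C p = Poly_Mapping.single 0 (c *\<^sub>C 1) * p" (is ?L)
    and "c *\<^sub>C p = p * Poly_Mapping.single 0 (c *\<^sub>C 1)" (is ?R)
proof -
  have *: "Poly_Mapping.lookup (Poly_Mapping.single 0 d * p) k = d * Poly_Mapping.lookup p k"
    for k d
    by (simp add: lookup_mult lookup_single when_mult)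
  have "(d when q = 0 when k = l + q) = ((d when k = l) when q = 0)" for d :: 'b and k l q :: 'a
    by (simp add: when_def)
  then have **: "Poly_Mapping.lookup (p * Poly_Mapping.single 0 d) k = Poly_Mapping.lookup p k * d"
    for k d
    by (simp add: lookup_mult lookup_single mult_when eq_commute[of 0])
  show ?L by (rule poly_mapping_eqI) (simp add: * lookup_scaleC mult_scaleC_left)
  show ?R by (rule poly_mapping_eqI) (simp add: ** lookup_scaleC mult_scaleC_right)
qed

instance poly_mapping :: (monoid_add, complex_algebra_1) complex_algebra_1
proof
  fix c and x y :: "'a \<Rightarrow>\<^sub>0 'b"
  show "(c *\<^sub>C x) * y = c *\<^sub>C (x * y)"
    by (simp add: scaleC_as_mult(1) mult.assoc)
  show "x * (c *\<^sub>C y) = c *\<^sub>C (x * y)"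
    by (simp add: scaleC_as_mult(2) mult.assoc)
qed

instance poly_mapping :: (comm_monoid_add, complex_comm_algebra_1) complex_comm_algebra_1 ..


section \<open>Tensor products\<close>

definition tensor_rels :: "('a::complex_vector \<times> 'b::complex_vector \<Rightarrow>\<^sub>0 complex) set" where
  "tensor_rels =
     {Poly_Mapping.single (x + x', y) 1 - Poly_Mapping.single (x, y) 1
        - Poly_Mapping.single (x', y) 1 | x x' y. True}
   \<union> {Poly_Mapping.single (x, y + y') 1 - Poly_Mapping.single (x, y) 1
        - Poly_Mapping.single (x, y') 1 | x y y'. True}
   \<union> {Poly_Mapping.single (c *\<^sub>C x, y) 1 - c *\<^sub>C Poly_Mapping.single (x, y) 1 | c x y. True}
   \<union> {Poly_Mapping.single (x, c *\<^sub>C y) 1 - c *\<^sub>C Poly_Mapping.single (x, y) 1 | c x y. True}"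

lemma equivp_mod_span: "equivp (\<lambda>x y. x - y \<in> cspan S)"
proof (rule equivpI)
  show "reflp (\<lambda>x y. x - y \<in> cspan S)"
    by (simp add: reflp_def complex_vector.span_zero)
  show "symp (\<lambda>x y. x - y \<in> cspan S)"
  proof (rule sympI)
    fix x y assume "x - y \<in> cspan S"
    from complex_vector.span_neg[OF this] show "y - x \<in> cspan S" by simp
  qed
  show "transp (\<lambda>x y. x - y \<in> cspan S)"
  proof (rule transpI)
    fix x y z assume "x - y \<in> cspan S" "y - z \<in> cspan S"
    from complex_vector.span_add[OF this] show "x - z \<in> cspan S" by simp
  qed
qed

lemma mod_span_add:
  "x - x' \<in> cspan S \<Longrightarrow> y - y' \<in> cspan S \<Longrightarrow> (x + y) - (x' + y') \<in> cspan S"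
  by (simp add: add_diff_add complex_vector.span_add)

lemma mod_span_diff:
  "x - x' \<in> cspan S \<Longrightarrow> y - y' \<in> cspan S \<Longrightarrow> (x - y) - (x' - y') \<in> cspan S"
  using complex_vector.span_diff[of "x - x'" S "y - y'"] by (simp add: algebra_simps)

lemma mod_span_neg: "x - x' \<in> cspan S \<Longrightarrow> (- x) - (- x') \<in> cspan S"
  using complex_vector.span_neg[of "x - x'" S] by simp

lemma mod_span_scale: "x - x' \<in> cspan S \<Longrightarrow> c *\<^sub>C x - c *\<^sub>C x' \<in> cspan S"
  using complex_vector.span_scale[of "x - x'" S c]
  by (simp add: complex_vector.scale_right_diff_distrib)

quotient_type (overloaded) ('a, 'b) tensor =
    "'a::complex_vector \<times> 'b::complex_vector \<Rightarrow>\<^sub>0 complex"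
  / "\<lambda>p q. p - q \<in> cspan tensor_rels"
  by (rule equivp_mod_span)

instantiation tensor :: (complex_vector, complex_vector) complex_vector
begin

lift_definition zero_tensor :: "('a, 'b) tensor" is 0 .
lift_definition plus_tensor :: "('a, 'b) tensor \<Rightarrow> ('a, 'b) tensor \<Rightarrow> ('a, 'b) tensor"
  is "(+)" by (rule mod_span_add)
lift_definition minus_tensor :: "('a, 'b) tensor \<Rightarrow> ('a, 'b) tensor \<Rightarrow> ('a, 'b) tensor"
  is "(-)" by (rule mod_span_diff)
lift_definition uminus_tensor :: "('a, 'b) tensor \<Rightarrow> ('a, 'b) tensor"
  is "uminus" by (rule mod_span_neg)
lift_definition scaleC_tensor :: "complex \<Rightarrow> ('a, 'b) tensor \<Rightarrow> ('a, 'b) tensor"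
  is "scaleC" by (rule mod_span_scale)

instance
  by standard
     (transfer; simp add: complex_vector.span_zero algebra_simps scaleC_add_right scaleC_add_left)+

end

lift_definition tensor :: "'a::complex_vector \<Rightarrow> 'b::complex_vector \<Rightarrow> ('a, 'b) tensor"
    (infixr \<open>\<otimes>\<^sub>C\<close> 76)
  is "\<lambda>x y. Poly_Mapping.single (x, y) 1" .

definition cbilinear :: "('a::complex_vector \<Rightarrow> 'b::complex_vector \<Rightarrow> 'c::complex_vector) \<Rightarrow> bool"
  where "cbilinear b \<longleftrightarrow> (\<forall>x. clinear (b x)) \<and> (\<forall>y. clinear (\<lambda>x. b x y))"

text \<open>
  Meaningful for bilinear \<open>b\<close> only, see \<open>tensor_lift_tensor\<close> and \<open>clinear_tensor_lift\<close>.
\<close>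

definition tensor_lift ::
    "('a::complex_vector \<Rightarrow> 'b::complex_vector \<Rightarrow> 'c::complex_vector) \<Rightarrow> ('a, 'b) tensor \<Rightarrow> 'c"
  where "tensor_lift b t = lin_ext (\<lambda>(x, y). b x y) (rep_tensor t)"

lemma tensor_bilinear:
  "(x + x') \<otimes>\<^sub>C y = x \<otimes>\<^sub>C y + x' \<otimes>\<^sub>C y"
  "x \<otimes>\<^sub>C (y + y') = x \<otimes>\<^sub>C y + x \<otimes>\<^sub>C y'"
  "(c *\<^sub>C x) \<otimes>\<^sub>C y = c *\<^sub>C (x \<otimes>\<^sub>C y)"
  "x \<otimes>\<^sub>C (c *\<^sub>C y) = c *\<^sub>C (x \<otimes>\<^sub>C y)"
  by (transfer; rule complex_vector.span_base; force simp: tensor_rels_def diff_diff_eq)+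

lemma tensor_lift_abs:
  assumes "cbilinear b"
  shows "tensor_lift b (abs_tensor p) = lin_ext (\<lambda>(x, y). b x y) p"
proof -
  let ?L = "lin_ext (\<lambda>(x, y). b x y)"
  have b: "b (x + x') y = b x y + b x' y" "b x (y + y') = b x y + b x y'"
    "b (c *\<^sub>C x) y = c *\<^sub>C b x y" "b x (c *\<^sub>C y) = c *\<^sub>C b x y" for x x' y y' c
    using assms clinear_add[of "b x"] clinear_scale[of "b x"]
      clinear_add[of "\<lambda>x. b x y"] clinear_scale[of "\<lambda>x. b x y"]
    unfolding cbilinear_def by blast+
  have "rep_tensor (abs_tensor p) - p \<in> cspan tensor_rels"
    by (rule Quotient3_rep_abs[OF Quotient3_tensor]) (simp add: complex_vector.span_zero)
  moreover have "?L r = 0" if "r \<in> tensor_rels" for r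
    using that
    by (auto simp: tensor_rels_def clinear_diff[OF clinear_lin_ext] b
        clinear_scale[OF clinear_lin_ext] lin_ext_single scaleC_one)
  ultimately have "?L (rep_tensor (abs_tensor p) - p) = 0"
    using clinear_vanishes_on_span[OF clinear_lin_ext] by blast
  then show ?thesis
    by (simp add: tensor_lift_def clinear_diff[OF clinear_lin_ext])
qed

lemma clinear_tensor_lift:
  assumes "cbilinear b"
  shows "clinear (tensor_lift b)"
proof (rule clinearI)
  fix s t :: "('a, 'b) tensor" and c
  show "tensor_lift b (s + t) = tensor_lift b s + tensor_lift b t"
    by (induct s rule: tensor.abs_induct, induct t rule: tensor.abs_induct)
       (simp add: plus_tensor.abs_eq tensor_lift_abs[OF assms] clinear_add[OF clinear_lin_ext])
  show "tensor_lift b (c *\<^sub>C t) = c *\<^sub>C tensor_lift b t"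
    by (induct t rule: tensor.abs_induct)
       (simp add: scaleC_tensor.abs_eq tensor_lift_abs[OF assms] clinear_scale[OF clinear_lin_ext])
qed

lemma tensor_lift_tensor: "cbilinear b \<Longrightarrow> tensor_lift b (x \<otimes>\<^sub>C y) = b x y"
  by (simp add: tensor.abs_eq tensor_lift_abs lin_ext_single scaleC_one)

lemma tensor_induct [case_names tensor add, induct type: tensor]:
  fixes t :: "('a::complex_vector, 'b::complex_vector) tensor"
  assumes "\<And>x y. P (x \<otimes>\<^sub>C y)" "\<And>s t. P s \<Longrightarrow> P t \<Longrightarrow> P (s + t)"
  shows "P t"
proof -
  have abs_single: "abs_tensor (Poly_Mapping.single (x, y) c) = (c *\<^sub>C x) \<otimes>\<^sub>C y" for c x y
    unfolding tensor_bilinear(3)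
    by (simp add: tensor.abs_eq scaleC_tensor.abs_eq scaleC_single scaleC_complex_def)
  have "P (abs_tensor p)" for p
  proof (induction p rule: free_induct)
    case zero
    show ?case using assms(1)[of "0 *\<^sub>C 0" 0]
      unfolding tensor_bilinear(3) by (simp flip: zero_tensor_def)
  next
    case (single k c)
    show ?case by (cases k) (simp add: abs_single assms(1))
  next
    case (add p q)
    then show ?case using assms(2) by (simp flip: plus_tensor.abs_eq)
  qed
  then show ?thesis by (induct t rule: tensor.abs_induct)
qed

text \<open>Bilinear operations on tensor products, such as the product and the Lie bracket below.\<close>

definition tensor_lift2 ::
    "('a::complex_vector \<Rightarrow> 'b::complex_vector \<Rightarrow> 'c::complex_vector \<Rightarrow> 'd::complex_vector
       \<Rightarrow> 'e::complex_vector) \<Rightarrow> ('a, 'b) tensor \<Rightarrow> ('c, 'd) tensor \<Rightarrow> 'e"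
  where "tensor_lift2 Q s t = tensor_lift (\<lambda>a b. tensor_lift (Q a b) t) s"

lemma tensor_lift_fun_add: "tensor_lift (\<lambda>x y. b x y + b' x y) t = tensor_lift b t + tensor_lift b' t"
  by (simp add: tensor_lift_def lin_ext_def scaleC_add_right sum.distrib case_prod_beta)

lemma tensor_lift_fun_scale: "tensor_lift (\<lambda>x y. c *\<^sub>C b x y) t = c *\<^sub>C tensor_lift b t"
  by (simp add: tensor_lift_def lin_ext_def case_prod_beta complex_vector.scale_sum_right
      mult.commute)

lemma cbilinearI:
  assumes "\<And>x x' y. b (x + x') y = b x y + b x' y" "\<And>x y y'. b x (y + y') = b x y + b x y'"
    "\<And>c x y. b (c *\<^sub>C x) y = c *\<^sub>C b x y" "\<And>c x y. b x (c *\<^sub>C y) = c *\<^sub>C b x y"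
  shows "cbilinear b"
  unfolding cbilinear_def by (auto intro!: clinearI simp: assms)

context
  fixes Q :: "'a::complex_vector \<Rightarrow> 'b::complex_vector \<Rightarrow> 'c::complex_vector \<Rightarrow> 'd::complex_vector
       \<Rightarrow> 'e::complex_vector"
  assumes Q1: "\<And>c d. cbilinear (\<lambda>a b. Q a b c d)" and Q2: "\<And>a b. cbilinear (Q a b)"
begin

lemma tensor_lift2_outer: "cbilinear (\<lambda>a b. tensor_lift (Q a b) t)"
proof -
  have "clinear (\<lambda>a. Q a b c d)" "clinear (\<lambda>b. Q a b c d)" for a b c d
    using Q1[of c d] unfolding cbilinear_def by blast+
  note Q = this[THEN clinear_add] this[THEN clinear_scale]
  have "Q (a + a') b = (\<lambda>c d. Q a b c d + Q a' b c d)"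
    "Q a (b + b') = (\<lambda>c d. Q a b c d + Q a b' c d)"
    "Q (k *\<^sub>C a) b = (\<lambda>c d. k *\<^sub>C Q a b c d)"
    "Q a (k *\<^sub>C b) = (\<lambda>c d. k *\<^sub>C Q a b c d)" for a a' b b' k
    by (intro ext; rule Q)+
  then show ?thesis
    by (intro cbilinearI) (simp_all add: tensor_lift_fun_add tensor_lift_fun_scale)
qed

lemma clinear_tensor_lift2_left: "clinear (\<lambda>s. tensor_lift2 Q s t)"
  unfolding tensor_lift2_def by (intro clinear_tensor_lift tensor_lift2_outer)

lemma clinear_tensor_lift2_right: "clinear (tensor_lift2 Q s)"
  by (rule clinearI)
     (simp_all add: tensor_lift2_def clinear_add[OF clinear_tensor_lift[OF Q2]]
        clinear_scale[OF clinear_tensor_lift[OF Q2]] tensor_lift_fun_add tensor_lift_fun_scale)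

lemma tensor_lift2_tensor: "tensor_lift2 Q (a \<otimes>\<^sub>C b) (c \<otimes>\<^sub>C d) = Q a b c d"
  by (simp add: tensor_lift2_def tensor_lift_tensor[OF Q2] tensor_lift_tensor[OF tensor_lift2_outer]
      tensor_lift_tensor[OF Q1])

end

lemma tensor_nonzero:
  assumes "x \<noteq> 0" "y \<noteq> 0"
  shows "x \<otimes>\<^sub>C y \<noteq> 0"
proof -
  obtain f g where *: "clinear f" "f x = (1 :: complex)" "clinear g" "g y = (1 :: complex)"
    using assms clinear_functional_one by metis
  have "cbilinear (\<lambda>x y. f x * g y)"
    using *(1,3)
    by (intro cbilinearI) (simp_all add: clinear_add clinear_scale scaleC_complex_def algebra_simps)
  from tensor_lift_tensor[OF this, of x y] clinear_zero[OF clinear_tensor_lift[OF this]]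
  show ?thesis using * by auto
qed

instantiation tensor :: (complex_algebra_1, complex_algebra_1) complex_algebra_1
begin

definition one_tensor :: "('a, 'b) tensor" where "1 = 1 \<otimes>\<^sub>C 1"

definition times_tensor :: "('a, 'b) tensor \<Rightarrow> ('a, 'b) tensor \<Rightarrow> ('a, 'b) tensor"
  where "times_tensor = tensor_lift2 (\<lambda>a b c d. (a * c) \<otimes>\<^sub>C (b * d))"

lemma tensor_mult_bilinear:
  fixes s t u :: "('a, 'b) tensor"
  shows "(s + t) * u = s * u + t * u" "s * (t + u) = s * t + s * u"
    "(c *\<^sub>C s) * t = c *\<^sub>C (s * t)" "s * (c *\<^sub>C t) = c *\<^sub>C (s * t)"
    and tensor_mult: "(a \<otimes>\<^sub>C b) * (a' \<otimes>\<^sub>C b') = (a * a') \<otimes>\<^sub>C (b * b' :: 'b)"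
proof -
  let ?Q = "\<lambda>(a::'a) (b::'b) c d. (a * c) \<otimes>\<^sub>C (b * d)"
  have Q: "cbilinear (\<lambda>a b. ?Q a b c d)" "cbilinear (?Q a b)" for a b c d
    by (auto intro!: cbilinearI simp: algebra_simps tensor_bilinear mult_scaleC_left mult_scaleC_right)
  note left = clinear_tensor_lift2_left[of ?Q, OF Q, folded times_tensor_def]
    and right = clinear_tensor_lift2_right[of ?Q, OF Q, folded times_tensor_def]
  show "(s + t) * u = s * u + t * u" "(c *\<^sub>C s) * t = c *\<^sub>C (s * t)"
    using clinear_add[OF left] clinear_scale[OF left] by blast+
  show "s * (t + u) = s * t + s * u" "s * (c *\<^sub>C t) = c *\<^sub>C (s * t)"
    using clinear_add[OF right] clinear_scale[OF right] by blast+
  show "(a \<otimes>\<^sub>C b) * (a' \<otimes>\<^sub>C b') = (a * a') \<otimes>\<^sub>C (b * b' :: 'b)"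
    using tensor_lift2_tensor[of ?Q, OF Q, folded times_tensor_def] .
qed

instance
proof
  fix r s t :: "('a, 'b) tensor" and c
  show "(r + s) * t = r * t + s * t" "r * (s + t) = r * s + r * t"
    "(c *\<^sub>C s) * t = c *\<^sub>C (s * t)" "s * (c *\<^sub>C t) = c *\<^sub>C (s * t)"
    by (rule tensor_mult_bilinear)+
  show "r * s * t = r * (s * t)"
  proof (induct r)
    case (tensor a b)
    show ?case
    proof (induct s)
      case (tensor a' b')
      show ?case
        by (induct t) (simp_all add: tensor_mult mult.assoc tensor_mult_bilinear)
    qed (simp add: tensor_mult_bilinear)
  qed (simp add: tensor_mult_bilinear)
  show "1 * r = r" "r * 1 = r"
    by (induct r) (simp_all add: one_tensor_def tensor_mult tensor_mult_bilinear)
  show "0 \<noteq> (1 :: ('a, 'b) tensor)"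
    unfolding one_tensor_def by (metis tensor_nonzero one_neq_zero)
qed

end

instance tensor :: (complex_comm_algebra_1, complex_comm_algebra_1) complex_comm_algebra_1
proof
  fix s t :: "('a, 'b) tensor"
  show "s * t = t * s"
  proof (induct s)
    case (tensor a b)
    show ?case
      by (induct t) (simp_all add: tensor_mult mult.commute tensor_mult_bilinear)
  qed (simp add: tensor_mult_bilinear)
  show "1 * s = s" by simp
  show "(s + t) * u = s * u + t * u" for u by (rule tensor_mult_bilinear)
qed

text \<open>The current algebra \<open>\<gg> \<otimes> A\<close> with \<open>[x \<otimes> p, y \<otimes> q] = [x, y] \<otimes> pq\<close>.\<close>

instantiation tensor :: (complex_lie_algebra, complex_comm_algebra_1) complex_lie_algebra
begin

definition lie_bracket_tensor :: "('a, 'b) tensor \<Rightarrow> ('a, 'b) tensor \<Rightarrow> ('a, 'b) tensor"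
  where "lie_bracket_tensor = tensor_lift2 (\<lambda>x p y q. lie_bracket x y \<otimes>\<^sub>C (p * q))"

lemma lie_tensor_bilinear:
  fixes s t u :: "('a, 'b) tensor"
  shows "lie_bracket (s + t) u = lie_bracket s u + lie_bracket t u"
    "lie_bracket s (t + u) = lie_bracket s t + lie_bracket s u"
    "lie_bracket (c *\<^sub>C s) t = c *\<^sub>C lie_bracket s t"
    "lie_bracket s (c *\<^sub>C t) = c *\<^sub>C lie_bracket s t"
    and lie_tensor: "lie_bracket (x \<otimes>\<^sub>C p) (y \<otimes>\<^sub>C q) = lie_bracket x y \<otimes>\<^sub>C (p * q :: 'b)"
proof -
  let ?Q = "\<lambda>(x::'a) (p::'b) y q. lie_bracket x y \<otimes>\<^sub>C (p * q)"
  have Q: "cbilinear (\<lambda>x p. ?Q x p y q)" "cbilinear (?Q x p)" for x p y q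
    by (auto intro!: cbilinearI simp: algebra_simps tensor_bilinear mult_scaleC_left
        mult_scaleC_right lie_add_left lie_add_right lie_scale_left lie_scale_right)
  note left = clinear_tensor_lift2_left[of ?Q, OF Q, folded lie_bracket_tensor_def]
    and right = clinear_tensor_lift2_right[of ?Q, OF Q, folded lie_bracket_tensor_def]
  show "lie_bracket (s + t) u = lie_bracket s u + lie_bracket t u"
    "lie_bracket (c *\<^sub>C s) t = c *\<^sub>C lie_bracket s t"
    using clinear_add[OF left] clinear_scale[OF left] by blast+
  show "lie_bracket s (t + u) = lie_bracket s t + lie_bracket s u"
    "lie_bracket s (c *\<^sub>C t) = c *\<^sub>C lie_bracket s t"
    using clinear_add[OF right] clinear_scale[OF right] by blast+
  show "lie_bracket (x \<otimes>\<^sub>C p) (y \<otimes>\<^sub>C q) = lie_bracket x y \<otimes>\<^sub>C (p * q :: 'b)"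
    using tensor_lift2_tensor[of ?Q, OF Q, folded lie_bracket_tensor_def] .
qed

lemma lie_antisym: "lie_bracket y x = - lie_bracket x (y :: 'a)"
proof -
  have "0 = lie_bracket (x + y) (x + y)" by (simp only: lie_self)
  also have "\<dots> = lie_bracket x (x + y) + lie_bracket y (x + y)" by (rule lie_add_left)
  also have "\<dots> = lie_bracket y x + lie_bracket x y"
    by (simp add: lie_add_right lie_self)
  finally have "lie_bracket y x + lie_bracket x y = 0" ..
  then show ?thesis by (simp only: eq_neg_iff_add_eq_0)
qed

lemma tensor_zero_left: "0 \<otimes>\<^sub>C y = 0"
  using tensor_bilinear(3)[of 0 0 y] by simp

lemma tensor_minus_left: "(- x) \<otimes>\<^sub>C y = - (x \<otimes>\<^sub>C y)"
  using tensor_bilinear(3)[of "-1" x y] by simp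

lemma lie_tensor_antisym: "lie_bracket s t = - lie_bracket t (s :: ('a, 'b) tensor)"
proof (induct s)
  case (tensor x p)
  show ?case
  proof (induct t)
    case (tensor y q)
    show ?case
      by (simp add: lie_tensor lie_antisym[of x y] tensor_minus_left mult.commute)
  qed (simp add: lie_tensor_bilinear)
qed (simp add: lie_tensor_bilinear)

instance
proof
  fix r s t :: "('a, 'b) tensor" and c
  show "lie_bracket (r + s) t = lie_bracket r t + lie_bracket s t"
    "lie_bracket r (s + t) = lie_bracket r s + lie_bracket r t"
    "lie_bracket (c *\<^sub>C s) t = c *\<^sub>C lie_bracket s t"
    "lie_bracket s (c *\<^sub>C t) = c *\<^sub>C lie_bracket s t"
    by (rule lie_tensor_bilinear)+
  show "lie_bracket s s = 0"
  proof -
    have "lie_bracket s s + lie_bracket s s = 0"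
      using lie_tensor_antisym[of s s] by (simp add: eq_neg_iff_add_eq_0)
    then have "(1 + 1) *\<^sub>C lie_bracket s s = 0"
      by (simp only: scaleC_add_left scaleC_one)
    then show ?thesis by simp
  qed
  define J where "J r s t = lie_bracket r (lie_bracket s t) + lie_bracket s (lie_bracket t r)
    + lie_bracket t (lie_bracket r s)" for r s t :: "('a, 'b) tensor"
  have J_add: "J (r + r') s t = J r s t + J r' s t" "J r (s + s') t = J r s t + J r s' t"
    "J r s (t + t') = J r s t + J r s t'" for r r' s s' t t'
    by (simp_all add: J_def lie_tensor_bilinear algebra_simps)
  have "J r s t = 0"
  proof (induct r)
    case (tensor x p)
    show ?case
    proof (induct s)
      case (tensor y q)
      show ?case
      proof (induct t)
        case (tensor z v)
        have "q * (v * p) = p * (q * v)" "v * (p * q) = p * (q * v)"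
          by (simp_all add: ac_simps)
        then show ?case
          by (simp only: J_def lie_tensor tensor_bilinear(1)[symmetric] lie_jacobi tensor_zero_left)
      qed (simp add: J_add)
    qed (simp add: J_add)
  qed (simp add: J_add)
  then show "lie_bracket r (lie_bracket s t) + lie_bracket s (lie_bracket t r)
          + lie_bracket t (lie_bracket r s) = 0"
    by (simp only: J_def)
qed

end


section \<open>Universal enveloping algebras\<close>

text \<open>
  The free algebra on a set is the monoid algebra of the monoid of words in that set.
  Dividing it by the relations that make the inclusion of generators linear gives the tensor
  algebra; \<open>uea_rels\<close> contains these relations as well as \<open>x y - y x = [x, y]\<close>.
\<close>

datatype 'a word = Word "'a list"

instantiation word :: (type) monoid_add
begin

definition zero_word :: "'a word" where "0 = Word []"

fun plus_word :: "'a word \<Rightarrow> 'a word \<Rightarrow> 'a word" where "Word xs + Word ys = Word (xs @ ys)"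

instance
proof
  fix a b c :: "'a word"
  show "a + b + c = a + (b + c)" by (cases a; cases b; cases c) simp
  show "0 + a = a" "a + 0 = a" by (cases a; simp add: zero_word_def)+
qed

end

lemma word_add_eq_0: "v + w = 0 \<longleftrightarrow> v = 0 \<and> w = (0 :: 'a word)"
  by (cases v; cases w) (simp add: zero_word_def)

type_synonym 'a free_algebra = "'a word \<Rightarrow>\<^sub>0 complex"

definition free_gen :: "'a \<Rightarrow> 'a free_algebra"
  where "free_gen x = Poly_Mapping.single (Word [x]) 1"

definition uea_rels :: "'l::complex_lie_algebra free_algebra set" where
  "uea_rels =
     {free_gen (x + y) - free_gen x - free_gen y | x y. True}
   \<union> {free_gen (c *\<^sub>C x) - c *\<^sub>C free_gen x | c x. True}
   \<union> {free_gen x * free_gen y - free_gen y * free_gen x - free_gen (lie_bracket x y) | x y. True}"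

text \<open>The linear span of this set is the two-sided ideal generated by \<open>uea_rels\<close>.\<close>

definition uea_ideal_gens :: "'l::complex_lie_algebra free_algebra set"
  where "uea_ideal_gens = {a * r * b | a r b. r \<in> uea_rels}"

lemma uea_ideal_mult:
  assumes "x \<in> cspan uea_ideal_gens"
  shows "a * x \<in> cspan uea_ideal_gens" "x * a \<in> cspan uea_ideal_gens"
proof -
  have "clinear (\<lambda>x. a * x)" "clinear (\<lambda>x. x * a)"
    by (auto intro!: clinearI simp: mult_scaleC_left mult_scaleC_right algebra_simps)
  moreover have "a * x \<in> cspan uea_ideal_gens" "x * a \<in> cspan uea_ideal_gens"
    if "x \<in> uea_ideal_gens" for x
    using that unfolding uea_ideal_gens_def
    by (auto intro!: complex_vector.span_base) (metis mult.assoc)+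
  ultimately show "a * x \<in> cspan uea_ideal_gens" "x * a \<in> cspan uea_ideal_gens"
    using clinear_preserves_span assms by blast+
qed

quotient_type (overloaded) 'l uea = "'l::complex_lie_algebra free_algebra"
  / "\<lambda>x y. x - y \<in> cspan uea_ideal_gens"
  by (rule equivp_mod_span)

lemma lookup_zero_word_mult:
  "Poly_Mapping.lookup (p * q) (0 :: 'a word)
     = Poly_Mapping.lookup p 0 * (Poly_Mapping.lookup q 0 :: complex)"
proof -
  have "(c when 0 = l + q) = ((c when l = 0) when q = 0)" for c :: complex and l q :: "'a word"
    using word_add_eq_0[of l q] by (auto simp: when_def)
  then show ?thesis by (simp add: lookup_mult mult_when)
qed

lemma uea_one_notin_ideal: "1 \<notin> cspan (uea_ideal_gens :: 'l::complex_lie_algebra free_algebra set)"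
proof
  let ?e = "\<lambda>p :: 'l free_algebra. Poly_Mapping.lookup p 0"
  assume "1 \<in> cspan (uea_ideal_gens :: 'l free_algebra set)"
  moreover have "clinear ?e"
    by (rule clinearI) (simp_all add: lookup_add lookup_scaleC)
  moreover have "?e r = 0" if "r \<in> uea_rels" for r
    using that
    by (auto simp: uea_rels_def lookup_minus lookup_scaleC free_gen_def lookup_single when_def
        zero_word_def lookup_zero_word_mult[unfolded zero_word_def] scaleC_complex_def)
  then have "?e x = 0" if "x \<in> uea_ideal_gens" for x
    using that by (auto simp: uea_ideal_gens_def lookup_zero_word_mult)
  ultimately have "?e 1 = 0"
    by (rule clinear_vanishes_on_span[rotated -1])
  then show False by simp
qed

instantiation uea :: (complex_lie_algebra) complex_algebra_1
begin

lift_definition zero_uea :: "'a uea" is 0 .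
lift_definition one_uea :: "'a uea" is 1 .
lift_definition plus_uea :: "'a uea \<Rightarrow> 'a uea \<Rightarrow> 'a uea" is "(+)" by (rule mod_span_add)
lift_definition minus_uea :: "'a uea \<Rightarrow> 'a uea \<Rightarrow> 'a uea" is "(-)" by (rule mod_span_diff)
lift_definition uminus_uea :: "'a uea \<Rightarrow> 'a uea" is uminus by (rule mod_span_neg)
lift_definition scaleC_uea :: "complex \<Rightarrow> 'a uea \<Rightarrow> 'a uea" is scaleC by (rule mod_span_scale)
lift_definition times_uea :: "'a uea \<Rightarrow> 'a uea \<Rightarrow> 'a uea" is "(*)"
proof -
  fix x x' y y' :: "'a free_algebra"
  assume "x - x' \<in> cspan uea_ideal_gens" "y - y' \<in> cspan uea_ideal_gens"
  then have "(x - x') * y + x' * (y - y') \<in> cspan uea_ideal_gens"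
    by (intro complex_vector.span_add uea_ideal_mult)
  then show "x * y - x' * y' \<in> cspan uea_ideal_gens"
    by (simp add: algebra_simps)
qed

instance
proof
  show "0 \<noteq> (1 :: 'a uea)"
    by transfer (use uea_one_notin_ideal complex_vector.span_neg in force)
qed (transfer; simp add: complex_vector.span_zero algebra_simps scaleC_add_right scaleC_add_left
      mult_scaleC_left mult_scaleC_right)+

end

lift_definition uea_gen :: "'l::complex_lie_algebra \<Rightarrow> 'l uea" is free_gen .

text \<open>
  The algebra homomorphism induced by a Lie algebra homomorphism \<open>f\<close> into an associative
  algebra (only meaningful for such \<open>f\<close>).
\<close>

definition uea_lift :: "('l::complex_lie_algebra \<Rightarrow> 'a::complex_algebra_1) \<Rightarrow> 'l uea \<Rightarrow> 'a"
  where "uea_lift f u = lin_ext (\<lambda>w. case w of Word xs \<Rightarrow> prod_list (map f xs)) (rep_uea u)"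


section \<open>Rational functions with poles only at integers\<close>

inductive_set int_denoms :: "complex poly set" where
  one: "1 \<in> int_denoms"
| mult: "q \<in> int_denoms \<Longrightarrow> [:of_int k, 1:] * q \<in> int_denoms"

lemma int_denoms_nonzero: "q \<in> int_denoms \<Longrightarrow> q \<noteq> 0"
  by (induction rule: int_denoms.induct) (simp_all del: mult_pCons_left)

lemma int_denoms_mult: "p \<in> int_denoms \<Longrightarrow> q \<in> int_denoms \<Longrightarrow> p * q \<in> int_denoms"
  by (induction rule: int_denoms.induct) (auto intro: int_denoms.intros simp: mult.assoc simp del: mult_pCons_left)

typedef kfun = "{Fract p q | p q. q \<in> int_denoms}"
  using int_denoms.one by blast

setup_lifting type_definition_kfun

instantiation kfun :: complex_comm_algebra_1
begin

lift_definition zero_kfun :: kfun is 0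
  by (auto simp: Zero_fract_def intro: int_denoms.one)
lift_definition one_kfun :: kfun is 1
  by (auto simp: One_fract_def intro: int_denoms.one)
lift_definition plus_kfun :: "kfun \<Rightarrow> kfun \<Rightarrow> kfun" is "(+)"
  using int_denoms_mult int_denoms_nonzero by fastforce
lift_definition minus_kfun :: "kfun \<Rightarrow> kfun \<Rightarrow> kfun" is "(-)"
  using int_denoms_mult int_denoms_nonzero by fastforce
lift_definition uminus_kfun :: "kfun \<Rightarrow> kfun" is uminus
  by force
lift_definition times_kfun :: "kfun \<Rightarrow> kfun \<Rightarrow> kfun" is "(*)"
  using int_denoms_mult by fastforce
lift_definition scaleC_kfun :: "complex \<Rightarrow> kfun \<Rightarrow> kfun" is "\<lambda>c F. Fract [:c:] 1 * F"
  by force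

instance
proof
  fix c d :: complex and x y :: kfun
  show "(c + d) *\<^sub>C x = c *\<^sub>C x + d *\<^sub>C x"
    by transfer (simp flip: distrib_right)
  show "c *\<^sub>C d *\<^sub>C x = (c * d) *\<^sub>C x"
  proof transfer
    fix c d :: complex and F :: "complex poly fract"
    have "Fract [:c:] 1 * Fract [:d:] 1 = Fract [:c * d:] 1"
      by (simp add: mult.commute)
    then show "Fract [:c:] 1 * (Fract [:d:] 1 * F) = Fract [:c * d:] 1 * F"
      by (simp only: mult.assoc[symmetric])
  qed
  show "1 *\<^sub>C x = x"
    by transfer (simp flip: one_pCons One_fract_def)
qed (transfer; simp add: algebra_simps)+

end

definition of_poly :: "complex poly \<Rightarrow> kfun" where "of_poly p = Abs_kfun (Fract p 1)"

text \<open>The function \<open>(\<tau> + n)\<^sup>-\<^sup>1\<close>.\<close>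

lift_definition pole :: "int \<Rightarrow> kfun" is "\<lambda>n. Fract 1 [:of_int n, 1:]"
  using int_denoms.mult[OF int_denoms.one] by (metis mult.right_neutral mem_Collect_eq)

abbreviation tau :: kfun where "tau \<equiv> of_poly [:0, 1:]"

abbreviation inv_tau :: kfun where "inv_tau \<equiv> pole 0"

definition K_sing :: "kfun set"
  where "K_sing = cspan {pole n ^ Suc k | n k. True}"

subsection \<open>Shift, derivative, reflection and trace\<close>

text \<open>
  A numerator and denominator, not necessarily coprime. The functions below do not depend on the
  choice (see \<open>fract_subst_Fract\<close> and \<open>fract_deriv_Fract\<close>); the values of \<open>kfun_eval\<close> depend
  on it at finitely many points only, so that its residues do not.
\<close>

definition some_quot :: "complex poly fract \<Rightarrow> complex poly \<times> complex poly"
  where "some_quot F = (SOME x. snd x \<noteq> 0 \<and> F = Fract (fst x) (snd x))"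

text \<open>Substitution \<open>F(\<tau>) \<mapsto> F(r(\<tau>))\<close>, for \<open>r\<close> of degree 1.\<close>

definition fract_subst :: "complex poly \<Rightarrow> complex poly fract \<Rightarrow> complex poly fract"
  where "fract_subst r F = (case some_quot F of (p, q) \<Rightarrow> Fract (pcompose p r) (pcompose q r))"

definition fract_deriv :: "complex poly fract \<Rightarrow> complex poly fract"
  where "fract_deriv F = (case some_quot F of (p, q) \<Rightarrow>
           Fract (pderiv p * q - p * pderiv q) (q ^ 2))"

lemma some_quot_Fract:
  assumes "q \<noteq> 0" "some_quot (Fract p q) = (p', q')"
  shows "p * q' = p' * (q :: complex poly)" "q' \<noteq> 0"
proof -
  have "\<exists>x. snd x \<noteq> 0 \<and> Fract p q = Fract (fst x) (snd x)"
    using assms(1) by (intro exI[of _ "(p, q)"]) simp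
  from someI_ex[OF this] have *: "q' \<noteq> 0" "Fract p q = Fract p' q'"
    using assms(2) unfolding some_quot_def by auto
  show "q' \<noteq> 0" by (rule *(1))
  with *(2) assms(1) show "p * q' = p' * q"
    by (simp add: eq_fract)
qed

lemma fract_subst_Fract:
  assumes "q \<noteq> 0" "degree r = 1"
  shows "fract_subst r (Fract p q) = Fract (pcompose p r) (pcompose q r)"
proof -
  obtain p' q' where pq: "some_quot (Fract p q) = (p', q')" by fastforce
  note * = some_quot_Fract[OF assms(1) pq]
  have "pcompose q r \<noteq> 0" "pcompose q' r \<noteq> 0"
    using assms *(2) by (simp_all add: pcompose_eq_0_iff)
  with *(1) show ?thesis
    by (simp add: fract_subst_def pq eq_fract flip: pcompose_mult)
qed

lemma fract_deriv_Fract: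
  assumes "q \<noteq> 0"
  shows "fract_deriv (Fract p q) = Fract (pderiv p * q - p * pderiv q) (q ^ 2)"
proof -
  obtain p' q' where pq: "some_quot (Fract p q) = (p', q')" by fastforce
  note * = some_quot_Fract[OF assms pq]
  have D: "pderiv p * q' + p * pderiv q' = pderiv p' * q + p' * pderiv q"
    using arg_cong[OF *(1), of pderiv] by (simp add: pderiv_mult algebra_simps)
  have "(pderiv p' * q' - p' * pderiv q') * q ^ 2 = (pderiv p * q - p * pderiv q) * q' ^ 2"
    using *(1) D by algebra
  then show ?thesis
    using assms *(2) by (simp add: fract_deriv_def pq eq_fract)
qed

lemma int_denoms_shift: "q \<in> int_denoms \<Longrightarrow> pcompose q [:of_int n, 1:] \<in> int_denoms"
proof (induction rule: int_denoms.induct)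
  case one
  then show ?case by (simp add: pcompose_1 int_denoms.one)
next
  case (mult q k)
  from int_denoms.mult[OF mult.IH, of "k + n"] show ?case
    by (simp add: pcompose_mult pcompose_pCons add.commute del: mult_pCons_left)
qed

lemma int_denoms_reflect:
  "q \<in> int_denoms \<Longrightarrow> pcompose q [:0, -1:] \<in> int_denoms \<or> - pcompose q [:0, -1:] \<in> int_denoms"
proof (induction rule: int_denoms.induct)
  case one
  then show ?case by (simp add: pcompose_1 int_denoms.one)
next
  case (mult q k)
  have "pcompose ([:of_int k, 1:] * q) [:0, -1:] = - ([:of_int (- k), 1:] * pcompose q [:0, -1:])"
    by (simp add: pcompose_mult pcompose_pCons del: mult_pCons_left flip: mult_minus_left)
  moreover have "[:of_int (- k), 1:] * - pcompose q [:0, -1:]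
      = - ([:of_int (- k), 1:] * pcompose q [:0, -1:])"
    by (rule mult_minus_right)
  ultimately show ?case
    using mult.IH int_denoms.mult[of "pcompose q [:0, -1:]" "- k"]
      int_denoms.mult[of "- pcompose q [:0, -1:]" "- k"]
    by (metis minus_minus)
qed

lemma fract_shift_closed:
  assumes "q \<in> int_denoms"
  shows "\<exists>p' q'. fract_subst [:of_int n, 1:] (Fract p q) = Fract p' q' \<and> q' \<in> int_denoms"
proof -
  have "fract_subst [:of_int n, 1:] (Fract p q)
      = Fract (pcompose p [:of_int n, 1:]) (pcompose q [:of_int n, 1:])"
    using assms by (simp add: fract_subst_Fract int_denoms_nonzero)
  with int_denoms_shift[OF assms] show ?thesis by blast
qed

text \<open>The operator \<open>T\<^sup>n\<close>.\<close>

lift_definition shift :: "int \<Rightarrow> kfun \<Rightarrow> kfun" is "\<lambda>n. fract_subst [:of_int n, 1:]"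
  using fract_shift_closed by blast

lemma fract_reflect_closed:
  assumes "q \<in> int_denoms"
  shows "\<exists>p' q'. fract_subst [:0, -1:] (Fract p q) = Fract p' q' \<and> q' \<in> int_denoms"
proof -
  let ?p = "pcompose p [:0, -1:]" and ?q = "pcompose q [:0, -1:]"
  have "fract_subst [:0, -1:] (Fract p q) = Fract ?p ?q"
    using assms by (simp add: fract_subst_Fract int_denoms_nonzero)
  moreover have "Fract ?p ?q = Fract (- ?p) (- ?q)" by simp
  ultimately show ?thesis
    using int_denoms_reflect[OF assms] by metis
qed

text \<open>The function \<open>F(-\<tau>)\<close>.\<close>

lift_definition reflect :: "kfun \<Rightarrow> kfun" is "fract_subst [:0, -1:]"
  using fract_reflect_closed by blast

lemma fract_deriv_closed:
  assumes "q \<in> int_denoms"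
  shows "\<exists>p' q'. fract_deriv (Fract p q) = Fract p' q' \<and> q' \<in> int_denoms"
  using int_denoms_mult[OF assms assms] fract_deriv_Fract[OF int_denoms_nonzero[OF assms], of p]
  unfolding power2_eq_square by blast

lift_definition kderiv :: "kfun \<Rightarrow> kfun" is fract_deriv
  using fract_deriv_closed by blast

definition kfun_eval :: "kfun \<Rightarrow> complex \<Rightarrow> complex"
  where "kfun_eval F z = (case some_quot (Rep_kfun F) of (p, q) \<Rightarrow> poly p z / poly q z)"

text \<open>\<open>Sum_any\<close> sums over the finite set of integers with nonzero residue.\<close>

definition Tr :: "kfun \<Rightarrow> complex"
  where "Tr F = Sum_any (\<lambda>n::int. residue (kfun_eval F) (of_int n))"


section \<open>The Hopf algebra of shifts and derivations\<close>

text \<open>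
  Elements of \<open>H\<^sub>T[\<partial>\<^sub>\<tau>]\<close> are written in the monomials \<open>T\<^sup>n \<partial>\<^sub>\<tau>\<^sup>k\<close>, indexed by pairs \<open>(n, k)\<close>.
\<close>

type_synonym hhat = "int \<times> nat \<Rightarrow>\<^sub>0 complex"

definition Tpow :: "int \<Rightarrow> hhat" where "Tpow n = Poly_Mapping.single (n, 0) 1"

definition Dtau :: hhat where "Dtau = Poly_Mapping.single (0, 1) 1"

definition H_T :: "hhat set" where "H_T = cspan (range Tpow)"

definition antipode :: "hhat \<Rightarrow> hhat"
  where "antipode = lin_ext (\<lambda>(n, k). Tpow (- n) * (- Dtau) ^ k)"

text \<open>The algebra homomorphism for which \<open>T\<close> is grouplike and \<open>\<partial>\<^sub>\<tau>\<close> is primitive.\<close>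

definition coproduct :: "hhat \<Rightarrow> (hhat, hhat) tensor"
  where "coproduct = lin_ext (\<lambda>(n, k).
           (Tpow n \<otimes>\<^sub>C Tpow n) * (Dtau \<otimes>\<^sub>C 1 + 1 \<otimes>\<^sub>C Dtau) ^ k)"

definition hact :: "hhat \<Rightarrow> kfun \<Rightarrow> kfun"
  where "hact h F = lin_ext (\<lambda>(n, k). shift n ((kderiv ^^ k) F)) h"


section \<open>Distributions, fields and vertex algebras\<close>

text \<open>A kernel \<open>\<Sum>\<^sub>i w\<^sub>i \<otimes> F\<^sub>i\<close> is given by the list of pairs \<open>(w\<^sub>i, F\<^sub>i)\<close>.\<close>

definition singular_kernel :: "(kfun \<Rightarrow> 'w::complex_vector) \<Rightarrow> ('w \<times> kfun) list \<Rightarrow> bool"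
  where "singular_kernel D ws \<longleftrightarrow>
     snd ` set ws \<subseteq> K_sing \<and>
     (\<forall>p. D (of_poly p) = (\<Sum>(w, F)\<leftarrow>ws. Tr (F * of_poly p) *\<^sub>C w))"

definition rational_singularities :: "(kfun \<Rightarrow> 'w::complex_vector) \<Rightarrow> bool"
  where "rational_singularities D \<longleftrightarrow> clinear D \<and> (\<exists>ws. singular_kernel D ws)"

definition is_field :: "(kfun \<Rightarrow> 'v \<Rightarrow> 'v::complex_vector) \<Rightarrow> bool"
  where "is_field f \<longleftrightarrow> (\<forall>F. clinear (f F)) \<and> (\<forall>v. rational_singularities (\<lambda>G. f G v))"

text \<open>The element \<open>F(\<tau>\<^sub>1 - \<tau>\<^sub>2)\<close> of \<open>K \<otimes> K\<close>.\<close>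

definition poly_at_difference :: "complex poly \<Rightarrow> (kfun, kfun) tensor"
  where "poly_at_difference F = poly (map_poly (\<lambda>c. c *\<^sub>C 1) F) (tau \<otimes>\<^sub>C 1 - 1 \<otimes>\<^sub>C tau)"

definition mutually_rational ::
    "(kfun \<Rightarrow> 'v \<Rightarrow> 'v::complex_vector) \<Rightarrow> (kfun \<Rightarrow> 'v \<Rightarrow> 'v) \<Rightarrow> bool"
  where "mutually_rational f g \<longleftrightarrow>
     (\<exists>F\<in>int_denoms. \<forall>t v.
        tensor_lift (\<lambda>G G'. f G (g G' v) - g G' (f G v)) (poly_at_difference F * t) = 0)"

text \<open>The linear map on \<open>K\<close> that vanishes on polynomials and maps \<open>S(h) 1/\<tau>\<close> to \<open>\<phi> h\<close>.\<close>

definition sing_map :: "(hhat \<Rightarrow> 'w::complex_vector) \<Rightarrow> kfun \<Rightarrow> 'w"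
  where "sing_map \<phi> = (THE r. clinear r \<and> (\<forall>p. r (of_poly p) = 0) \<and>
           (\<forall>h. r (hact (antipode h) inv_tau) = \<phi> h))"

locale HT_vertex_algebra_data =
  fixes vac :: "'v::complex_vector"
    and Y :: "'v \<Rightarrow> kfun \<Rightarrow> 'v \<Rightarrow> 'v"
begin

definition state_act :: "hhat \<Rightarrow> 'v \<Rightarrow> 'v"
  where "state_act h f = Y f (hact (antipode h) inv_tau) vac"

definition Y_S :: "'v \<Rightarrow> 'v \<Rightarrow> kfun \<Rightarrow> 'v"
  where "Y_S g f F = - Y g (reflect F) f"

definition R_V :: "'v \<Rightarrow> kfun \<Rightarrow> 'v"
  where "R_V v = sing_map (\<lambda>h. state_act h v)"

definition R_hol :: "(kfun \<Rightarrow> 'v) \<Rightarrow> kfun \<Rightarrow> 'v"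
  where "R_hol D = sing_map (\<lambda>h.
           tensor_lift (\<lambda>h' h''. state_act h' (D (hact (antipode h'') inv_tau))) (coproduct h))"

text \<open>\<open>\<R>\<^sub>V(\<tau>) D\<close> for a distribution \<open>D\<close> with singular kernel \<open>ws\<close>.\<close>

definition R_apply :: "('v \<times> kfun) list \<Rightarrow> (kfun \<Rightarrow> 'v) \<Rightarrow> kfun \<Rightarrow> 'v"
  where "R_apply ws D G = (\<Sum>(v, F)\<leftarrow>ws. R_V v (F * G)) + R_hol D G"

end

locale HT_vertex_algebra = HT_vertex_algebra_data vac Y
  for vac :: "'v::complex_vector" and Y :: "'v \<Rightarrow> kfun \<Rightarrow> 'v \<Rightarrow> 'v" +
  assumes Y_field: "is_field (Y f)"
    and Y_linear: "clinear (\<lambda>f. Y f F v)"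
    and vacuum: "Y vac F v = Tr F *\<^sub>C v"
    and creation_pol: "Y f (of_poly p) vac = 0"
    and creation: "Y f inv_tau vac = f"
    and covariance: "h \<in> H_T \<Longrightarrow> Y f (hact (antipode h) F) = Y (state_act h f) F"
    and skew_symmetry: "singular_kernel (Y_S g f) ws \<Longrightarrow> Y f G g = R_apply ws (Y_S g f) G"
    and mutual_rationality: "mutually_rational (Y f) (Y g)"


section \<open>The vacuum module of the loop algebra\<close>

type_synonym 'g loop = "('g, kfun) tensor"

text \<open>The Lie subalgebra of \<open>\<gg> \<otimes> K\<close> spanned by the \<open>X \<otimes> p\<close> with polynomial \<open>p\<close>.\<close>

typedef (overloaded) 'g loop_ann =
    "cspan {X \<otimes>\<^sub>C of_poly p | X p. True} :: 'g::complex_lie_algebra loop set"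
  by (rule exI[of _ 0]) (rule complex_vector.span_zero)

setup_lifting type_definition_loop_ann

lemma of_poly_mult: "of_poly p * of_poly q = of_poly (p * q)"
proof -
  have "Fract p 1 \<in> {Fract p q | p q. q \<in> int_denoms}" for p
    using int_denoms.one by blast
  then show ?thesis
    by (simp add: of_poly_def times_kfun_def Abs_kfun_inverse)
qed

lemma clinear_lie_bracket:
  "clinear (lie_bracket x)" "clinear (\<lambda>x. lie_bracket x (y :: 'l::complex_lie_algebra))"
  by (auto intro!: clinearI simp: lie_add_left lie_add_right lie_scale_left lie_scale_right)

lemma loop_ann_closed:
  assumes "s \<in> cspan {X \<otimes>\<^sub>C of_poly p | X p. True}" "t \<in> cspan {X \<otimes>\<^sub>C of_poly p | X p. True}"
  shows "lie_bracket s t \<in> cspan {X \<otimes>\<^sub>C of_poly p | (X :: 'g::complex_lie_algebra) p. True}"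
proof (rule clinear_preserves_span[OF clinear_lie_bracket(2) _ assms(1)])
  fix s :: "'g loop" assume s: "s \<in> {X \<otimes>\<^sub>C of_poly p | X p. True}"
  show "lie_bracket s t \<in> cspan {X \<otimes>\<^sub>C of_poly p | X p. True}"
  proof (rule clinear_preserves_span[OF clinear_lie_bracket(1) _ assms(2)])
    fix t :: "'g loop" assume "t \<in> {X \<otimes>\<^sub>C of_poly p | X p. True}"
    with s obtain X p Y q where "s = X \<otimes>\<^sub>C of_poly p" "t = Y \<otimes>\<^sub>C of_poly q" by blast
    then have "lie_bracket s t = lie_bracket X Y \<otimes>\<^sub>C of_poly (p * q)"
      by (simp only: lie_tensor of_poly_mult)
    then show "lie_bracket s t \<in> cspan {X \<otimes>\<^sub>C of_poly p | X p. True}"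
      by (intro complex_vector.span_base) blast
  qed
qed

instantiation loop_ann :: (complex_lie_algebra) complex_lie_algebra
begin

lift_definition zero_loop_ann :: "'a loop_ann" is 0 by (rule complex_vector.span_zero)
lift_definition plus_loop_ann :: "'a loop_ann \<Rightarrow> 'a loop_ann \<Rightarrow> 'a loop_ann" is "(+)"
  by (rule complex_vector.span_add)
lift_definition minus_loop_ann :: "'a loop_ann \<Rightarrow> 'a loop_ann \<Rightarrow> 'a loop_ann" is "(-)"
  by (rule complex_vector.span_diff)
lift_definition uminus_loop_ann :: "'a loop_ann \<Rightarrow> 'a loop_ann" is uminus
  by (rule complex_vector.span_neg)
lift_definition scaleC_loop_ann :: "complex \<Rightarrow> 'a loop_ann \<Rightarrow> 'a loop_ann" is scaleC
  by (rule complex_vector.span_scale)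
lift_definition lie_bracket_loop_ann :: "'a loop_ann \<Rightarrow> 'a loop_ann \<Rightarrow> 'a loop_ann"
  is lie_bracket by (rule loop_ann_closed)

instance
  by standard
     (transfer; simp add: add.assoc add.left_commute scaleC_add_right scaleC_add_left
        scaleC_scaleC scaleC_one lie_add_left lie_add_right lie_scale_left lie_scale_right lie_self
        lie_jacobi[unfolded add.assoc])+

end

text \<open>
  The homomorphism \<open>\<U>(\<L>\<gg>\<^sub>a\<^sub>n\<^sub>n) \<rightarrow> \<U>(\<L>\<gg>)\<close> induced by the inclusion, and the homomorphism
  \<open>\<U>(\<L>\<gg>\<^sub>a\<^sub>n\<^sub>n) \<rightarrow> \<complex> = End \<complex>\<close> through which \<open>\<U>(\<L>\<gg>\<^sub>a\<^sub>n\<^sub>n)\<close> acts on the trivial module.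
\<close>

definition ann_incl :: "'g::complex_lie_algebra loop_ann uea \<Rightarrow> 'g loop uea"
  where "ann_incl = uea_lift (\<lambda>x. uea_gen (Rep_loop_ann x))"

definition ann_trivial :: "'g::complex_lie_algebra loop_ann uea \<Rightarrow> complex"
  where "ann_trivial = uea_lift (\<lambda>_. 0)"

text \<open>The relations making the tensor product over \<open>\<complex>\<close> balanced over \<open>\<U>(\<L>\<gg>\<^sub>a\<^sub>n\<^sub>n)\<close>.\<close>

definition balancing_rels :: "('g::complex_lie_algebra loop uea, complex) tensor set"
  where "balancing_rels = {(u * ann_incl a) \<otimes>\<^sub>C z - u \<otimes>\<^sub>C (ann_trivial a * z) | u a z. True}"

quotient_type (overloaded) 'g vacuum_module =
    "('g::complex_lie_algebra loop uea, complex) tensor"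
  / "\<lambda>s t. s - t \<in> cspan balancing_rels"
  by (rule equivp_mod_span)

instantiation vacuum_module :: (complex_lie_algebra) complex_vector
begin

lift_definition zero_vacuum_module :: "'a vacuum_module" is 0 .
lift_definition plus_vacuum_module :: "'a vacuum_module \<Rightarrow> 'a vacuum_module \<Rightarrow> 'a vacuum_module"
  is "(+)" by (rule mod_span_add)
lift_definition minus_vacuum_module :: "'a vacuum_module \<Rightarrow> 'a vacuum_module \<Rightarrow> 'a vacuum_module"
  is "(-)" by (rule mod_span_diff)
lift_definition uminus_vacuum_module :: "'a vacuum_module \<Rightarrow> 'a vacuum_module"
  is uminus by (rule mod_span_neg)
lift_definition scaleC_vacuum_module :: "complex \<Rightarrow> 'a vacuum_module \<Rightarrow> 'a vacuum_module"
  is scaleC by (rule mod_span_scale)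

instance
  by standard
     (transfer; simp add: complex_vector.span_zero algebra_simps scaleC_add_right scaleC_add_left)+

end

definition induced_tensor ::
    "'g::complex_lie_algebra loop uea \<Rightarrow> complex \<Rightarrow> 'g vacuum_module"
  where "induced_tensor u z = abs_vacuum_module (u \<otimes>\<^sub>C z)"

definition vacuum_vector :: "'g::complex_lie_algebra vacuum_module"
  where "vacuum_vector = induced_tensor 1 1"

definition uea_act ::
    "'g::complex_lie_algebra loop uea \<Rightarrow> 'g vacuum_module \<Rightarrow> 'g vacuum_module"
  where "uea_act u v =
    abs_vacuum_module (tensor_lift (\<lambda>x z. (u * x) \<otimes>\<^sub>C z) (rep_vacuum_module v))"

lemma uea_act_induced_tensor: "uea_act u (induced_tensor x z) = induced_tensor (u * x) z"
proof -
  let ?f = "\<lambda>x z. (u * x) \<otimes>\<^sub>C (z :: complex)"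
  let ?s = "rep_vacuum_module (abs_vacuum_module (x \<otimes>\<^sub>C z))"
  have "?s - x \<otimes>\<^sub>C z \<in> cspan balancing_rels"
    by (rule Quotient3_rep_abs[OF Quotient3_vacuum_module]) (simp add: complex_vector.span_zero)
  have b: "cbilinear ?f"
    by (intro cbilinearI) (simp_all add: tensor_bilinear algebra_simps mult_scaleC_right)
  have "tensor_lift ?f (?s - x \<otimes>\<^sub>C z) \<in> cspan balancing_rels"
  proof (rule clinear_preserves_span[OF clinear_tensor_lift[OF b] _ \<open>?s - x \<otimes>\<^sub>C z \<in> _\<close>])
    fix r :: "('a loop uea, complex) tensor" assume "r \<in> balancing_rels"
    then obtain v a z where "r = (v * ann_incl a) \<otimes>\<^sub>C z - v \<otimes>\<^sub>C (ann_trivial a * z)"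
      unfolding balancing_rels_def by blast
    then have "tensor_lift ?f r = (u * v * ann_incl a) \<otimes>\<^sub>C z - (u * v) \<otimes>\<^sub>C (ann_trivial a * z)"
      by (simp add: clinear_diff[OF clinear_tensor_lift[OF b]] tensor_lift_tensor[OF b] mult.assoc)
    then show "tensor_lift ?f r \<in> cspan balancing_rels"
      unfolding balancing_rels_def by (intro complex_vector.span_base) blast
  qed
  then have "tensor_lift ?f ?s - (u * x) \<otimes>\<^sub>C z \<in> cspan balancing_rels"
    by (simp add: clinear_diff[OF clinear_tensor_lift[OF b]] tensor_lift_tensor[OF b])
  then show ?thesis
    by (simp add: uea_act_def induced_tensor_def vacuum_module.abs_eq_iff)
qed

text \<open>The action of \<open>X\<^bsub>{F}\<^esub> = X \<otimes> F\<close>.\<close>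

definition current :: "'g::complex_lie_algebra \<Rightarrow> kfun \<Rightarrow> 'g vacuum_module \<Rightarrow> 'g vacuum_module"
  where "current X F = uea_act (uea_gen (X \<otimes>\<^sub>C F))"


end

(*
  Applied to a vector, a current X_{F} depends only on finitely many Laurent coefficients of F at the
  integers, and the coefficients of this dependence are unique; this defines operators
  "X_{(tau - k)^m}" for each integer k, although such functions, supported at one integer, are not
  in K. They commute for distinct k, and for a fixed k they bracket like the modes of an ordinary
  current. So the currents at all integers generate an ordinary vertex algebra: by Dong's lemma their
  iterated products are mutually local, and by Goddard's uniqueness theorem these are determined by
  the states they create, hence every state a has exactly one field A(a). With the translation T of
  states, put
    Y(a)(F) = sum over the integers n of the residue at n of F times A(T^n a).
  Two fields commute once one of them is translated far enough, and the orders of locality at the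
  remaining translates give the polynomial of mutual rationality. At the integer n the operator R_V
  is T^n exp((tau - n) D), D being the derivation of states, so skew-symmetry for Y is ordinary
  skew-symmetry for A.
*)

theory Submission
  imports Defs
begin

section \<open>Laurent expansions of rational functions with integer poles\<close>

text \<open>The local modes exist because a polynomial can be prescribed to finite order at finitely
  many integers. Hence a distribution with only finitely many Laurent coefficients of nonnegative
  index determines all its coefficients, and an identity between currents X_{F} for arbitrary F may
  be compared coefficient by coefficient. Bracket, translation and derivative rules of the modes all
  arise this way. The same finiteness is needed to define Y(a)(F) b: for |n| large the field of T^n
  a commutes with the field creating b, so its nonnegative modes kill b. Skew-symmetry is demanded
  for every singular kernel of a distribution D, but a kernel only records the values of D on
  polynomials. The coefficients of D are therefore split into those of the kernel and a remainder of
  negative index. That this remainder gives the values of D on K_Sing, hence D_Hol, is the residue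
  theorem: a product of two elements of K_Sing is O(tau^-2) at infinity, so its trace vanishes. On
  coefficients R_V is additive, and its two defining clauses are the images of the two
  summands.\<close>

lemma Rep_of_poly: "Rep_kfun (of_poly p) = Fract p 1"
proof -
  have "Fract p 1 \<in> {Fract p q | p q. q \<in> int_denoms}"
    using int_denoms.one by blast
  then show ?thesis by (simp add: of_poly_def Abs_kfun_inverse)
qed

lemma of_poly_add: "of_poly (p + q) = of_poly p + of_poly q"
  by (rule Rep_kfun_inject[THEN iffD1]) (simp add: plus_kfun.rep_eq Rep_of_poly)

lemma of_poly_smult: "of_poly (smult c p) = c *\<^sub>C of_poly p"
  by (rule Rep_kfun_inject[THEN iffD1]) (simp add: scaleC_kfun.rep_eq Rep_of_poly)

lemma of_poly_1: "of_poly 1 = 1"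
  by (rule Rep_kfun_inject[THEN iffD1]) (simp add: one_kfun.rep_eq Rep_of_poly One_fract_def)

lemma of_poly_const: "of_poly [:c:] = c *\<^sub>C 1"
  using of_poly_smult[of c 1] by (simp add: of_poly_1)

lemma of_poly_0: "of_poly 0 = 0"
  using of_poly_smult[of 0 0] by simp

lemma of_poly_power: "of_poly (p ^ k) = of_poly p ^ k"
  by (induction k) (simp_all add: of_poly_1 flip: of_poly_mult)

lemma pole_inverse: "pole n * of_poly [:of_int n, 1:] = 1"
  by (rule Rep_kfun_inject[THEN iffD1])
     (simp add: times_kfun.rep_eq pole.rep_eq Rep_of_poly one_kfun.rep_eq One_fract_def eq_fract)

lemma pole_mult_pole:
  assumes "m \<noteq> n"
  shows "pole m * pole n = (1 / of_int (n - m)) *\<^sub>C (pole m - pole n)"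
proof -
  have "of_poly [:of_int n, 1:] - of_poly [:of_int m, 1:] = of_poly [:of_int (n - m):]"
  proof -
    have "of_poly [:of_int n, 1:] = of_poly [:of_int m, 1:] + of_poly [:of_int (n - m):]"
      by (simp flip: of_poly_add)
    then show ?thesis by simp
  qed
  then have "pole m * pole n * (of_poly [:of_int n, 1:] - of_poly [:of_int m, 1:])
      = of_int (n - m) *\<^sub>C (pole m * pole n)"
    by (simp add: of_poly_const mult_scaleC_right del: of_int_diff)
  moreover have "pole m * pole n * (of_poly [:of_int n, 1:] - of_poly [:of_int m, 1:])
      = pole m * (pole n * of_poly [:of_int n, 1:]) - pole n * (pole m * of_poly [:of_int m, 1:])"
    by (simp add: algebra_simps)
  ultimately have "of_int (n - m) *\<^sub>C (pole m * pole n) = pole m - pole n"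
    by (simp add: pole_inverse)
  then have "(1 / of_int (n - m)) *\<^sub>C (of_int (n - m) *\<^sub>C (pole m * pole n))
      = (1 / of_int (n - m)) *\<^sub>C (pole m - pole n)" by simp
  then show ?thesis using assms by (simp only: scaleC_scaleC) (simp add: scaleC_one)
qed

lemma of_poly_mult_pole:
  "of_poly p * pole n = of_poly (synthetic_div p (- of_int n)) + poly p (- of_int n) *\<^sub>C pole n"
proof -
  have "p = [:of_int n, 1:] * synthetic_div p (- of_int n) + [:poly p (- of_int n):]"
    using synthetic_div_correct'[of "- of_int n" p] by simp
  then have "of_poly p * pole n
     = of_poly ([:of_int n, 1:] * synthetic_div p (- of_int n) + [:poly p (- of_int n):]) * pole n"
    by simp
  also have "\<dots> = (pole n * of_poly [:of_int n, 1:]) * of_poly (synthetic_div p (- of_int n))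
      + of_poly [:poly p (- of_int n):] * pole n"
    by (simp only: of_poly_add distrib_right) (simp only: of_poly_mult[symmetric] ac_simps)
  finally show ?thesis
    by (simp add: pole_inverse of_poly_const mult_scaleC_left)
qed

section \<open>Partial fractions\<close>

definition kbasis :: "kfun set"
  where "kbasis = range of_poly \<union> {pole n ^ Suc k | n k. True}"

lemma K_sing_pole_power: "pole n ^ Suc k \<in> K_sing"
  unfolding K_sing_def by (rule complex_vector.span_base) blast

lemma K_sing_closed:
  "F \<in> K_sing \<Longrightarrow> G \<in> K_sing \<Longrightarrow> F + G \<in> K_sing"
  "F \<in> K_sing \<Longrightarrow> G \<in> K_sing \<Longrightarrow> F - G \<in> K_sing"
  "F \<in> K_sing \<Longrightarrow> c *\<^sub>C F \<in> K_sing" "0 \<in> K_sing"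
  unfolding K_sing_def
  by (rule complex_vector.span_add complex_vector.span_diff complex_vector.span_scale
      complex_vector.span_zero; assumption?)+

lemma K_sing_induct [consumes 1, case_names zero pole add scale]:
  assumes "F \<in> K_sing" "P 0" "\<And>n k. P (pole n ^ Suc k)"
    "\<And>F G. P F \<Longrightarrow> P G \<Longrightarrow> P (F + G)" "\<And>c F. P F \<Longrightarrow> P (c *\<^sub>C F)"
  shows "P F"
  using assms(1) unfolding K_sing_def
  by (induction rule: complex_vector.span_induct_alt) (use assms in blast)+

lemma pole_power_mult_pole_neq:
  assumes "m \<noteq> n"
  shows "pole m ^ Suc (Suc k) * pole n
    = (1 / of_int (n - m)) *\<^sub>C (pole m ^ Suc (Suc k) - pole m ^ Suc k * pole n)"
proof -
  have "pole m ^ Suc (Suc k) * pole n = pole m ^ Suc k * (pole m * pole n)"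
    by (simp add: mult_ac)
  also have "\<dots> = (1 / of_int (n - m)) *\<^sub>C (pole m ^ Suc (Suc k) - pole m ^ Suc k * pole n)"
    using assms by (simp add: pole_mult_pole mult_scaleC_right right_diff_distrib mult_ac)
  finally show ?thesis .
qed

text \<open>For distinct poles each step of the induction trades the product for terms with a lower
  power of \<open>pole m\<close>. Abstractly, \<open>K_sing\<close> consists of the functions in K
  vanishing at infinity, and these are closed under products.\<close>

lemma pole_power_mult_pole: "pole m ^ Suc k * pole n \<in> K_sing"
proof (cases "m = n")
  case True
  then have "pole m ^ Suc k * pole n = pole n ^ Suc (Suc k)"
    by (simp add: mult_ac)
  then show ?thesis by (simp only: K_sing_pole_power)
next
  case False
  show ?thesis
  proof (induction k)
    case 0
    show ?case
      using False K_sing_pole_power[of m 0] K_sing_pole_power[of n 0]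
      by (simp add: pole_mult_pole K_sing_closed)
  next
    case (Suc k)
    show ?case unfolding pole_power_mult_pole_neq[OF False]
      by (intro K_sing_closed Suc.IH K_sing_pole_power)
  qed
qed

lemma K_sing_mult_pole: "F \<in> K_sing \<Longrightarrow> F * pole n \<in> K_sing"
  by (induction rule: K_sing_induct)
     (simp_all only: pole_power_mult_pole distrib_right mult_scaleC_left K_sing_closed mult_zero_left)

text \<open>Existence of partial fractions by induction on the denominator: one more linear factor
  is multiplication by some \<open>pole k\<close>, and the span of \<open>kbasis\<close> is stable
  under this.\<close>

lemma cspan_kbasis: "F \<in> cspan kbasis"
proof -
  have sub: "K_sing \<subseteq> cspan kbasis"
    unfolding K_sing_def by (intro complex_vector.span_mono) (auto simp: kbasis_def)
  have closed: "G * pole n \<in> cspan kbasis" if "G \<in> cspan kbasis" for G n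
  proof (rule clinear_preserves_span[where f = "\<lambda>F. F * pole n", OF _ _ that])
    show "clinear (\<lambda>F. F * pole n)"
      by (rule clinearI) (simp_all only: distrib_right mult_scaleC_left)
    fix G assume "G \<in> kbasis"
    then consider p where "G = of_poly p" | m k where "G = pole m ^ Suc k"
      unfolding kbasis_def by blast
    then show "G * pole n \<in> cspan kbasis"
    proof cases
      case 1
      have "pole n ^ Suc 0 \<in> kbasis" unfolding kbasis_def by blast
      then show ?thesis unfolding 1 of_poly_mult_pole
        by (intro complex_vector.span_add complex_vector.span_scale complex_vector.span_base)
           (auto simp: kbasis_def)
    next
      case 2
      then show ?thesis using sub pole_power_mult_pole by blast
    qed
  qed
  obtain p q where F: "Rep_kfun F = Fract p q" "q \<in> int_denoms"
    using Rep_kfun[of F] by auto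
  have "Abs_kfun (Fract p q) \<in> cspan kbasis" using F(2)
  proof (induction rule: int_denoms.induct)
    case one
    then show ?case
      by (intro complex_vector.span_base) (auto simp: kbasis_def of_poly_def)
  next
    case (mult q k)
    have *: "Fract p q \<in> {Fract p q | p q. q \<in> int_denoms}" 
       "Fract 1 [:of_int k, 1:] \<in> {Fract p q | p q. q \<in> int_denoms}"
      using mult.hyps int_denoms.mult[OF int_denoms.one, of k] by fastforce+
    have "Abs_kfun (Fract p ([:of_int k, 1:] * q)) = Abs_kfun (Fract p q * Fract 1 [:of_int k, 1:])"
      by (simp add: mult.commute)
    also have "\<dots> = Abs_kfun (Fract p q) * pole k"
      using * by (simp add: times_kfun_def pole_def Abs_kfun_inverse)
    finally show ?case using closed[OF mult.IH] by simp
  qed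
  then show ?thesis by (metis F(1) Rep_kfun_inverse)
qed

lemma kfun_induct [case_names poly pole add scale]:
  assumes "\<And>p. P (of_poly p)" "\<And>n k. P (pole n ^ Suc k)"
    "\<And>F G. P F \<Longrightarrow> P G \<Longrightarrow> P (F + G)" "\<And>c F. P F \<Longrightarrow> P (c *\<^sub>C F)"
  shows "P F"
  using cspan_kbasis[of F]
proof (induction rule: complex_vector.span_induct_alt)
  case base
  show ?case using assms(1)[of 0] by (simp add: of_poly_0)
next
  case (step c x y)
  then show ?case using assms unfolding kbasis_def by blast
qed

section \<open>Laurent expansions at the integers\<close>

definition loc_poly :: "int \<Rightarrow> complex poly \<Rightarrow> complex fls"
  where "loc_poly n p = fps_to_fls (fps_of_poly (pcompose p [:of_int n, 1:]))"

text \<open>The Laurent expansion of \<open>F\<close> at the integer \<open>n\<close>, in the variable \<open>\<tau> - n\<close>.\<close>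

definition loc :: "kfun \<Rightarrow> int \<Rightarrow> complex fls"
  where "loc F n = (case some_quot (Rep_kfun F) of (p, q) \<Rightarrow> loc_poly n p / loc_poly n q)"

abbreviation cf :: "kfun \<Rightarrow> int \<Rightarrow> int \<Rightarrow> complex"
  where "cf F n m \<equiv> fls_nth (loc F n) m"

lemma loc_poly_hom:
  "loc_poly n (p + q) = loc_poly n p + loc_poly n q"
  "loc_poly n (p * q) = loc_poly n p * loc_poly n q"
  "loc_poly n 1 = 1" "loc_poly n [:c:] = fls_const c"
  by (simp_all add: loc_poly_def pcompose_add pcompose_mult fps_of_poly_add fps_of_poly_mult
      fps_to_fls_plus fls_times_fps_to_fls pcompose_1 fps_of_poly_const fps_const_to_fls)

lemma loc_poly_eq_0: "loc_poly n p = 0 \<longleftrightarrow> p = 0"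
  using fps_of_poly_eq_iff[of "pcompose p [:of_int n, 1:]" 0]
  by (simp add: loc_poly_def pcompose_eq_0_iff)

lemma loc_eq:
  assumes "Rep_kfun F = Fract p q" "q \<noteq> 0"
  shows "loc F n = loc_poly n p / loc_poly n q"
proof -
  obtain p' q' where pq: "some_quot (Rep_kfun F) = (p', q')" by fastforce
  note * = some_quot_Fract[OF assms(2) pq[unfolded assms(1)]]
  have "loc_poly n p * loc_poly n q' = loc_poly n p' * loc_poly n q"
    using *(1) by (simp flip: loc_poly_hom)
  moreover have "loc_poly n q \<noteq> 0" "loc_poly n q' \<noteq> 0"
    using *(2) assms(2) by (simp_all add: loc_poly_eq_0)
  ultimately show ?thesis
    by (simp add: loc_def pq field_simps)
qed

lemma kfun_cases:
  obtains p q where "Rep_kfun F = Fract p q" "q \<in> int_denoms" "q \<noteq> 0"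
  using Rep_kfun[of F] int_denoms_nonzero by fastforce

lemma loc_hom:
  "loc (F + G) n = loc F n + loc G n"
  "loc (F * G) n = loc F n * loc G n"
proof -
  obtain p q p' q' where *: "Rep_kfun F = Fract p q" "q \<noteq> 0" "Rep_kfun G = Fract p' q'" "q' \<noteq> 0"
    using kfun_cases by metis
  have **: "Rep_kfun (F + G) = Fract (p * q' + p' * q) (q * q')"
    "Rep_kfun (F * G) = Fract (p * p') (q * q')"
    using * by (simp_all add: plus_kfun.rep_eq times_kfun.rep_eq)
  have "loc_poly n q \<noteq> 0" "loc_poly n q' \<noteq> 0"
    using *(2,4) by (simp_all add: loc_poly_eq_0)
  then show "loc (F + G) n = loc F n + loc G n" "loc (F * G) n = loc F n * loc G n"
    using * by (simp_all add: loc_eq[OF **(1)] loc_eq[OF **(2)] loc_eq[OF *(1)] loc_eq[OF *(3)]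
        loc_poly_hom field_simps)
qed

lemma loc_of_poly: "loc (of_poly p) n = loc_poly n p"
  by (simp add: loc_eq[OF Rep_of_poly] loc_poly_hom)

lemma loc_scaleC: "loc (c *\<^sub>C F) n = fls_const c * loc F n"
proof -
  have "c *\<^sub>C F = of_poly [:c:] * F"
    by (simp add: of_poly_const mult_scaleC_left)
  then show ?thesis by (simp add: loc_hom loc_of_poly loc_poly_hom)
qed

lemma loc_1: "loc 1 n = 1"
  using loc_of_poly[of 1] by (simp add: of_poly_1 loc_poly_hom)

lemma loc_power: "loc (F ^ k) n = loc F n ^ k"
  by (induction k) (simp_all add: loc_1 loc_hom)

lemma cf_add: "cf (F + G) n m = cf F n m + cf G n m"
  by (simp add: loc_hom)

lemma cf_scaleC: "cf (c *\<^sub>C F) n m = c * cf F n m"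
  by (simp add: loc_scaleC)

lemma cf_of_poly_neg: "m < 0 \<Longrightarrow> cf (of_poly p) n m = 0"
  by (simp add: loc_of_poly loc_poly_def)

lemma loc_poly_linear: "loc_poly n [:a, 1:] = fls_const (a + of_int n) + fls_X"
proof -
  have "fps_of_poly [:a + of_int n, 1:] = fps_const (a + of_int n) + fps_X"
    by (simp add: fps_of_poly_pCons)
  then have "fps_to_fls (fps_of_poly [:a + of_int n, 1:]) = fls_const (a + of_int n) + fls_X"
    by (simp only: fps_to_fls_plus fps_const_to_fls fps_X_to_fls)
  then show ?thesis
    by (simp add: loc_poly_def pcompose_pCons)
qed

lemma loc_pole: "loc (pole k) n = 1 / (fls_const (of_int (k + n)) + fls_X)"
  using loc_eq[of "pole k" 1 "[:of_int k, 1:]" n]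
  by (simp add: pole.rep_eq loc_poly_hom loc_poly_linear)

lemma cf_pole_power_at:
  "cf (pole (- n) ^ Suc k) n m = (if m = - 1 - int k then 1 else 0)"
proof -
  have "loc (pole (- n) ^ Suc k) n = fls_X_inv ^ Suc k"
    by (simp only: loc_power loc_pole) (simp add: fls_inverse_X divide_inverse power_inverse[symmetric])
  then show ?thesis by (simp only: fls_X_inv_power_nth) auto
qed

lemma cf_pole_power_other:
  assumes "n + l \<noteq> 0" "m < 0"
  shows "cf (pole l ^ k) n m = 0"
proof -
  define f :: "complex fps" where "f = fps_const (of_int (l + n)) + fps_X"
  have f: "f $ 0 \<noteq> 0" using assms(1) by (auto simp: f_def add.commute simp flip: of_int_add)
  have "loc (pole l) n = inverse (fps_to_fls f)"
    by (simp add: loc_pole f_def fps_to_fls_plus divide_inverse fps_const_to_fls fps_X_to_fls)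
  also have "\<dots> = fps_to_fls (inverse f)"
    using f by (simp add: fls_inverse_fps_to_fls)
  finally have "loc (pole l ^ k) n = fps_to_fls (inverse f ^ k)"
    by (simp add: loc_power fps_to_fls_power)
  then show ?thesis using assms(2) by simp
qed


lemma loc_eq_0: "loc F n = 0 \<longleftrightarrow> F = 0"
proof -
  obtain p q where *: "Rep_kfun F = Fract p q" "q \<noteq> 0"
    using kfun_cases by metis
  then have "loc F n = 0 \<longleftrightarrow> p = 0"
    by (simp add: loc_eq[OF *] loc_poly_eq_0)
  also have "\<dots> \<longleftrightarrow> F = 0"
    using * by (simp add: Rep_kfun_inject[symmetric] zero_kfun.rep_eq Zero_fract_def eq_fract)
  finally show ?thesis .
qed

text \<open>A rational function is determined by its expansion at any single point. Identities in K
  thus reduce to identities of Laurent series at one conveniently chosen integer.\<close>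

lemma kfun_eqI: "loc F n = loc G n \<Longrightarrow> F = G"
  using loc_eq_0[of "F - G" n] loc_hom(1)[of "F - G" G n] by simp

section \<open>Shift, reflection and derivative on Laurent coefficients\<close>

lemma Rep_shift:
  assumes "Rep_kfun F = Fract p q" "q \<noteq> 0"
  shows "Rep_kfun (shift k F) = Fract (pcompose p [:of_int k, 1:]) (pcompose q [:of_int k, 1:])"
  using assms by (simp add: shift.rep_eq fract_subst_Fract)

lemma loc_shift: "loc (shift k F) n = loc F (n + k)"
proof -
  obtain p q where *: "Rep_kfun F = Fract p q" "q \<noteq> 0"
    using kfun_cases by metis
  have "loc_poly n (pcompose p [:of_int k, 1:]) = loc_poly (n + k) p" for p
    by (simp add: loc_poly_def pcompose_pCons flip: pcompose_assoc) (simp add: add.commute)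
  moreover have "pcompose q [:of_int k, 1:] \<noteq> 0"
    using *(2) by (simp add: pcompose_eq_0_iff)
  ultimately show ?thesis
    by (simp add: loc_eq[OF Rep_shift[OF *]] loc_eq[OF *])
qed

text \<open>With t = tau - n the argument -tau is -n - t, so the expansion of \<open>F\<close> at
  \<open>- n\<close> gets composed with -t.\<close>

lemma cf_reflect: "cf (reflect F) n m = cf F (- n) m * (- 1) powi m"
proof -
  obtain p q where *: "Rep_kfun F = Fract p q" "q \<noteq> 0"
    using kfun_cases by metis
  have R: "Rep_kfun (reflect F) = Fract (pcompose p [:0, -1:]) (pcompose q [:0, -1:])"
    using * by (simp add: reflect.rep_eq fract_subst_Fract)
  let ?X = "fps_const (-1) * fps_X :: complex fps"
  have X: "?X \<noteq> 0" "fps_nth ?X 0 = 0" by auto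
  have "loc_poly n (pcompose p [:0, -1:]) = fls_compose_fps (loc_poly (- n) p) ?X" for p
  proof -
    have "pcompose (pcompose p [:0, -1:]) [:of_int n, 1:]
        = pcompose (pcompose p [:of_int (- n), 1:]) [:0, -1:]"
      by (simp add: pcompose_pCons flip: pcompose_assoc)
    moreover have Y: "fps_of_poly [:0, -1:] = ?X"
      by (simp add: fps_of_poly_pCons)
    have "fps_of_poly (pcompose r [:0, -1:]) = fps_compose (fps_of_poly r) ?X" for r
      by (subst Y[symmetric], rule fps_of_poly_pcompose) simp
    ultimately show ?thesis
      by (simp only: loc_poly_def fls_compose_fps_to_fls[OF X])
  qed
  moreover have "pcompose q [:0, -1:] \<noteq> 0"
    using *(2) by (simp add: pcompose_eq_0_iff)
  ultimately have "loc (reflect F) n = fls_compose_fps (loc F (- n)) ?X"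
    using X by (simp add: loc_eq[OF R] loc_eq[OF *] fls_compose_fps_divide)
  moreover have neg1: "(- 1 :: complex) \<noteq> 0" by simp
  ultimately show ?thesis by (simp only: fls_nth_fls_compose_fps_linear[OF neg1])
qed

lemma loc_kderiv: "loc (kderiv F) n = fls_deriv (loc F n)"
proof -
  obtain p q where *: "Rep_kfun F = Fract p q" "q \<noteq> 0"
    using kfun_cases by metis
  have R: "Rep_kfun (kderiv F) = Fract (pderiv p * q - p * pderiv q) (q ^ 2)"
    using * by (simp add: kderiv.rep_eq fract_deriv_Fract)
  have D: "loc_poly n (pderiv p) = fls_deriv (loc_poly n p)" for p
    by (simp add: loc_poly_def fls_deriv_fps_to_fls pderiv_pcompose pderiv_pCons
        flip: fps_of_poly_pderiv)
  have q: "loc_poly n q \<noteq> 0"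
    using *(2) by (simp add: loc_poly_eq_0)
  have minus: "loc_poly n (p - q) = loc_poly n p - loc_poly n q" for p q
    using loc_poly_hom(1)[of n "p - q" q] by (simp add: algebra_simps)
  \<comment> \<open>The derivative of \<open>F\<close> is obtained by differentiating the relation F
    q = p and solving for it.\<close>
  have "loc F n * loc_poly n q = loc_poly n p"
    using q by (simp add: loc_eq[OF *])
  then have "fls_deriv (loc F n) * loc_poly n q + loc F n * fls_deriv (loc_poly n q)
      = fls_deriv (loc_poly n p)"
    by (metis fls_deriv_mult add.commute)
  moreover have "loc (kderiv F) n
      = (loc_poly n p' * loc_poly n q - loc_poly n p * fls_deriv (loc_poly n q)) / (loc_poly n q)\<^sup>2"
    if "p' = pderiv p" for p'
    using that *(2) by (simp add: loc_eq[OF R] minus loc_poly_hom D power2_eq_square)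
  ultimately show ?thesis
    using q \<open>loc F n * loc_poly n q = loc_poly n p\<close>[symmetric]
    by (simp add: D power2_eq_square field_simps)
qed

lemma cf_kderiv: "cf (kderiv F) n m = of_int (m + 1) * cf F n (m + 1)"
  by (simp add: loc_kderiv)

lemma kderiv_pole_power: "kderiv (pole n ^ Suc k) = (- of_nat (Suc k)) *\<^sub>C pole n ^ Suc (Suc k)"
\<comment> \<open>At \<open>- n\<close> the function \<open>pole n\<close> is the inverse of the
  local coordinate, so both sides are monomials there.\<close>
proof (rule kfun_eqI[of _ "- n"], rule fls_eqI)
  fix m
  show "cf (kderiv (pole n ^ Suc k)) (- n) m = cf ((- of_nat (Suc k)) *\<^sub>C pole n ^ Suc (Suc k)) (- n) m"
    unfolding cf_kderiv cf_scaleC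
    using cf_pole_power_at[of "- n" k "m + 1"] cf_pole_power_at[of "- n" "Suc k" m]
    by (simp del: power_Suc)
qed

lemma shift_hom:
  "shift k (F + G) = shift k F + shift k G" "shift k (F * G) = shift k F * shift k G"
  "shift k (c *\<^sub>C F) = c *\<^sub>C shift k F"
  by (rule kfun_eqI[of _ 0]; simp add: loc_shift loc_hom loc_scaleC)+

lemma shift_shift: "shift k (shift l F) = shift (k + l) F" and shift_0: "shift 0 F = F"
  by (rule kfun_eqI[of _ 0]; simp add: loc_shift add.commute)+

lemma kderiv_hom:
  "kderiv (F + G) = kderiv F + kderiv G" "kderiv (F * G) = F * kderiv G + kderiv F * G"
  "kderiv (c *\<^sub>C F) = c *\<^sub>C kderiv F"
  by (rule kfun_eqI[of _ 0]; simp add: loc_kderiv loc_hom loc_scaleC fls_deriv_mult_const_left)+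

lemma shift_pole_power: "shift k (pole n ^ j) = pole (n + k) ^ j"
  by (rule kfun_eqI[of _ 0]) (simp add: loc_shift loc_power loc_pole add_ac)

lemma shift_of_poly: "shift k (of_poly p) = of_poly (pcompose p [:of_int k, 1:])"
  by (rule Rep_kfun_inject[THEN iffD1]) (simp add: Rep_shift[OF Rep_of_poly] Rep_of_poly pcompose_1)

lemma kderiv_of_poly: "kderiv (of_poly p) = of_poly (pderiv p)"
  by (rule Rep_kfun_inject[THEN iffD1]) (simp add: kderiv.rep_eq Rep_of_poly fract_deriv_Fract)

section \<open>Pairing rational functions with families of Laurent coefficients\<close>

text \<open>In the pairing below, indices \<open>m \<ge> 0\<close> meet the regular coefficients of
  a rational function, which may be nonzero at all integers, so \<open>w\<close> has to be finite
  there. Negative indices meet only the finitely many polar coefficients and stay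
  unrestricted.\<close>

definition laurent_family :: "(int \<Rightarrow> int \<Rightarrow> 'w::complex_vector) \<Rightarrow> bool"
  where "laurent_family w \<longleftrightarrow> (\<exists>N. \<forall>n m. m \<ge> 0 \<longrightarrow> w n m \<noteq> 0 \<longrightarrow> m \<le> N \<and> \<bar>n\<bar> \<le> N)"

text \<open>
  The sum over all integers \<open>n\<close> of the residues at \<open>n\<close> of \<open>F\<close> times the Laurent series
  \<open>\<Sum>\<^sub>m w n m (\<tau> - n)\<^sup>-\<^sup>m\<^sup>-\<^sup>1\<close>.
\<close>

definition pair :: "kfun \<Rightarrow> (int \<Rightarrow> int \<Rightarrow> 'w::complex_vector) \<Rightarrow> 'w"
  where "pair F w = (\<Sum>(n, m)\<in>{(n, m). cf F n m \<noteq> 0 \<and> w n m \<noteq> 0}. cf F n m *\<^sub>C w n m)"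

lemma cf_bounded: "\<exists>N\<ge>0. \<forall>n m. cf F n m \<noteq> 0 \<longrightarrow> - N \<le> m \<and> (m < 0 \<longrightarrow> \<bar>n\<bar> \<le> N)"
proof (induction F rule: kfun_induct)
  case (poly p)
  have "0 \<le> m" if "cf (of_poly p) n m \<noteq> 0" for n m
    using that cf_of_poly_neg[of m p n] by (cases "m < 0") auto
  then show ?case by (intro exI[of _ 0]) force
next
  case (pole k j)
  have "- (\<bar>k\<bar> + 1 + int j) \<le> m \<and> (m < 0 \<longrightarrow> \<bar>n\<bar> \<le> \<bar>k\<bar> + 1 + int j)"
    if "cf (pole k ^ Suc j) n m \<noteq> 0" for n m
  proof (cases "n + k = 0")
    case True
    then have k: "k = - n" by simp
    show ?thesis using that unfolding k cf_pole_power_at by (auto split: if_splits)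
  next
    case False
    then have "\<not> m < 0" using that cf_pole_power_other by blast
    then show ?thesis by simp
  qed
  then show ?case by (intro exI[of _ "\<bar>k\<bar> + 1 + int j"]) auto
next
  case (add F G)
  then obtain N N' where N: "N \<ge> 0" "\<And>n m. cf F n m \<noteq> 0 \<longrightarrow> - N \<le> m \<and> (m < 0 \<longrightarrow> \<bar>n\<bar> \<le> N)"
    "\<And>n m. cf G n m \<noteq> 0 \<longrightarrow> - N' \<le> m \<and> (m < 0 \<longrightarrow> \<bar>n\<bar> \<le> N')" by blast
  have "- max N N' \<le> m \<and> (m < 0 \<longrightarrow> \<bar>n\<bar> \<le> max N N')" if "cf (F + G) n m \<noteq> 0" for n m
    using that N(2,3)[of n m] by (cases "cf F n m = 0") (auto simp: cf_add)
  then show ?case using N(1) by (intro exI[of _ "max N N'"]) auto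
next
  case (scale c F)
  then show ?case by (auto simp: cf_scaleC)
qed

lemma cf_boundedE:
  obtains N where "N \<ge> 0" "\<And>n m. cf F n m \<noteq> 0 \<Longrightarrow> - N \<le> m"
    "\<And>n m. cf F n m \<noteq> 0 \<Longrightarrow> m < 0 \<Longrightarrow> \<bar>n\<bar> \<le> N"
  using cf_bounded[of F] by blast

lemma laurent_familyE:
  assumes "laurent_family w"
  obtains N where "N \<ge> 0" "\<And>n m. w n m \<noteq> 0 \<Longrightarrow> m \<ge> 0 \<Longrightarrow> \<bar>n\<bar> \<le> N"
    "\<And>n m. w n m \<noteq> 0 \<Longrightarrow> m \<le> N"
proof -
  obtain N where N: "\<And>n m. m \<ge> 0 \<Longrightarrow> w n m \<noteq> 0 \<Longrightarrow> m \<le> N \<and> \<bar>n\<bar> \<le> N"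
    using assms unfolding laurent_family_def by blast
  show thesis
  proof (rule that[of "max N 0"])
    show "m \<le> max N 0" if "w n m \<noteq> 0" for n m
      using N[of m n] that by (cases "m \<ge> 0") auto
    show "\<bar>n\<bar> \<le> max N 0" if "w n m \<noteq> 0" "m \<ge> 0" for n m
      using N[of m n] that by auto
  qed simp
qed

lemma laurent_familyI:
  assumes "\<And>n m. m \<ge> 0 \<Longrightarrow> w n m \<noteq> 0 \<Longrightarrow> m \<le> N \<and> \<bar>n\<bar> \<le> N'"
  shows "laurent_family w"
proof -
  have "m \<le> max N N' \<and> \<bar>n\<bar> \<le> max N N'" if "m \<ge> 0" "w n m \<noteq> 0" for n m
    using assms[OF that] by auto
  then show ?thesis unfolding laurent_family_def by blast
qed

lemma pair_support_box:
  assumes "laurent_family w"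
  obtains N where "\<And>n m. cf F n m \<noteq> 0 \<Longrightarrow> w n m \<noteq> 0 \<Longrightarrow> n \<in> {-N..N} \<and> m \<in> {-N..N}"
proof -
  obtain N1 where N1: "N1 \<ge> 0" "\<And>n m. cf F n m \<noteq> 0 \<Longrightarrow> - N1 \<le> m"
    "\<And>n m. cf F n m \<noteq> 0 \<Longrightarrow> m < 0 \<Longrightarrow> \<bar>n\<bar> \<le> N1" by (rule cf_boundedE[of F]) (rule that)
  obtain N2 where N2: "N2 \<ge> 0" "\<And>n m. w n m \<noteq> 0 \<Longrightarrow> m \<ge> 0 \<Longrightarrow> \<bar>n\<bar> \<le> N2"
    "\<And>n m. w n m \<noteq> 0 \<Longrightarrow> m \<le> N2" by (rule laurent_familyE[OF assms]) (rule that)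
  have "n \<in> {-(max N1 N2)..max N1 N2} \<and> m \<in> {-(max N1 N2)..max N1 N2}"
    if "cf F n m \<noteq> 0" "w n m \<noteq> 0" for n m
  proof -
    have "\<bar>n\<bar> \<le> max N1 N2"
      using N1(3)[OF that(1)] N2(2)[OF that(2)] by (cases "m < 0") auto
    then show ?thesis using N1(2)[OF that(1)] N2(3)[OF that(2)] by auto
  qed
  then show thesis by (rule that)
qed

lemma pair_superset:
  assumes "finite A" "\<And>n m. cf F n m \<noteq> 0 \<Longrightarrow> w n m \<noteq> 0 \<Longrightarrow> (n, m) \<in> A"
  shows "pair F w = (\<Sum>(n, m)\<in>A. cf F n m *\<^sub>C w n m)"
  unfolding pair_def
proof (rule sum.mono_neutral_left[OF assms(1)])
  show "{(n, m). cf F n m \<noteq> 0 \<and> w n m \<noteq> 0} \<subseteq> A" using assms(2) by blast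
qed auto

lemma finite_pair_support:
  assumes "laurent_family w"
  shows "finite {(n, m). cf F n m \<noteq> 0 \<and> w n m \<noteq> 0}"
proof -
  obtain N where N: "\<And>n m. cf F n m \<noteq> 0 \<Longrightarrow> w n m \<noteq> 0 \<Longrightarrow> n \<in> {-N..N} \<and> m \<in> {-N..N}"
    by (rule pair_support_box[OF assms]) (rule that)
  have "{(n, m). cf F n m \<noteq> 0 \<and> w n m \<noteq> 0} \<subseteq> {-N..N} \<times> {-N..N}"
    using N by blast
  then show ?thesis by (rule finite_subset) simp
qed

lemma laurent_family_add:
  assumes "laurent_family w" "laurent_family w'"
  shows "laurent_family (\<lambda>n m. w n m + w' n m)"
proof -
  obtain N where N: "N \<ge> 0" "\<And>n m. w n m \<noteq> 0 \<Longrightarrow> m \<ge> 0 \<Longrightarrow> \<bar>n\<bar> \<le> N"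
    "\<And>n m. w n m \<noteq> 0 \<Longrightarrow> m \<le> N" by (rule laurent_familyE[OF assms(1)]) (rule that)
  obtain N' where N': "N' \<ge> 0" "\<And>n m. w' n m \<noteq> 0 \<Longrightarrow> m \<ge> 0 \<Longrightarrow> \<bar>n\<bar> \<le> N'"
    "\<And>n m. w' n m \<noteq> 0 \<Longrightarrow> m \<le> N'" by (rule laurent_familyE[OF assms(2)]) (rule that)
  have "m \<le> max N N' \<and> \<bar>n\<bar> \<le> max N N'" if "m \<ge> 0" "w n m + w' n m \<noteq> 0" for n m
    using that N(2,3)[of n m] N'(2,3)[of n m] by (cases "w n m = 0"; cases "w' n m = 0") auto
  then show ?thesis by (rule laurent_familyI)
qed

lemma laurent_family_map:
  assumes "laurent_family w" "\<And>n m. w n m = 0 \<Longrightarrow> w' n m = 0"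
  shows "laurent_family w'"
  using assms unfolding laurent_family_def by metis

lemma laurent_family_scale: "laurent_family w \<Longrightarrow> laurent_family (\<lambda>n m. c *\<^sub>C w n m)"
  by (erule laurent_family_map) simp

lemma laurent_family_minus: "laurent_family w \<Longrightarrow> laurent_family (\<lambda>n m. - w n m)"
  by (erule laurent_family_map) simp

lemma laurent_family_diff:
  "laurent_family w \<Longrightarrow> laurent_family w' \<Longrightarrow> laurent_family (\<lambda>n m. w n m - w' n m)"
  using laurent_family_add[of w "\<lambda>n m. - w' n m"] laurent_family_minus[of w'] by simp

lemma pair_add_left:
  assumes "laurent_family w"
  shows "pair (F + G) w = pair F w + pair G w"
proof -
  let ?A = "{(n, m). cf F n m \<noteq> 0 \<and> w n m \<noteq> 0} \<union> {(n, m). cf G n m \<noteq> 0 \<and> w n m \<noteq> 0}"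
  have A: "finite ?A" using finite_pair_support[OF assms] by blast
  have "pair (F + G) w = (\<Sum>(n, m)\<in>?A. cf (F + G) n m *\<^sub>C w n m)"
    by (rule pair_superset[OF A]) (auto simp: cf_add)
  moreover have "pair F w = (\<Sum>(n, m)\<in>?A. cf F n m *\<^sub>C w n m)"
    "pair G w = (\<Sum>(n, m)\<in>?A. cf G n m *\<^sub>C w n m)"
    by (rule pair_superset[OF A]; auto)+
  ultimately show ?thesis
    by (simp add: cf_add scaleC_add_left sum.distrib case_prod_beta del: Un_iff)
qed

lemma pair_scale_left: "pair (c *\<^sub>C F) w = c *\<^sub>C pair F w"
proof (cases "c = 0")
  case True
  then show ?thesis by (simp add: pair_def cf_scaleC[of 0 F, simplified])
next
  case False
  then show ?thesis
    by (simp add: pair_def cf_scaleC complex_vector.scale_sum_right case_prod_beta)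
qed

lemma clinear_pair: "laurent_family w \<Longrightarrow> clinear (\<lambda>F. pair F w)"
  by (rule clinearI) (simp_all add: pair_add_left pair_scale_left)

lemma pair_add_right:
  assumes "laurent_family w" "laurent_family w'"
  shows "pair F (\<lambda>n m. w n m + w' n m) = pair F w + pair F w'"
proof -
  let ?A = "{(n, m). cf F n m \<noteq> 0 \<and> w n m \<noteq> 0} \<union> {(n, m). cf F n m \<noteq> 0 \<and> w' n m \<noteq> 0}"
  have A: "finite ?A" using finite_pair_support assms by blast
  have "pair F (\<lambda>n m. w n m + w' n m) = (\<Sum>(n, m)\<in>?A. cf F n m *\<^sub>C (w n m + w' n m))"
    by (rule pair_superset[OF A]) auto
  moreover have "pair F w = (\<Sum>(n, m)\<in>?A. cf F n m *\<^sub>C w n m)"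
    "pair F w' = (\<Sum>(n, m)\<in>?A. cf F n m *\<^sub>C w' n m)"
    by (rule pair_superset[OF A]; auto)+
  ultimately show ?thesis
    by (simp add: scaleC_add_right sum.distrib case_prod_beta del: Un_iff)
qed

lemma clinear_sum: "clinear f \<Longrightarrow> f (sum g A) = (\<Sum>x\<in>A. f (g x))"
  by (induction A rule: infinite_finite_induct) (simp_all add: clinear_zero clinear_add)

lemma pair_map:
  assumes "clinear L" "laurent_family w"
  shows "pair F (\<lambda>n m. L (w n m)) = L (pair F w)"
proof -
  have "pair F (\<lambda>n m. L (w n m))
      = (\<Sum>(n, m)\<in>{(n, m). cf F n m \<noteq> 0 \<and> w n m \<noteq> 0}. cf F n m *\<^sub>C L (w n m))"
    using assms by (intro pair_superset finite_pair_support) (auto simp: clinear_zero)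
  also have "\<dots> = L (pair F w)"
    by (simp add: pair_def clinear_sum[OF assms(1)] case_prod_beta clinear_scale[OF assms(1)])
  finally show ?thesis .
qed

lemma clinear_scaleC: "clinear (\<lambda>x. c *\<^sub>C x)"
  by (rule clinearI) (simp_all add: scaleC_add_right mult.commute)

lemma clinear_uminus: "clinear (\<lambda>x. - x)"
  by (rule clinearI) simp_all

lemma pair_scale_right: "laurent_family w \<Longrightarrow> pair F (\<lambda>n m. c *\<^sub>C w n m) = c *\<^sub>C pair F w"
  by (rule pair_map[OF clinear_scaleC])

lemma pair_minus_right: "laurent_family w \<Longrightarrow> pair F (\<lambda>n m. - w n m) = - pair F w"
  by (rule pair_map[OF clinear_uminus])

lemma pair_diff_right:
  "laurent_family w \<Longrightarrow> laurent_family w' \<Longrightarrow>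
    pair F (\<lambda>n m. w n m - w' n m) = pair F w - pair F w'"
  using pair_add_right[of w "\<lambda>n m. - w' n m"] by (simp add: laurent_family_minus pair_minus_right)

lemma pair_of_poly_0:
  assumes "\<And>n m. m \<ge> 0 \<Longrightarrow> w n m = 0"
  shows "pair (of_poly p) w = 0"
proof -
  have "\<not> (cf (of_poly p) n m \<noteq> 0 \<and> w n m \<noteq> 0)" for n m
    using assms[of m n] cf_of_poly_neg[of m p n] by (cases "m < 0") auto
  then have "{(n, m). cf (of_poly p) n m \<noteq> 0 \<and> w n m \<noteq> 0} = {}" by blast
  then show ?thesis unfolding pair_def by (simp only: sum.empty)
qed

lemma pair_pole_power:
  assumes "\<And>n m. m \<ge> 0 \<Longrightarrow> w n m = 0"
  shows "pair (pole (- n) ^ Suc k) w = w n (- 1 - int k)"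
proof -
  have "pair (pole (- n) ^ Suc k) w
      = (\<Sum>(n', m)\<in>{(n, - 1 - int k)}. cf (pole (- n) ^ Suc k) n' m *\<^sub>C w n' m)"
  proof (rule pair_superset)
    fix n' m assume *: "cf (pole (- n) ^ Suc k) n' m \<noteq> 0" "w n' m \<noteq> 0"
    then have m: "m < 0" using assms[of m n'] by (cases "m < 0") auto
    then have "n' = n" using *(1) cf_pole_power_other[of n' "- n" m "Suc k"] by fastforce
    then show "(n', m) \<in> {(n, - 1 - int k)}"
      using * cf_pole_power_at[of n k m] by (auto split: if_splits)
  qed simp
  then show ?thesis using cf_pole_power_at[of n k "- 1 - int k"] by (simp add: scaleC_one del: power_Suc)
qed

lemma laurent_family_singular:
  assumes "\<And>n m. m \<ge> 0 \<Longrightarrow> w n m = 0"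
  shows "laurent_family w"
  unfolding laurent_family_def using assms by blast

lemma clinear_ext_kfun:
  assumes "clinear D" "clinear E" "\<And>p. D (of_poly p) = E (of_poly p)"
    "\<And>n k. D (pole (- n) ^ Suc k) = E (pole (- n) ^ Suc k)"
  shows "D F = E F"
proof (induction F rule: kfun_induct)
  case (pole n k)
  then show ?case using assms(4)[of "- n" k] by simp
qed (simp_all add: assms(3) clinear_add[OF assms(1)] clinear_add[OF assms(2)]
      clinear_scale[OF assms(1)] clinear_scale[OF assms(2)])

lemma pair_of_vanishing:
  assumes "clinear D" "\<And>p. D (of_poly p) = 0"
    and w: "\<And>n m. w n m = (if m < 0 then D (pole (- n) ^ nat (- m)) else 0)"
  shows "D F = pair F w"
proof -
  have 0: "\<And>n m. m \<ge> 0 \<Longrightarrow> w n m = 0" by (simp add: w)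
  show ?thesis
  proof (rule clinear_ext_kfun[OF assms(1) clinear_pair[OF laurent_family_singular[OF 0]]])
    show "D (of_poly p) = pair (of_poly p) w" for p
      by (simp add: assms(2) pair_of_poly_0[OF 0])
    fix n k
    have "nat (- (- 1 - int k)) = Suc k" by simp
    then show "D (pole (- n) ^ Suc k) = pair (pole (- n) ^ Suc k) w"
      by (simp only: pair_pole_power[OF 0]) (simp add: w del: power_Suc)
  qed
qed

subsection \<open>The Laurent coefficients of a distribution are unique\<close>

lemma cf_of_poly_0: "cf (of_poly p) n 0 = poly p (of_int n)"
  by (simp add: loc_of_poly loc_poly_def poly_0_coeff_0[symmetric] poly_pcompose)

lemma cf_linear_power_mult:
  "cf (of_poly ([:- of_int n, 1:] ^ k) * F) n m = cf F n (m - int k)"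
proof -
  have "loc (of_poly ([:- of_int n, 1:] ^ k)) n = fls_X ^ k"
    by (simp only: of_poly_power loc_power loc_of_poly loc_poly_linear) simp
  then show ?thesis
    by (simp add: loc_hom fls_X_power_times_conv_shift)
qed

text \<open>If \<open>w\<close> has a nonzero coefficient of nonnegative index at n, let
  \<open>j\<close> be the largest such index. A polynomial vanishing to order exactly
  \<open>j\<close> at n, and to high order at the other integers where \<open>w\<close> is
  supported, isolates \<open>w n j\<close> in the pairing.\<close>

lemma pair_unique_regular:
  assumes w: "laurent_family w" and 0: "\<And>p. pair (of_poly p) w = 0" and "m \<ge> 0"
  shows "w n m = 0"
proof (rule ccontr)
  assume "w n m \<noteq> 0"
  obtain N where N: "N \<ge> 0" "\<And>n m. w n m \<noteq> 0 \<Longrightarrow> m \<ge> 0 \<Longrightarrow> \<bar>n\<bar> \<le> N"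
    "\<And>n m. w n m \<noteq> 0 \<Longrightarrow> m \<le> N" by (rule laurent_familyE[OF w]) (rule that)
  define J where "J = {j. 0 \<le> j \<and> w n j \<noteq> 0}"
  have "J \<subseteq> {0..N}" using N(3) by (auto simp: J_def)
  then have J: "finite J" "J \<noteq> {}"
    using \<open>w n m \<noteq> 0\<close> \<open>m \<ge> 0\<close> by (auto simp: J_def finite_subset)
  define j where "j = Max J"
  have j: "0 \<le> j" "w n j \<noteq> 0"
    using Max_in[OF J] by (auto simp: j_def J_def)
  have jmax: "i \<le> j" if "w n i \<noteq> 0" for i
    using Max_ge[OF J(1), of i] that j(1) by (cases "i \<ge> 0") (auto simp: j_def J_def)
  \<comment> \<open>The order \<open>Suc (nat N)\<close> exceeds every index occurring in
    \<open>w\<close>, so \<open>q\<close> suppresses all coefficients at the integers other than n,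
    while its value at n is nonzero.\<close>
  define q where "q = (\<Prod>l\<in>{-N..N} - {n}. [:- of_int l, 1:] ^ Suc (nat N) :: complex poly)"
  define F where "F = of_poly ([:- of_int n, 1:] ^ nat j) * of_poly q"
  have *: "cf F n i = cf (of_poly q) n (i - j)" for i
    using cf_linear_power_mult[of n "nat j" "of_poly q" i] j(1) by (simp add: F_def)
  have "cf F l i = 0" if "l \<noteq> n" "w l i \<noteq> 0" "i \<ge> 0" for l i
  proof -
    have l: "l \<in> {-N..N} - {n}" using N(2)[of l i] that by auto
    then have "q = [:- of_int l, 1:] ^ Suc (nat N)
        * (\<Prod>l\<in>{-N..N} - {n} - {l}. [:- of_int l, 1:] ^ Suc (nat N))"
      unfolding q_def by (subst prod.remove[OF _ l]) simp_all
    then obtain r where "q = [:- of_int l, 1:] ^ Suc (nat N) * r" by blast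
    then have "F = of_poly ([:- of_int l, 1:] ^ Suc (nat N)) * of_poly ([:- of_int n, 1:] ^ nat j * r)"
      by (simp add: F_def of_poly_mult mult_ac del: power_Suc mult_pCons_left mult_pCons_right)
    then have "cf F l i = cf (of_poly ([:- of_int n, 1:] ^ nat j * r)) l (i - int (Suc (nat N)))"
      by (simp only: cf_linear_power_mult)
    also have "\<dots> = 0"
      using N(1) N(3)[of l i] that by (intro cf_of_poly_neg) simp
    finally show ?thesis .
  qed
  moreover have "cf F n i = 0" if "w n i \<noteq> 0" "i \<noteq> j" for i
    unfolding * using jmax[OF that(1)] that by (intro cf_of_poly_neg) simp
  moreover have "cf F l i = 0" if "i < 0" for l i
    unfolding F_def of_poly_mult by (rule cf_of_poly_neg[OF that])
  ultimately have "pair F w = (\<Sum>(l, i)\<in>{(n, j)}. cf F l i *\<^sub>C w l i)"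
    by (intro pair_superset) (auto, (metis not_less)+)
  moreover have "pair F w = 0"
    using 0 by (simp add: F_def of_poly_mult del: mult_pCons_left)
  moreover have "cf F n j = (\<Prod>l\<in>{-N..N} - {n}. (of_int n - of_int l) ^ Suc (nat N))"
    using *[of j] by (simp add: cf_of_poly_0 q_def poly_prod del: power_Suc)
  ultimately show False using j(2) by auto
qed

text \<open>Polynomials detect the coefficients with \<open>m \<ge> 0\<close>; once these agree,
  each pole power reads off a single coefficient of negative index.\<close>

lemma pair_unique:
  assumes w: "laurent_family w" "laurent_family w'" and eq: "\<And>F. pair F w = pair F w'"
  shows "w = w'"
proof -
  define d where "d = (\<lambda>n m. w n m - w' n m)"
  have d: "laurent_family d" "pair F d = 0" for F
    using laurent_family_diff[OF w] pair_diff_right[OF w, of F] eq unfolding d_def by auto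
  have reg: "d n m = 0" if "m \<ge> 0" for n m
    by (rule pair_unique_regular[OF d that])
  have "d n m = 0" if "m < 0" for n m
    using pair_pole_power[where w = d and n = n and k = "nat (- m - 1)", OF reg] d(2) that by simp
  with reg have "d n m = 0" for n m by (metis not_less)
  then show ?thesis by (auto simp: d_def fun_eq_iff)
qed

subsection \<open>Products\<close>

text \<open>When \<open>w n m\<close> is read as the coefficient of (tau - n)^(-m-1), this is the
  product with \<open>F\<close> in the local coordinate at n. It is the transpose of multiplication
  by \<open>F\<close>, see \<open>pair_mult\<close>.\<close>

definition conv :: "kfun \<Rightarrow> (int \<Rightarrow> int \<Rightarrow> 'w::complex_vector) \<Rightarrow> int \<Rightarrow> int \<Rightarrow> 'w"
  where "conv F w n m = (\<Sum>l | cf F n l \<noteq> 0 \<and> w n (l + m) \<noteq> 0. cf F n l *\<^sub>C w n (l + m))"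

lemma conv_superset:
  assumes "finite A" "\<And>l. cf F n l \<noteq> 0 \<Longrightarrow> w n (l + m) \<noteq> 0 \<Longrightarrow> l \<in> A"
  shows "conv F w n m = (\<Sum>l\<in>A. cf F n l *\<^sub>C w n (l + m))"
  unfolding conv_def using assms by (intro sum.mono_neutral_left) auto

lemma conv_nonzeroE:
  assumes "conv F w n m \<noteq> 0"
  obtains l where "cf F n l \<noteq> 0" "w n (l + m) \<noteq> 0"
proof (rule ccontr)
  assume "\<not> thesis"
  then have "{l. cf F n l \<noteq> 0 \<and> w n (l + m) \<noteq> 0} = {}" using that by blast
  then show False using assms unfolding conv_def by (simp only: sum.empty simp_thms)
qed

lemma laurent_family_conv:
  assumes "laurent_family w"
  shows "laurent_family (conv F w)"
proof -
  obtain N1 where N1: "N1 \<ge> 0" "\<And>n m. cf F n m \<noteq> 0 \<Longrightarrow> - N1 \<le> m"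
    "\<And>n m. cf F n m \<noteq> 0 \<Longrightarrow> m < 0 \<Longrightarrow> \<bar>n\<bar> \<le> N1" by (rule cf_boundedE[of F]) (rule that)
  obtain N2 where N2: "N2 \<ge> 0" "\<And>n m. w n m \<noteq> 0 \<Longrightarrow> m \<ge> 0 \<Longrightarrow> \<bar>n\<bar> \<le> N2"
    "\<And>n m. w n m \<noteq> 0 \<Longrightarrow> m \<le> N2" by (rule laurent_familyE[OF assms]) (rule that)
  show ?thesis
  proof (rule laurent_familyI[where N = "N1 + N2" and N' = "N1 + N2"])
    fix n m assume "m \<ge> 0" "conv F w n m \<noteq> 0"
    then obtain l where l: "cf F n l \<noteq> 0" "w n (l + m) \<noteq> 0" by (elim conv_nonzeroE)
    show "m \<le> N1 + N2 \<and> \<bar>n\<bar> \<le> N1 + N2"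
      using N1(1) N1(2,3)[OF l(1)] N2(1) N2(2,3)[OF l(2)] \<open>m \<ge> 0\<close> by linarith
  qed
qed

lemma fls_mult_nth_superset:
  fixes f g :: "complex fls"
  assumes "finite A" "\<And>i. fls_nth f i \<noteq> 0 \<Longrightarrow> fls_nth g (n - i) \<noteq> 0 \<Longrightarrow> i \<in> A"
  shows "fls_nth (f * g) n = (\<Sum>i\<in>A. fls_nth f i * fls_nth g (n - i))"
proof -
  let ?B = "{i\<in>A. fls_nth f i \<noteq> 0 \<and> fls_nth g (n - i) \<noteq> 0}"
  have "(\<Sum>i\<in>?B. fls_nth f i * fls_nth g (n - i))
      = (\<Sum>i=fls_subdegree f..n - fls_subdegree g. fls_nth f i * fls_nth g (n - i))"
  proof (rule sum.mono_neutral_left)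
    show "?B \<subseteq> {fls_subdegree f..n - fls_subdegree g}"
    proof
      fix i assume "i \<in> ?B"
      then have "\<not> i < fls_subdegree f" "\<not> n - i < fls_subdegree g"
        using fls_eq0_below_subdegree by blast+
      then show "i \<in> {fls_subdegree f..n - fls_subdegree g}" by simp
    qed
  qed (use assms in auto)
  moreover have "(\<Sum>i\<in>?B. fls_nth f i * fls_nth g (n - i)) = (\<Sum>i\<in>A. fls_nth f i * fls_nth g (n - i))"
    using assms by (intro sum.mono_neutral_left) auto
  ultimately show ?thesis by (simp add: fls_times_nth(2))
qed

lemma pair_mult:
  assumes w: "laurent_family w"
  shows "pair (F * G) w = pair G (conv F w)"
proof -
  obtain N where N: "N \<ge> 0" "\<And>n m. cf F n m \<noteq> 0 \<Longrightarrow> - N \<le> m"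
    "\<And>n m. cf F n m \<noteq> 0 \<Longrightarrow> m < 0 \<Longrightarrow> \<bar>n\<bar> \<le> N" by (rule cf_boundedE[of F]) (rule that)
  obtain M where M: "M \<ge> 0" "\<And>n m. cf G n m \<noteq> 0 \<Longrightarrow> - M \<le> m"
    "\<And>n m. cf G n m \<noteq> 0 \<Longrightarrow> m < 0 \<Longrightarrow> \<bar>n\<bar> \<le> M" by (rule cf_boundedE[of G]) (rule that)
  obtain L where L: "L \<ge> 0" "\<And>n m. w n m \<noteq> 0 \<Longrightarrow> m \<ge> 0 \<Longrightarrow> \<bar>n\<bar> \<le> L"
    "\<And>n m. w n m \<noteq> 0 \<Longrightarrow> m \<le> L" by (rule laurent_familyE[OF w]) (rule that)
  \<comment> \<open>Every nonzero term of the triple sum has all its indices within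
    \<open>B\<close>, so all sums can run over one box and be interchanged.\<close>
  define B where "B = N + M + L"
  let ?I = "{-B..B}"
  have key: "n \<in> ?I \<and> l \<in> ?I \<and> m \<in> ?I \<and> l + m \<in> ?I"
    if "cf F n l \<noteq> 0" "cf G n m \<noteq> 0" "w n (l + m) \<noteq> 0" for n l m
  proof -
    have "\<bar>n\<bar> \<le> B"
      using N(1) N(3)[OF that(1)] M(1) M(3)[OF that(2)] L(1) L(2)[OF that(3)] unfolding B_def
      by linarith
    then show ?thesis
      using N(1) N(2)[OF that(1)] M(1) M(2)[OF that(2)] L(1) L(3)[OF that(3)] unfolding B_def
        atLeastAtMost_iff by linarith
  qed
  have "pair (F * G) w = (\<Sum>(n, p)\<in>?I \<times> ?I. cf (F * G) n p *\<^sub>C w n p)"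
  proof (rule pair_superset)
    fix n p assume *: "cf (F * G) n p \<noteq> 0" "w n p \<noteq> 0"
    obtain l where "cf F n l \<noteq> 0" "cf G n (p - l) \<noteq> 0"
    proof (rule ccontr)
      assume "\<not> thesis"
      then have "\<And>l. cf F n l \<noteq> 0 \<Longrightarrow> cf G n (p - l) \<noteq> 0 \<Longrightarrow> l \<in> {}" using that by blast
      from fls_mult_nth_superset[OF finite.emptyI this] have "cf (F * G) n p = 0"
        unfolding loc_hom by (simp only: sum.empty)
      then show False using *(1) by simp
    qed
    then show "(n, p) \<in> ?I \<times> ?I" using key[of n l "p - l"] *(2) by simp
  qed simp
  also have "\<dots> = (\<Sum>n\<in>?I. \<Sum>p\<in>?I. cf (F * G) n p *\<^sub>C w n p)"
    by (rule sum.cartesian_product[symmetric])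
  also have "\<dots> = (\<Sum>n\<in>?I. \<Sum>p\<in>?I. \<Sum>l\<in>?I. (cf F n l * cf G n (p - l)) *\<^sub>C w n p)"
  proof (intro sum.cong refl)
    fix n p
    show "cf (F * G) n p *\<^sub>C w n p = (\<Sum>l\<in>?I. (cf F n l * cf G n (p - l)) *\<^sub>C w n p)"
    proof (cases "w n p = 0")
      case False
      have "cf (F * G) n p = (\<Sum>l\<in>?I. cf F n l * cf G n (p - l))"
        unfolding loc_hom
      proof (rule fls_mult_nth_superset)
        fix l assume "cf F n l \<noteq> 0" "cf G n (p - l) \<noteq> 0"
        then show "l \<in> ?I" using key[of n l "p - l"] False by simp
      qed simp
      then show ?thesis by (simp add: complex_vector.scale_sum_left)
    qed simp
  qed
  also have "\<dots> = (\<Sum>n\<in>?I. \<Sum>l\<in>?I. \<Sum>p\<in>?I. (cf F n l * cf G n (p - l)) *\<^sub>C w n p)"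
    by (rule sum.cong[OF refl], rule sum.swap)
  also have "\<dots> = (\<Sum>n\<in>?I. \<Sum>l\<in>?I. \<Sum>m\<in>?I. (cf F n l * cf G n m) *\<^sub>C w n (l + m))"
  proof (rule sum.cong[OF refl], rule sum.cong[OF refl])
    fix n l
    define g where "g m = (cf F n l * cf G n m) *\<^sub>C w n (l + m)" for m
    have g: "m \<in> ?I \<and> l + m \<in> ?I" if "g m \<noteq> 0" for m
      using that key[of n l m] by (cases "w n (l + m) = 0") (auto simp: g_def)
    have "(\<Sum>p\<in>?I. g (p - l)) = (\<Sum>m\<in>(\<lambda>p. p - l) ` ?I. g m)"
      by (subst sum.reindex) (simp_all add: inj_on_def)
    also have "\<dots> = (\<Sum>m\<in>{m. g m \<noteq> 0}. g m)"
    proof (rule sum.mono_neutral_right)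
      show "{m. g m \<noteq> 0} \<subseteq> (\<lambda>p. p - l) ` ?I"
      proof
        fix m assume "m \<in> {m. g m \<noteq> 0}"
        then have "l + m \<in> ?I" using g by blast
        then show "m \<in> (\<lambda>p. p - l) ` ?I" by (intro image_eqI[of _ _ "l + m"]) simp_all
      qed
    qed simp_all
    also have "\<dots> = (\<Sum>m\<in>?I. g m)"
      using g by (intro sum.mono_neutral_left) auto
    finally show "(\<Sum>p\<in>?I. (cf F n l * cf G n (p - l)) *\<^sub>C w n p)
        = (\<Sum>m\<in>?I. (cf F n l * cf G n m) *\<^sub>C w n (l + m))"
      by (simp add: g_def)
  qed
  also have "\<dots> = (\<Sum>n\<in>?I. \<Sum>m\<in>?I. \<Sum>l\<in>?I. (cf F n l * cf G n m) *\<^sub>C w n (l + m))"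
    by (rule sum.cong[OF refl], rule sum.swap)
  also have "\<dots> = (\<Sum>n\<in>?I. \<Sum>m\<in>?I. cf G n m *\<^sub>C conv F w n m)"
  proof (intro sum.cong refl)
    fix n m
    show "(\<Sum>l\<in>?I. (cf F n l * cf G n m) *\<^sub>C w n (l + m)) = cf G n m *\<^sub>C conv F w n m"
    proof (cases "cf G n m = 0")
      case False
      then have "conv F w n m = (\<Sum>l\<in>?I. cf F n l *\<^sub>C w n (l + m))"
        using key[of n _ m] by (intro conv_superset) blast+
      then show ?thesis
        by (simp add: complex_vector.scale_sum_right mult.commute)
    qed simp
  qed
  also have "\<dots> = (\<Sum>(n, m)\<in>?I \<times> ?I. cf G n m *\<^sub>C conv F w n m)"
    by (rule sum.cartesian_product)
  also have "\<dots> = pair G (conv F w)"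
  proof (rule pair_superset[symmetric])
    fix n m assume *: "cf G n m \<noteq> 0" "conv F w n m \<noteq> 0"
    from *(2) obtain l where "cf F n l \<noteq> 0" "w n (l + m) \<noteq> 0" by (elim conv_nonzeroE)
    then show "(n, m) \<in> ?I \<times> ?I" using key[of n l m] * by simp
  qed simp
  finally show ?thesis .
qed

section \<open>Calculus of formal fields\<close>

text \<open>
  Formal distributions in several variables are functions of the mode indices; multiplication by
  the difference of two variables becomes the difference of two shifts.
\<close>

definition dsh :: "'p \<Rightarrow> 'p \<Rightarrow> ('p::ab_group_add \<Rightarrow> 'v::complex_vector) \<Rightarrow> 'p \<Rightarrow> 'v"
  where "dsh u v T = (\<lambda>p. T (p + u) - T (p + v))"

lemma dsh_apply: "dsh u v T p = T (p + u) - T (p + v)"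
  by (simp add: dsh_def)

lemma dsh_commute: "dsh u v (dsh u' v' T) = dsh u' v' (dsh u v T)"
  by (simp add: dsh_apply fun_eq_iff add_ac)

lemma dsh_pow_commute: "(dsh u v ^^ m) ((dsh u' v' ^^ n) T) = (dsh u' v' ^^ n) ((dsh u v ^^ m) T)"
proof -
  have 1: "dsh u v ((dsh u' v' ^^ n) T) = (dsh u' v' ^^ n) (dsh u v T)" for T
    by (induction n) (simp_all add: dsh_commute[of u v])
  show ?thesis
    by (induction m arbitrary: T) (simp_all add: 1)
qed

lemma dsh_pow_diff:
  "(dsh u v ^^ n) (\<lambda>p. T p - T' p) = (\<lambda>p. (dsh u v ^^ n) T p - (dsh u v ^^ n) T' p)"
proof (induction n)
  case (Suc n)
  have "dsh u v (\<lambda>p. S p - S' p) = (\<lambda>p. dsh u v S p - dsh u v S' p)" for S S' :: "'a \<Rightarrow> 'b"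
    by (simp add: dsh_def fun_eq_iff)
  then show ?case by (simp add: Suc.IH)
qed simp

lemma dsh_pow_map:
  assumes "clinear L"
  shows "(dsh u v ^^ n) (\<lambda>p. L (T p)) = (\<lambda>p. L ((dsh u v ^^ n) T p))"
proof (induction n)
  case (Suc n)
  have "dsh u v (\<lambda>p. L (S p)) = (\<lambda>p. L (dsh u v S p))" for S
    by (simp add: dsh_def clinear_diff[OF assms])
  then show ?case by (simp add: Suc.IH)
qed simp

lemma dsh_pow_zero: "(dsh u v ^^ n) (\<lambda>p. 0) = (\<lambda>p. 0)"
  by (induction n) (simp_all add: dsh_def)

lemma dsh_pow_add_fun:
  "(dsh u v ^^ n) (\<lambda>p. T p + T' p) = (\<lambda>p. (dsh u v ^^ n) T p + (dsh u v ^^ n) T' p)"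
proof (induction n)
  case (Suc n)
  have "dsh u v (\<lambda>p. S p + S' p) = (\<lambda>p. dsh u v S p + dsh u v S' p)" for S S' :: "'a \<Rightarrow> 'b"
    by (simp add: dsh_def fun_eq_iff)
  then show ?case by (simp add: Suc.IH)
qed simp

lemma dsh_pow_reindex:
  assumes "\<And>p. f (p + u) = f p + u'" "\<And>p. f (p + v) = f p + v'"
  shows "(dsh u v ^^ n) (\<lambda>p. T (f p)) = (\<lambda>p. (dsh u' v' ^^ n) T (f p))"
proof (induction n)
  case (Suc n)
  have "dsh u v (\<lambda>p. S (f p)) = (\<lambda>p. dsh u' v' S (f p))" for S
    by (simp add: dsh_def assms)
  then show ?case by (simp add: Suc.IH)
qed simp

lemma dsh_pow_neg: "(dsh v u ^^ n) T = (\<lambda>p. (- 1) ^ n *\<^sub>C (dsh u v ^^ n) T p)"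
proof (induction n)
  case (Suc n)
  have "dsh v u (\<lambda>p. c *\<^sub>C T p) = (\<lambda>p. (- c) *\<^sub>C dsh u v T p)" for c T
    by (simp add: dsh_def fun_eq_iff complex_vector.scale_right_diff_distrib)
  then show ?case by (simp add: Suc.IH)
qed (simp add: scaleC_one)

lemma dsh_pow_mono:
  assumes "\<And>p. (dsh u v ^^ n) T p = 0" "n \<le> m"
  shows "(dsh u v ^^ m) T p = 0"
proof -
  have "(dsh u v ^^ n) T = (\<lambda>p. 0)" using assms(1) by blast
  moreover have "(dsh u v ^^ m) T = (dsh u v ^^ (m - n)) ((dsh u v ^^ n) T)"
    using assms(2) by (simp flip: funpow_add[unfolded comp_def, THEN fun_cong])
  ultimately show ?thesis by (simp add: dsh_pow_zero)
qed

text \<open>The binomial theorem for \<open>z - w = (x - w) - (x - z)\<close>, in the only form needed.\<close>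

lemma dsh_pow_combine:
  assumes "\<And>q. (dsh u v ^^ m) T q = 0" "\<And>q. (dsh u w ^^ n) T q = 0"
  shows "(dsh v w ^^ (m + n)) T p = 0"
  using assms
proof (induction "m + n" arbitrary: m n T p)
  case 0
  then show ?case by simp
next
  case (Suc k)
  show ?case
  proof (cases "m = 0 \<or> n = 0")
    case True
    then have "T = (\<lambda>p. 0)" using Suc.prems by auto
    then show ?thesis by (simp only: dsh_pow_zero)
  next
    case False
    then obtain m' n' where mn: "m = Suc m'" "n = Suc n'" by (metis not0_implies_Suc)
    have k: "k = m' + Suc n'" "k = Suc m' + n'" using Suc.hyps(2) mn by simp_all
    \<comment> \<open>Applying \<open>dsh u v\<close> to \<open>T\<close> lowers the first exponent
      and keeps the second; \<open>dsh u w\<close> does the opposite. The induction hypothesis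
      applies to both results, and their difference is \<open>dsh v w T\<close>.\<close>
    have 1: "(dsh u v ^^ m') (dsh u v T) q = 0" "(dsh u w ^^ Suc n') (dsh u v T) q = 0" for q
    proof -
      show "(dsh u v ^^ m') (dsh u v T) q = 0"
        using Suc.prems(1) by (simp add: mn funpow_swap1)
      have "(dsh u w ^^ Suc n') (dsh u v T) = dsh u v ((dsh u w ^^ Suc n') T)"
        using dsh_pow_commute[of "Suc n'" u w 1 u v T] by simp
      moreover have "(dsh u w ^^ Suc n') T = (\<lambda>q. 0)" using Suc.prems(2) mn by blast
      ultimately show "(dsh u w ^^ Suc n') (dsh u v T) q = 0"
        by (simp add: dsh_apply del: funpow.simps(2))
    qed
    have 2: "(dsh u w ^^ n') (dsh u w T) q = 0" "(dsh u v ^^ Suc m') (dsh u w T) q = 0" for q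
    proof -
      show "(dsh u w ^^ n') (dsh u w T) q = 0"
        using Suc.prems(2) by (simp add: mn funpow_swap1)
      have "(dsh u v ^^ Suc m') (dsh u w T) = dsh u w ((dsh u v ^^ Suc m') T)"
        using dsh_pow_commute[of "Suc m'" u v 1 u w T] by simp
      moreover have "(dsh u v ^^ Suc m') T = (\<lambda>q. 0)" using Suc.prems(1) mn by blast
      ultimately show "(dsh u v ^^ Suc m') (dsh u w T) q = 0"
        by (simp add: dsh_apply del: funpow.simps(2))
    qed
    have "dsh v w T = (\<lambda>p. dsh u w T p - dsh u v T p)"
      by (simp add: dsh_def)
    then have "(dsh v w ^^ k) (dsh v w T)
        = (\<lambda>p. (dsh v w ^^ k) (dsh u w T) p - (dsh v w ^^ k) (dsh u v T) p)"
      by (simp only: dsh_pow_diff)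
    moreover have "(dsh v w ^^ k) (dsh u v T) p = 0"
      using Suc.hyps(1)[OF k(1) 1] k(1) by simp
    moreover have "(dsh v w ^^ k) (dsh u w T) p = 0"
      using Suc.hyps(1)[OF k(2) 2(2,1)] k(2) by simp
    moreover have "m + n = Suc k" using Suc.hyps(2) by simp
    ultimately show ?thesis by (simp add: funpow_swap1)
  qed
qed

subsection \<open>Multiplication by the expansions of powers of a difference\<close>

type_synonym 'v dist3 = "int \<times> int \<times> int \<Rightarrow> 'v"

text \<open>The coefficient of x^(n-q) z^q in (x - z)^n expanded in nonnegative powers of z, for an
  integer exponent of either sign.\<close>

definition bcoef :: "int \<Rightarrow> nat \<Rightarrow> complex"
  where "bcoef n q = (- 1) ^ q * (of_int n gchoose q)"

lemma bcoef_0: "bcoef n 0 = 1"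
  by (simp add: bcoef_def)

lemma bcoef_Suc: "bcoef (n + 1) (Suc q) = bcoef n (Suc q) - bcoef n q"
  using gbinomial_Suc_Suc[of "of_int n :: complex" q]
  by (simp add: bcoef_def algebra_simps)

text \<open>In coefficients this says that d/dx + d/dz annihilates (x - z)^n. It is the reason why
  products of covariant fields are covariant.\<close>

lemma bcoef_absorb: "of_int (n - int q) * bcoef n q = - of_nat (Suc q) * bcoef n (Suc q)"
proof -
  have "(of_int n - of_nat q) * (of_int n gchoose q) = of_nat (Suc q) * (of_int n gchoose Suc q :: complex)"
    using gbinomial_absorb_comp[of "of_int n :: complex" q]
      Suc_times_gbinomial[of q "of_int n - 1 :: complex"] by simp
  then have "(- 1) ^ q * ((of_int n - of_nat q) * (of_int n gchoose q))
      = (- 1) ^ q * (of_nat (Suc q) * (of_int n gchoose Suc q :: complex))" by (rule arg_cong)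
  then show ?thesis by (simp add: bcoef_def mult_ac del: of_nat_Suc)
qed

text \<open>\<open>(x - z)\<^sup>n\<close> expanded in nonnegative powers of \<open>z\<close>; the indices belong to \<open>(w, x, z)\<close>.\<close>

definition ep :: "int \<Rightarrow> 'v::complex_vector dist3 \<Rightarrow> 'v dist3"
  where "ep n T = (\<lambda>(l, i, j).
     \<Sum>q | T (l, i + n - int q, j + int q) \<noteq> 0. bcoef n q *\<^sub>C T (l, i + n - int q, j + int q))"

definition swap23 :: "'v dist3 \<Rightarrow> 'v dist3"
  where "swap23 T = (\<lambda>(l, i, j). T (l, j, i))"

text \<open>\<open>(x - z)\<^sup>n\<close> expanded in nonnegative powers of \<open>x\<close>.\<close>

definition em :: "int \<Rightarrow> 'v::complex_vector dist3 \<Rightarrow> 'v dist3"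
  where "em n T = (\<lambda>p. ((- 1) powi n) *\<^sub>C swap23 (ep n (swap23 T)) p)"

text \<open>The bound on \<open>j\<close> is uniform in \<open>i\<close> because the terms of
  \<open>ep\<close> raise \<open>j\<close> while lowering \<open>i\<close>; it makes the sum over q
  finite.\<close>

definition zbd :: "'v::complex_vector dist3 \<Rightarrow> bool"
  where "zbd T \<longleftrightarrow> (\<forall>l. \<exists>J. \<forall>i j. j \<ge> J \<longrightarrow> T (l, i, j) = 0)"

lemma ep_eq:
  assumes "\<And>i j. j \<ge> J \<Longrightarrow> T (l, i, j) = 0" "J \<le> j + int K"
  shows "ep n T (l, i, j) = (\<Sum>q<K. bcoef n q *\<^sub>C T (l, i + n - int q, j + int q))"
  unfolding ep_def prod.case
proof (rule sum.mono_neutral_left)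
  show "{q. T (l, i + n - int q, j + int q) \<noteq> 0} \<subseteq> {..<K}"
  proof
    fix q assume "q \<in> {q. T (l, i + n - int q, j + int q) \<noteq> 0}"
    then have "\<not> j + int q \<ge> J" using assms(1) by blast
    then show "q \<in> {..<K}" using assms(2) by simp
  qed
qed auto

lemma ep_eqE:
  assumes "zbd T"
  obtains J where "\<And>n i j K. J \<le> j + int K \<Longrightarrow>
    ep n T (l, i, j) = (\<Sum>q<K. bcoef n q *\<^sub>C T (l, i + n - int q, j + int q))"
    "\<And>i j. j \<ge> J \<Longrightarrow> T (l, i, j) = 0"
proof -
  obtain J where J: "\<And>i j. j \<ge> J \<Longrightarrow> T (l, i, j) = 0"
    using assms unfolding zbd_def by blast
  show thesis by (rule that[of J]) (use ep_eq[of J T l, OF J] J in blast)+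
qed

lemma ep_0:
  assumes "zbd T"
  shows "ep 0 T = T"
proof
  fix p :: "int \<times> int \<times> int"
  obtain l i j where p: "p = (l, i, j)" by (cases p)
  obtain J where J: "\<And>n i j K. J \<le> j + int K \<Longrightarrow>
    ep n T (l, i, j) = (\<Sum>q<K. bcoef n q *\<^sub>C T (l, i + n - int q, j + int q))"
    by (rule ep_eqE[OF assms, of l]) (rule that)
  have b: "bcoef 0 q = (if q = 0 then 1 else 0)" for q
    by (cases q) (simp_all add: bcoef_def)
  have "ep 0 T (l, i, j) = (\<Sum>q<Suc (nat (J - j)). bcoef 0 q *\<^sub>C T (l, i + 0 - int q, j + int q))"
    by (rule J) simp
  also have "\<dots> = (\<Sum>q\<in>{0}. bcoef 0 q *\<^sub>C T (l, i + 0 - int q, j + int q))"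
    by (rule sum.mono_neutral_right) (auto simp: b)
  finally show "ep 0 T p = T p" by (simp add: p b scaleC_one)
qed

abbreviation mxz :: "'v::complex_vector dist3 \<Rightarrow> 'v dist3"
  where "mxz \<equiv> dsh (0, 1, 0) (0, 0, 1)"

abbreviation mzw :: "'v::complex_vector dist3 \<Rightarrow> 'v dist3"
  where "mzw \<equiv> dsh (0, 0, 1) (1, 0, 0)"

abbreviation mxw :: "'v::complex_vector dist3 \<Rightarrow> 'v dist3"
  where "mxw \<equiv> dsh (0, 1, 0) (1, 0, 0)"

lemma zbd_shift:
  assumes "zbd T"
  shows "zbd (\<lambda>p. T (p + u))"
  unfolding zbd_def
proof
  fix l
  obtain a b c where u: "u = (a, b, c)" by (cases u)
  obtain J where "\<And>i j. j \<ge> J \<Longrightarrow> T (l + a, i, j) = 0"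
    using assms unfolding zbd_def by blast
  then show "\<exists>J. \<forall>i j. J \<le> j \<longrightarrow> T ((l, i, j) + u) = 0"
    by (intro exI[of _ "J - c"]) (auto simp: u)
qed

lemma zbd_diff:
  assumes "zbd T" "zbd T'"
  shows "zbd (\<lambda>p. T p - T' p)"
  unfolding zbd_def
proof
  fix l
  obtain J J' where J: "\<And>i j. j \<ge> J \<Longrightarrow> T (l, i, j) = 0"
    and J': "\<And>i j. j \<ge> J' \<Longrightarrow> T' (l, i, j) = 0"
    using assms unfolding zbd_def by meson
  have "T (l, i, j) - T' (l, i, j) = 0" if "max J J' \<le> j" for i j
    using J J' that by simp
  then show "\<exists>J. \<forall>i j. J \<le> j \<longrightarrow> T (l, i, j) - T' (l, i, j) = 0" by blast
qed

lemma zbd_dsh: "zbd T \<Longrightarrow> zbd (dsh u v T)"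
  unfolding dsh_def by (intro zbd_diff zbd_shift)

lemma zbd_dsh_pow: "zbd T \<Longrightarrow> zbd ((dsh u v ^^ n) T)"
  by (induction n) (simp_all add: zbd_dsh)

lemma ep_shift: "ep n (\<lambda>p. T (p + u)) p = ep n T (p + u)"
proof -
  obtain a b c l i j where "u = (a, b, c)" "p = (l, i, j)" by (metis prod_cases3)
  then show ?thesis by (simp add: ep_def algebra_simps)
qed

lemma ep_diff:
  assumes "zbd T" "zbd T'"
  shows "ep n (\<lambda>p. T p - T' p) p = ep n T p - ep n T' p"
proof -
  obtain l i j where p: "p = (l, i, j)" by (cases p)
  obtain J where J: "\<And>n i j K. J \<le> j + int K \<Longrightarrow>
    ep n T (l, i, j) = (\<Sum>q<K. bcoef n q *\<^sub>C T (l, i + n - int q, j + int q))"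
    by (rule ep_eqE[OF assms(1), of l]) (rule that)
  obtain J' where J': "\<And>n i j K. J' \<le> j + int K \<Longrightarrow>
    ep n T' (l, i, j) = (\<Sum>q<K. bcoef n q *\<^sub>C T' (l, i + n - int q, j + int q))"
    by (rule ep_eqE[OF assms(2), of l]) (rule that)
  obtain J'' where J'': "\<And>n i j K. J'' \<le> j + int K \<Longrightarrow> ep n (\<lambda>p. T p - T' p) (l, i, j)
      = (\<Sum>q<K. bcoef n q *\<^sub>C (T (l, i + n - int q, j + int q) - T' (l, i + n - int q, j + int q)))"
    by (rule ep_eqE[OF zbd_diff[OF assms], of l]) (rule that)
  define K where "K = nat (max J (max J' J'') - j)"
  have "J \<le> j + int K" "J' \<le> j + int K" "J'' \<le> j + int K" by (auto simp: K_def)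
  then show ?thesis unfolding p
    by (simp add: J J' J'' complex_vector.scale_right_diff_distrib sum_subtractf)
qed

lemma ep_dsh: "zbd T \<Longrightarrow> ep n (dsh u v T) = dsh u v (ep n T)"
  by (rule ext) (simp add: dsh_def ep_diff zbd_shift ep_shift)

lemma ep_dsh_pow: "zbd T \<Longrightarrow> ep n ((dsh u v ^^ m) T) = (dsh u v ^^ m) (ep n T)"
  by (induction m) (simp_all add: ep_dsh zbd_dsh_pow)

lemma ep_map:
  assumes "clinear L" "zbd T"
  shows "ep n (\<lambda>p. L (T p)) p = L (ep n T p)"
proof -
  obtain l i j where p: "p = (l, i, j)" by (cases p)
  obtain J where J: "\<And>n i j K. J \<le> j + int K \<Longrightarrow>
    ep n T (l, i, j) = (\<Sum>q<K. bcoef n q *\<^sub>C T (l, i + n - int q, j + int q))"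
    "\<And>i j. j \<ge> J \<Longrightarrow> T (l, i, j) = 0"
    by (rule ep_eqE[OF assms(2), of l]) (rule that)
  have "ep n (\<lambda>p. L (T p)) (l, i, j)
      = (\<Sum>q<nat (J - j). bcoef n q *\<^sub>C L (T (l, i + n - int q, j + int q)))"
    by (rule ep_eq[of J]) (simp_all add: J(2) clinear_zero[OF assms(1)])
  moreover have "ep n T (l, i, j) = (\<Sum>q<nat (J - j). bcoef n q *\<^sub>C T (l, i + n - int q, j + int q))"
    by (rule J) simp
  moreover have "L (sum g A) = (\<Sum>x\<in>A. L (g x))" for g :: "nat \<Rightarrow> 'a" and A
    by (induction A rule: infinite_finite_induct)
       (simp_all add: clinear_zero[OF assms(1)] clinear_add[OF assms(1)])
  ultimately show ?thesis by (simp add: p clinear_scale[OF assms(1)])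
qed

text \<open>Pascal's rule \<open>bcoef_Suc\<close> is the relation (x - z) (x - z)^n = (x - z)^(n+1)
  on coefficients.\<close>

lemma ep_mxz:
  assumes "zbd T"
  shows "mxz (ep n T) = ep (n + 1) T"
proof
  fix p :: "int \<times> int \<times> int"
  obtain l i j where p: "p = (l, i, j)" by (cases p)
  obtain J where J: "\<And>n i j K. J \<le> j + int K \<Longrightarrow>
    ep n T (l, i, j) = (\<Sum>q<K. bcoef n q *\<^sub>C T (l, i + n - int q, j + int q))"
    by (rule ep_eqE[OF assms, of l]) (rule that)
  define K where "K = nat (J - j)"
  have K: "J \<le> j + int (Suc K)" "J \<le> j + 1 + int K" by (auto simp: K_def)
  define t where "t q = T (l, i + n + 1 - int q, j + int q)" for q
  have "mxz (ep n T) p = ep n T (l, i + 1, j) - ep n T (l, i, j + 1)"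
    by (simp add: p dsh_apply)
  also have "\<dots> = (\<Sum>q<Suc K. bcoef n q *\<^sub>C t q) - (\<Sum>q<K. bcoef n q *\<^sub>C t (Suc q))"
    unfolding J[OF K(1)] J[OF K(2)] by (simp add: t_def algebra_simps)
  also have "\<dots> = t 0 + (\<Sum>q<K. bcoef (n + 1) (Suc q) *\<^sub>C t (Suc q))"
    unfolding sum.lessThan_Suc_shift bcoef_Suc
    by (simp add: bcoef_0 scaleC_one complex_vector.scale_left_diff_distrib sum_subtractf)
  also have "\<dots> = (\<Sum>q<Suc K. bcoef (n + 1) q *\<^sub>C t q)"
    unfolding sum.lessThan_Suc_shift by (simp add: bcoef_0 scaleC_one)
  also have "\<dots> = ep (n + 1) T p"
    unfolding p J[OF K(1)] by (simp add: t_def algebra_simps)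
  finally show "mxz (ep n T) p = ep (n + 1) T p" .
qed

lemma ep_mxz_pow: "zbd T \<Longrightarrow> (mxz ^^ k) (ep n T) = ep (n + int k) T"
  by (induction k) (simp_all add: ep_mxz add_ac)

lemma ep_nonneg: "zbd T \<Longrightarrow> ep (int k) T = (mxz ^^ k) T"
  using ep_mxz_pow[of T k 0] by (simp add: ep_0)

abbreviation xbd :: "'v::complex_vector dist3 \<Rightarrow> bool"
  where "xbd T \<equiv> zbd (swap23 T)"

lemma swap23_swap23: "swap23 (swap23 T) = T"
  by (auto simp: swap23_def)

lemma swap23_dsh_pow:
  "swap23 ((dsh (a, b, c) (a', b', c') ^^ n) T) = (dsh (a, c, b) (a', c', b') ^^ n) (swap23 T)"
proof (induction n)
  case (Suc n)
  have "swap23 (dsh (a, b, c) (a', b', c') S) = dsh (a, c, b) (a', c', b') (swap23 S)" for S :: "'a dist3"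
    by (auto simp: swap23_def dsh_apply)
  then show ?case by (simp add: Suc.IH)
qed simp

lemma dsh_pow_scale: "(dsh u v ^^ n) (\<lambda>p. c *\<^sub>C T p) = (\<lambda>p. c *\<^sub>C (dsh u v ^^ n) T p)"
  by (rule dsh_pow_map) (rule clinearI; simp add: scaleC_add_right mult.commute)

lemma em_dsh_pow:
  assumes "xbd T"
  shows "em n ((dsh u v ^^ m) T) = (dsh u v ^^ m) (em n T)"
proof -
  obtain a b c a' b' c' where uv: "u = (a, b, c)" "v = (a', b', c')" by (metis prod_cases3)
  show ?thesis
    by (simp add: em_def uv swap23_dsh_pow ep_dsh_pow assms dsh_pow_scale)
qed

text \<open>Exchanging the variables turns x - z into z - x; the k signs are absorbed by the
  prefactor of \<open>em\<close>, which passes from exponent n to n + k.\<close>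

lemma em_mxz_pow:
  assumes "xbd T"
  shows "(mxz ^^ k) (em n T) = em (n + int k) T"
proof -
  have "(mxz ^^ k) (em n T) = (\<lambda>p. ((- 1) powi n) *\<^sub>C swap23 ((dsh (0, 0, 1) (0, 1, 0) ^^ k) (ep n (swap23 T))) p)"
    by (simp add: em_def dsh_pow_scale swap23_dsh_pow)
  also have "(dsh (0, 0, 1) (0, 1, 0) ^^ k) (ep n (swap23 T)) = (\<lambda>p. (- 1) ^ k *\<^sub>C ep (n + int k) (swap23 T) p)"
    by (subst dsh_pow_neg) (simp add: ep_mxz_pow[OF assms])
  finally show ?thesis
    by (simp add: em_def swap23_def case_prod_beta power_int_add)
qed

lemma em_0: "xbd T \<Longrightarrow> em 0 T = T"
  by (simp add: em_def ep_0 swap23_swap23 scaleC_one)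

lemma em_nonneg: "xbd T \<Longrightarrow> em (int k) T = (mxz ^^ k) T"
  using em_mxz_pow[of T k 0] by (simp add: em_0)

lemma em_map:
  assumes "clinear L" "xbd T"
  shows "em n (\<lambda>p. L (T p)) p = L (em n T p)"
proof -
  have *: "swap23 (\<lambda>p. L (T p)) = (\<lambda>p. L (swap23 T p))" by (auto simp: swap23_def)
  have "ep n (swap23 (\<lambda>p. L (T p))) = (\<lambda>p. L (ep n (swap23 T) p))"
    unfolding * by (rule ext) (rule ep_map[OF assms])
  then show ?thesis
    by (simp add: em_def swap23_def case_prod_beta clinear_scale[OF assms(1)])
qed

subsection \<open>Fields, locality and products\<close>

type_synonym 'v modes = "int \<Rightarrow> 'v \<Rightarrow> 'v"

text \<open>Here \<open>A m\<close> is the coefficient of z^(-m-1), so multiplication by z shifts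
  the index by one, and the bound on \<open>m\<close> says that A(z) c has a pole of finite
  order.\<close>

definition formal_field :: "'v::complex_vector modes \<Rightarrow> bool"
  where "formal_field A \<longleftrightarrow> (\<forall>m. clinear (A m)) \<and> (\<forall>c. \<exists>N. \<forall>m\<ge>N. A m c = 0)"

text \<open>\<open>(z - w)\<^sup>N\<close> annihilates the commutator of \<open>A(z)\<close> and \<open>B(w)\<close>.\<close>

definition local :: "nat \<Rightarrow> 'v::complex_vector modes \<Rightarrow> 'v modes \<Rightarrow> bool"
  where "local N A B \<longleftrightarrow>
    (\<forall>c p. (dsh (1, 0) (0, 1) ^^ N) (\<lambda>(i, j). A i (B j c) - B j (A i c)) p = 0)"

text \<open>The residue in \<open>x\<close> of \<open>A(x) B(z) (x - z)\<^sup>n - B(z) A(x) (x - z)\<^sup>n\<close>, suitably expanded.\<close>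

definition mprod :: "'v::complex_vector modes \<Rightarrow> int \<Rightarrow> 'v modes \<Rightarrow> 'v modes"
  where "mprod A n B m c =
    ep n (\<lambda>(l, i, j). A i (B j c)) (0, 0, m) - em n (\<lambda>(l, i, j). B j (A i c)) (0, 0, m)"

lemma formal_field_clinear: "formal_field A \<Longrightarrow> clinear (A m)"
  by (simp add: formal_field_def)

lemma formal_field_bound:
  assumes "formal_field A"
  obtains N where "\<And>m. m \<ge> N \<Longrightarrow> A m c = 0"
  using assms unfolding formal_field_def by blast

lemma local_mono: "local M A B \<Longrightarrow> M \<le> N \<Longrightarrow> local N A B"
  unfolding local_def by (intro allI, rule dsh_pow_mono[where n = M]) blast+

lemma local_sym:
  assumes "local N A B"
  shows "local N B A"
  unfolding local_def
proof (intro allI)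
  fix c p
  let ?T = "\<lambda>(i, j). A i (B j c) - B j (A i c)"
  have "(dsh (1, 0) (0, 1) ^^ N) (\<lambda>p. - ?T (prod.swap p)) p
      = - (dsh (1, 0) (0, 1) ^^ N) (\<lambda>p. ?T (prod.swap p)) p"
    by (subst dsh_pow_map[where L = uminus]) (auto intro: clinearI)
  also have "(dsh (1, 0) (0, 1) ^^ N) (\<lambda>p. ?T (prod.swap p)) p = (dsh (0, 1) (1, 0) ^^ N) ?T (prod.swap p)"
    by (subst dsh_pow_reindex[where u' = "(0,1)" and v' = "(1,0)"]) auto
  also have "\<dots> = 0"
    using assms by (subst dsh_pow_neg) (simp only: local_def complex_vector.scale_zero_right)
  finally have "(dsh (1, 0) (0, 1) ^^ N) (\<lambda>p. - ?T (prod.swap p)) p = 0" by simp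
  moreover have "(\<lambda>(i, j). B i (A j c) - A j (B i c)) = (\<lambda>p. - ?T (prod.swap p))" by auto
  ultimately show "(dsh (1, 0) (0, 1) ^^ N) (\<lambda>(i, j). B i (A j c) - A j (B i c)) p = 0" by simp
qed

lemma zbd_comp:
  assumes "formal_field A" "formal_field B"
  shows "zbd (\<lambda>(l, i, j). A i (B j (g l)))" "xbd (\<lambda>(l, i, j). B j (A i (g l)))"
proof -
  have *: "zbd (\<lambda>(l, i, j). A i (B j (g l)))" if AB: "formal_field A" "formal_field B" for A B :: "'a modes"
    unfolding zbd_def
  proof
    fix l
    obtain N where N: "\<And>m. m \<ge> N \<Longrightarrow> B m (g l) = 0"
      using AB(2) unfolding formal_field_def by blast
    have "A i (B j (g l)) = 0" if "j \<ge> N" for i j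
      by (simp only: N[OF that] clinear_zero[OF formal_field_clinear[OF AB(1)]])
    then show "\<exists>J. \<forall>i j. J \<le> j \<longrightarrow> (case (l, i, j) of (l, i, j) \<Rightarrow> A i (B j (g l))) = 0"
      by auto
  qed
  show "zbd (\<lambda>(l, i, j). A i (B j (g l)))" by (rule *[OF assms])
  have "swap23 (\<lambda>(l, i, j). B j (A i (g l))) = (\<lambda>(l, i, j). B i (A j (g l)))"
    by (auto simp: swap23_def)
  then show "xbd (\<lambda>(l, i, j). B j (A i (g l)))" using *[OF assms(2,1)] by simp
qed

text \<open>Transports locality to distributions in three variables: \<open>f\<close> freezes the
  index of the variable not involved. The next lemma also allows an outer operator \<open>L\<close>,
  such as a mode of the third field.\<close>

lemma local_slice:
  assumes "local N A B"
    and f: "\<And>p. f (p + (1, 0)) = f p + u" "\<And>p. f (p + (0, 1)) = f p + v"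
    and T: "\<And>i j. T (f (i, j)) = A i (B j c) - B j (A i c)"
  shows "(dsh u v ^^ N) T (f q) = 0"
proof -
  have "(dsh (1, 0) (0, 1) ^^ N) (\<lambda>p. T (f p)) q = (dsh u v ^^ N) T (f q)"
    by (simp only: dsh_pow_reindex[OF f])
  moreover have "(\<lambda>p. T (f p)) = (\<lambda>(i, j). A i (B j c) - B j (A i c))"
    using T by (auto simp: fun_eq_iff)
  moreover have "(dsh (1, 0) (0, 1) ^^ N) (\<lambda>(i, j). A i (B j c) - B j (A i c)) q = 0"
    using assms(1) unfolding local_def by blast
  ultimately show ?thesis by simp
qed

lemma local_slice_map:
  assumes "local N A B" "clinear L"
    and f: "\<And>p. f (p + (1, 0)) = f p + u" "\<And>p. f (p + (0, 1)) = f p + v"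
    and T: "\<And>i j. T (f (i, j)) = L (A i (B j c) - B j (A i c))"
  shows "(dsh u v ^^ N) T (f q) = 0"
proof -
  have "(dsh (1, 0) (0, 1) ^^ N) (\<lambda>p. T (f p)) q = (dsh u v ^^ N) T (f q)"
    by (simp only: dsh_pow_reindex[OF f])
  moreover have "(\<lambda>p. T (f p)) = (\<lambda>p. L ((\<lambda>(i, j). A i (B j c) - B j (A i c)) p))"
    using T by (auto simp: fun_eq_iff)
  moreover have "(dsh (1, 0) (0, 1) ^^ N) (\<lambda>(i, j). A i (B j c) - B j (A i c)) q = 0"
    using assms(1) unfolding local_def by blast
  ultimately show ?thesis
    by (simp add: dsh_pow_map[OF assms(2)] clinear_zero[OF assms(2)])
qed

lemma ep_slice: "ep n T (l, i, j) = ep n (\<lambda>(_, i, j). T (l, i, j)) (0, i, j)"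
  by (simp add: ep_def)

lemma em_slice: "em n T (l, i, j) = em n (\<lambda>(_, i, j). T (l, i, j)) (0, i, j)"
  by (simp add: em_def swap23_def ep_def)

text \<open>Index 0 in x is the residue. Composing a product with a mode of a third field on either
  side only adds the spectator variable w, so both orders become three-variable expressions that can
  be subtracted.\<close>

lemma mprod_comp:
  assumes "formal_field A" "formal_field B" "formal_field C"
  shows "mprod A n B j (C l c)
      = ep n (\<lambda>(l, i, j). A i (B j (C l c))) (l, 0, j) - em n (\<lambda>(l, i, j). B j (A i (C l c))) (l, 0, j)"
    and "C l (mprod A n B j c)
      = ep n (\<lambda>(l, i, j). C l (A i (B j c))) (l, 0, j) - em n (\<lambda>(l, i, j). C l (B j (A i c))) (l, 0, j)"
proof -
  show "mprod A n B j (C l c)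
      = ep n (\<lambda>(l, i, j). A i (B j (C l c))) (l, 0, j) - em n (\<lambda>(l, i, j). B j (A i (C l c))) (l, 0, j)"
    unfolding mprod_def by (subst (2) ep_slice, subst (2) em_slice) simp
  note C = formal_field_clinear[OF assms(3), of l]
  note z = zbd_comp[OF assms(1,2), of "\<lambda>_. c"]
  have "C l (mprod A n B j c)
      = ep n (\<lambda>p. C l (case p of (l, i, j) \<Rightarrow> A i (B j c))) (0, 0, j)
      - em n (\<lambda>p. C l (case p of (l, i, j) \<Rightarrow> B j (A i c))) (0, 0, j)"
    unfolding mprod_def by (simp only: clinear_diff[OF C] ep_map[OF C z(1)] em_map[OF C z(2)])
  moreover have eqs: "(\<lambda>p. C l (case p of (l, i, j) \<Rightarrow> A i (B j c))) = (\<lambda>(_, i, j). C l (A i (B j c)))"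
    "(\<lambda>p. C l (case p of (l, i, j) \<Rightarrow> B j (A i c))) = (\<lambda>(_, i, j). C l (B j (A i c)))"
    by auto
  ultimately show "C l (mprod A n B j c)
      = ep n (\<lambda>(l, i, j). C l (A i (B j c))) (l, 0, j) - em n (\<lambda>(l, i, j). C l (B j (A i c))) (l, 0, j)"
    by (subst ep_slice, subst em_slice) (simp only: eqs prod.case)
qed

lemma zbd_map:
  assumes "zbd T" "\<And>l i j. T (l, i, j) = 0 \<Longrightarrow> T' (l, i, j) = 0"
  shows "zbd T'"
  unfolding zbd_def
proof
  fix l
  obtain J where "\<forall>i j. J \<le> j \<longrightarrow> T (l, i, j) = 0" using assms(1) unfolding zbd_def by blast
  then have "\<forall>i j. J \<le> j \<longrightarrow> T' (l, i, j) = 0" using assms(2) by blast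
  then show "\<exists>J. \<forall>i j. J \<le> j \<longrightarrow> T' (l, i, j) = 0" by blast
qed

lemma local_0: "local 0 A B \<longleftrightarrow> (\<forall>i j c. A i (B j c) = B j (A i c))"
  unfolding local_def by auto

text \<open>Exact commutation passes to products. The order in \<open>dong\<close> contains |n|,
  which would not suffice for fields translated far apart.\<close>

lemma mprod_local_0:
  assumes "formal_field A" "formal_field B" "formal_field C" "local 0 A C" "local 0 B C"
  shows "local 0 (mprod A n B) C"
proof -
  have "A i (C l c) = C l (A i c)" "B i (C l c) = C l (B i c)" for i l c
    using assms(4,5) by (simp_all add: local_0)
  then show ?thesis
    unfolding local_0 mprod_comp[OF assms(1-3)] by simp
qed

text \<open>
  Dong's lemma. Writing \<open>z - w = (x - w) - (x - z)\<close>, powers of \<open>x - z\<close> absorb the expansion of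
  \<open>(x - z)\<^sup>n\<close>, while \<open>(x - w)\<^sup>N (z - w)\<^sup>N\<close> moves \<open>C\<close> past both \<open>A\<close> and \<open>B\<close>.
\<close>

lemma dong:
  assumes fields: "formal_field A" "formal_field B" "formal_field C"
    and loc: "local N A B" "local N A C" "local N B C"
  shows "local (nat \<bar>n\<bar> + N + N + N) (mprod A n B) C"
  unfolding local_def
proof (intro allI)
  fix c and q :: "int \<times> int"
  let ?k = "nat \<bar>n\<bar>" and ?K = "nat (n + \<bar>n\<bar>)"
  define ABC where "ABC = (\<lambda>(l, i, j). A i (B j (C l c)))"
  define BAC where "BAC = (\<lambda>(l, i, j). B j (A i (C l c)))"
  define CAB where "CAB = (\<lambda>(l, i, j). C l (A i (B j c)))"
  define CBA where "CBA = (\<lambda>(l, i, j). C l (B j (A i c)))"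
  define ACB where "ACB = (\<lambda>(l, i, j). A i (C l (B j c)))"
  define BCA where "BCA = (\<lambda>(l, i, j). B j (C l (A i c)))"
  define X where "X = (\<lambda>p. ABC p - CAB p)"
  define Y where "Y = (\<lambda>p. BAC p - CBA p)"
  define U where "U = (\<lambda>p. ep n X p - em n Y p)"
  note lin = formal_field_clinear[OF fields(1)] formal_field_clinear[OF fields(2)]
    formal_field_clinear[OF fields(3)]
  have z: "zbd ABC" "xbd BAC"
    unfolding ABC_def BAC_def by (rule zbd_comp[OF fields(1,2)])+
  have z': "zbd CAB" "xbd CBA"
  proof -
    show "zbd CAB"
      by (rule zbd_map[OF zbd_comp(1)[OF fields(1,2), of "\<lambda>_. c"]])
         (simp add: CAB_def clinear_zero[OF lin(3)])
    show "xbd CBA"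
      by (rule zbd_map[OF zbd_comp(1)[OF fields(2,1), of "\<lambda>_. c"]])
         (simp add: CBA_def swap23_def clinear_zero[OF lin(3)])
  qed
  have swapY: "swap23 Y = (\<lambda>p. swap23 BAC p - swap23 CBA p)"
    by (auto simp: Y_def swap23_def)
  have zX: "zbd X" and xY: "xbd Y"
    unfolding swapY unfolding X_def by (intro zbd_diff z z')+
  have emY: "em n Y p = em n BAC p - em n CBA p" for p
  proof -
    obtain l i j where p: "p = (l, i, j)" by (cases p)
    have sw: "swap23 T (l, i, j) = T (l, j, i)" for T :: "'a dist3" by (simp add: swap23_def)
    show ?thesis
      unfolding em_def p sw swapY ep_diff[OF z(2) z'(2)]
      by (rule complex_vector.scale_right_diff_distrib)
  qed
  have U: "U (l, 0, j) = mprod A n B j (C l c) - C l (mprod A n B j c)" for l j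
    unfolding mprod_comp[OF fields] U_def emY unfolding X_def ep_diff[OF z(1) z'(1)]
    unfolding ABC_def BAC_def CAB_def CBA_def by simp

  \<comment> \<open>After multiplication by (x - z)^|n| the exponent n + |n| is nonnegative, and
    both expansions become honest multiplication. What remains is the difference \<open>X\<close> -
    \<open>Y\<close>, consisting of the commutator of A and B applied before and after C.\<close>
  have "(mxz ^^ ?k) U = (\<lambda>p. (mxz ^^ ?K) X p - (mxz ^^ ?K) Y p)"
  proof -
    have "n + int ?k = int ?K" by simp
    then show ?thesis
      unfolding U_def dsh_pow_diff ep_mxz_pow[OF zX] em_mxz_pow[OF xY]
      by (simp only: ep_nonneg[OF zX] em_nonneg[OF xY])
  qed
  also have "\<dots> = (mxz ^^ ?K) (\<lambda>p. X p - Y p)" by (simp only: dsh_pow_diff)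
  finally have 1: "(mxz ^^ (N + ?k)) U = (mxz ^^ ?K) ((mxz ^^ N) (\<lambda>p. X p - Y p))"
    by (simp add: funpow_add dsh_pow_commute)
  have "(mxz ^^ N) (\<lambda>p. X p - Y p) p = 0" for p
  proof -
    obtain l i j where p: "p = (l, i, j)" by (cases p)
    have "(mxz ^^ N) (\<lambda>p. ABC p - BAC p) ((\<lambda>(i, j). (l, i, j)) (i, j)) = 0"
      by (rule local_slice[OF loc(1), where c = "C l c"]) (auto simp: ABC_def BAC_def)
    moreover have "(mxz ^^ N) (\<lambda>p. CAB p - CBA p) ((\<lambda>(i, j). (l, i, j)) (i, j)) = 0"
      by (rule local_slice_map[OF loc(1) lin(3)[of l], where c = c])
         (auto simp: CAB_def CBA_def clinear_diff[OF lin(3)])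
    moreover have "(\<lambda>p. X p - Y p) = (\<lambda>p. (ABC p - BAC p) - (CAB p - CBA p))"
      by (auto simp: X_def Y_def)
    ultimately show ?thesis by (simp add: p dsh_pow_diff)
  qed
  then have "(mxz ^^ N) (\<lambda>p. X p - Y p) = (\<lambda>p. 0)" by blast
  with 1 have claim1: "(mxz ^^ (N + ?k)) U = (\<lambda>p. 0)" by (simp only: dsh_pow_zero)

  have X0: "(mxw ^^ N) ((mzw ^^ N) X) = (\<lambda>p. 0)"
  proof -
    have "(mzw ^^ N) (\<lambda>p. ABC p - ACB p) p = 0" for p
    proof -
      obtain l i j where p: "p = (l, i, j)" by (cases p)
      have "(mzw ^^ N) (\<lambda>p. ABC p - ACB p) ((\<lambda>(j, l). (l, i, j)) (j, l)) = 0"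
        by (rule local_slice_map[OF loc(3) lin(1)[of i], where c = c])
           (auto simp: ABC_def ACB_def clinear_diff[OF lin(1)])
      then show ?thesis by (simp add: p)
    qed
    moreover have "(mxw ^^ N) (\<lambda>p. ACB p - CAB p) p = 0" for p
    proof -
      obtain l i j where p: "p = (l, i, j)" by (cases p)
      have "(mxw ^^ N) (\<lambda>p. ACB p - CAB p) ((\<lambda>(i, l). (l, i, j)) (i, l)) = 0"
        by (rule local_slice[OF loc(2), where c = "B j c"]) (auto simp: CAB_def ACB_def)
      then show ?thesis by (simp add: p)
    qed
    ultimately have 0: "(mzw ^^ N) (\<lambda>p. ABC p - ACB p) = (\<lambda>p. 0)"
      "(mxw ^^ N) (\<lambda>p. ACB p - CAB p) = (\<lambda>p. 0)" by blast+
    have "X = (\<lambda>p. (ABC p - ACB p) + (ACB p - CAB p))" by (simp add: X_def)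
    then have "(mxw ^^ N) ((mzw ^^ N) X) = (\<lambda>p. (mxw ^^ N) ((mzw ^^ N) (\<lambda>p. ABC p - ACB p)) p
        + (mxw ^^ N) ((mzw ^^ N) (\<lambda>p. ACB p - CAB p)) p)"
      by (simp only: dsh_pow_add_fun)
    moreover have "(mxw ^^ N) ((mzw ^^ N) (\<lambda>p. ACB p - CAB p))
        = (mzw ^^ N) ((mxw ^^ N) (\<lambda>p. ACB p - CAB p))"
      by (rule dsh_pow_commute)
    ultimately show ?thesis by (simp only: 0 dsh_pow_zero add_0)
  qed
  have Y0: "(mxw ^^ N) ((mzw ^^ N) Y) = (\<lambda>p. 0)"
  proof -
    have "(mzw ^^ N) (\<lambda>p. BCA p - CBA p) p = 0" for p
    proof -
      obtain l i j where p: "p = (l, i, j)" by (cases p)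
      have "(mzw ^^ N) (\<lambda>p. BCA p - CBA p) ((\<lambda>(j, l). (l, i, j)) (j, l)) = 0"
        by (rule local_slice[OF loc(3), where c = "A i c"]) (auto simp: CBA_def BCA_def)
      then show ?thesis by (simp add: p)
    qed
    moreover have "(mxw ^^ N) (\<lambda>p. BAC p - BCA p) p = 0" for p
    proof -
      obtain l i j where p: "p = (l, i, j)" by (cases p)
      have "(mxw ^^ N) (\<lambda>p. BAC p - BCA p) ((\<lambda>(i, l). (l, i, j)) (i, l)) = 0"
        by (rule local_slice_map[OF loc(2) lin(2)[of j], where c = c])
           (auto simp: BAC_def BCA_def clinear_diff[OF lin(2)])
      then show ?thesis by (simp add: p)
    qed
    ultimately have 0: "(mzw ^^ N) (\<lambda>p. BCA p - CBA p) = (\<lambda>p. 0)"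
      "(mxw ^^ N) (\<lambda>p. BAC p - BCA p) = (\<lambda>p. 0)" by blast+
    have "Y = (\<lambda>p. (BAC p - BCA p) + (BCA p - CBA p))" by (simp add: Y_def)
    then have "(mxw ^^ N) ((mzw ^^ N) Y) = (\<lambda>p. (mxw ^^ N) ((mzw ^^ N) (\<lambda>p. BAC p - BCA p)) p
        + (mxw ^^ N) ((mzw ^^ N) (\<lambda>p. BCA p - CBA p)) p)"
      by (simp only: dsh_pow_add_fun)
    moreover have "(mxw ^^ N) ((mzw ^^ N) (\<lambda>p. BAC p - BCA p))
        = (mzw ^^ N) ((mxw ^^ N) (\<lambda>p. BAC p - BCA p))"
      by (rule dsh_pow_commute)
    ultimately show ?thesis by (simp only: 0 dsh_pow_zero add_0)
  qed

  \<comment> \<open>One factor (z - w)^N is spent here on moving C past B. The other N + |n| + N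
    factors are distributed by \<open>dsh_pow_combine\<close>: N + |n| powers of x - z serve
    \<open>claim3\<close>, and N powers of x - w serve \<open>claim2\<close>.\<close>
  define U' where "U' = (mzw ^^ N) U"
  have claim2: "(mxw ^^ N) U' = (\<lambda>p. 0)"
  proof -
    have "(mxw ^^ N) U' = (\<lambda>p. ep n ((mxw ^^ N) ((mzw ^^ N) X)) p - em n ((mxw ^^ N) ((mzw ^^ N) Y)) p)"
    proof -
      have xd: "xbd ((mzw ^^ N) Y)" by (simp only: swap23_dsh_pow zbd_dsh_pow[OF xY])
      show ?thesis
        unfolding U'_def U_def
        by (simp only: dsh_pow_diff ep_dsh_pow[OF zX] ep_dsh_pow[OF zbd_dsh_pow[OF zX]]
            em_dsh_pow[OF xY] em_dsh_pow[OF xd])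
    qed
    also have "\<dots> = (\<lambda>p. 0)"
      unfolding X0 Y0 by (auto simp: ep_def em_def swap23_def)
    finally show ?thesis .
  qed
  have claim3: "(mxz ^^ (N + ?k)) U' = (\<lambda>p. 0)"
    unfolding U'_def by (subst dsh_pow_commute) (simp only: claim1 dsh_pow_zero)
  have "(mzw ^^ (N + ?k + N)) U' p = 0" for p
    by (rule dsh_pow_combine[where u = "(0, 1, 0)" and v = "(0, 0, 1)" and w = "(1, 0, 0)"
          and m = "N + ?k" and n = N]) (simp_all only: claim2 claim3)
  then have "(mzw ^^ (N + ?k + N + N)) U p = 0" for p
    by (simp add: U'_def funpow_add)
  moreover have "N + ?k + N + N = ?k + N + N + N" by simp
  ultimately have fin: "(mzw ^^ (?k + N + N + N)) U p = 0" for p by simp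
  have "(dsh (1, 0) (0, 1) ^^ (?k + N + N + N)) (\<lambda>p. U ((\<lambda>(j, l). (l, 0, j)) p)) q = 0"
    by (subst dsh_pow_reindex[where u' = "(0, 0, 1)" and v' = "(1, 0, 0)"]) (auto simp: fin)
  moreover have "(\<lambda>p. U ((\<lambda>(j, l). (l, 0, j)) p))
      = (\<lambda>(i, j). mprod A n B i (C j c) - C j (mprod A n B i c))"
    by (auto simp: U)
  ultimately show "(dsh (1, 0) (0, 1) ^^ (?k + N + N + N))
      (\<lambda>(i, j). mprod A n B i (C j c) - C j (mprod A n B i c)) q = 0" by simp
qed

text \<open>The usual formula for the n-th product. The cut-offs \<open>K\<close> and
  \<open>K'\<close> are left free so that several vectors can be compared under common
  bounds.\<close>

lemma mprod_eq:
  assumes fields: "formal_field A" "formal_field B"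
    and "\<And>m. m \<ge> J \<Longrightarrow> B m c = 0" "\<And>m. m \<ge> I \<Longrightarrow> A m c = 0"
    and "J \<le> m + int K" "I \<le> int K'"
  shows "mprod A n B m c = (\<Sum>q<K. bcoef n q *\<^sub>C A (n - int q) (B (m + int q) c))
      - ((- 1) powi n) *\<^sub>C (\<Sum>q<K'. bcoef n q *\<^sub>C B (m + n - int q) (A (int q) c))"
proof -
  have "ep n (\<lambda>(l, i, j). A i (B j c)) (0, 0, m)
      = (\<Sum>q<K. bcoef n q *\<^sub>C (\<lambda>(l, i, j). A i (B j c)) (0 :: int, 0 + n - int q, m + int q))"
    using assms by (intro ep_eq[where J = J]) (auto simp: clinear_zero[OF formal_field_clinear])
  moreover have "ep n (\<lambda>(l, i, j). B i (A j c)) (0, m, 0)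
      = (\<Sum>q<K'. bcoef n q *\<^sub>C (\<lambda>(l, i, j). B i (A j c)) (0 :: int, m + n - int q, 0 + int q))"
    using assms by (intro ep_eq[where J = I]) (auto simp: clinear_zero[OF formal_field_clinear])
  moreover have "swap23 (\<lambda>(l, i, j). B j (A i c)) = (\<lambda>(l, i, j). B i (A j c))"
    by (auto simp: swap23_def)
  ultimately show ?thesis
    unfolding mprod_def em_def by (simp add: swap23_def)
qed

lemma bounded_family:
  assumes "\<And>c. \<exists>N. \<forall>m\<ge>N. B m c = 0"
  shows "\<exists>N::int. \<forall>q<K. \<forall>m\<ge>N. B m (f (q::nat)) = 0"
proof (induction K)
  case (Suc K)
  then obtain N where "\<forall>q<K. \<forall>m\<ge>N. B m (f q) = 0" by blast
  moreover obtain N' where "\<forall>m\<ge>N'. B m (f K) = 0" using assms by blast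
  ultimately show ?case
    by (intro exI[of _ "max N N'"]) (auto simp: less_Suc_eq)
qed simp

lemma formal_field_mprod:
  assumes "formal_field A" "formal_field B"
  shows "formal_field (mprod A n B)"
  unfolding formal_field_def
proof (intro conjI allI)
  note A = formal_field_clinear[OF assms(1)] and B = formal_field_clinear[OF assms(2)]
  fix m
  show "clinear (mprod A n B m)"
  proof (rule clinearI)
    fix x y c
    obtain J1 where J1: "\<And>m. m \<ge> J1 \<Longrightarrow> B m x = 0" by (rule formal_field_bound[OF assms(2)]) (rule that)
    obtain J2 where J2: "\<And>m. m \<ge> J2 \<Longrightarrow> B m y = 0" by (rule formal_field_bound[OF assms(2)]) (rule that)
    obtain I1 where I1: "\<And>m. m \<ge> I1 \<Longrightarrow> A m x = 0" by (rule formal_field_bound[OF assms(1)]) (rule that)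
    obtain I2 where I2: "\<And>m. m \<ge> I2 \<Longrightarrow> A m y = 0" by (rule formal_field_bound[OF assms(1)]) (rule that)
    define J where "J = max J1 J2"
    define I where "I = max I1 I2"
    have J: "B m x = 0" "B m y = 0" "B m (x + y) = 0" "B m (c *\<^sub>C x) = 0" if "m \<ge> J" for m
      using that J1 J2 by (simp_all add: J_def clinear_add[OF B] clinear_scale[OF B])
    have I: "A m x = 0" "A m y = 0" "A m (x + y) = 0" "A m (c *\<^sub>C x) = 0" if "m \<ge> I" for m
      using that I1 I2 by (simp_all add: I_def clinear_add[OF A] clinear_scale[OF A])
    have K: "J \<le> m + int (nat (J - m))" "I \<le> int (nat I)" by auto
    have eq: "mprod A n B m z = (\<Sum>q<nat (J - m). bcoef n q *\<^sub>C A (n - int q) (B (m + int q) z))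
      - ((- 1) powi n) *\<^sub>C (\<Sum>q<nat I. bcoef n q *\<^sub>C B (m + n - int q) (A (int q) z))"
      if "\<And>m. m \<ge> J \<Longrightarrow> B m z = 0" "\<And>m. m \<ge> I \<Longrightarrow> A m z = 0" for z
      by (rule mprod_eq[OF assms that K])
    have e: "mprod A n B m x = (\<Sum>q<nat (J - m). bcoef n q *\<^sub>C A (n - int q) (B (m + int q) x))
      - ((- 1) powi n) *\<^sub>C (\<Sum>q<nat I. bcoef n q *\<^sub>C B (m + n - int q) (A (int q) x))"
      by (rule eq[OF J(1) I(1)])
    have "mprod A n B m y = (\<Sum>q<nat (J - m). bcoef n q *\<^sub>C A (n - int q) (B (m + int q) y))
      - ((- 1) powi n) *\<^sub>C (\<Sum>q<nat I. bcoef n q *\<^sub>C B (m + n - int q) (A (int q) y))"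
      by (rule eq[OF J(2) I(2)])
    moreover have "mprod A n B m (x + y)
      = (\<Sum>q<nat (J - m). bcoef n q *\<^sub>C A (n - int q) (B (m + int q) (x + y)))
      - ((- 1) powi n) *\<^sub>C (\<Sum>q<nat I. bcoef n q *\<^sub>C B (m + n - int q) (A (int q) (x + y)))"
      by (rule eq[OF J(3) I(3)])
    ultimately show "mprod A n B m (x + y) = mprod A n B m x + mprod A n B m y"
      by (simp add: e clinear_add[OF A] clinear_add[OF B] scaleC_add_right sum.distrib)
    have comm: "a *\<^sub>C c *\<^sub>C z = c *\<^sub>C a *\<^sub>C z" for a :: complex and z :: 'a
      by (simp add: mult.commute)
    have "mprod A n B m (c *\<^sub>C x)
      = (\<Sum>q<nat (J - m). bcoef n q *\<^sub>C A (n - int q) (B (m + int q) (c *\<^sub>C x)))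
      - ((- 1) powi n) *\<^sub>C (\<Sum>q<nat I. bcoef n q *\<^sub>C B (m + n - int q) (A (int q) (c *\<^sub>C x)))"
      by (rule eq[OF J(4) I(4)])
    then show "mprod A n B m (c *\<^sub>C x) = c *\<^sub>C mprod A n B m x"
      unfolding e by (simp only: clinear_scale[OF A] clinear_scale[OF B] complex_vector.scale_right_diff_distrib
          complex_vector.scale_sum_right comm)
  qed
next
  fix c
  obtain J where J: "\<And>m. m \<ge> J \<Longrightarrow> B m c = 0" by (rule formal_field_bound[OF assms(2)]) (rule that)
  obtain I where I: "\<And>m. m \<ge> I \<Longrightarrow> A m c = 0" by (rule formal_field_bound[OF assms(1)]) (rule that)
  obtain N where N: "\<forall>q<nat I. \<forall>m\<ge>N. B m (A (int q) c) = 0"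
    using bounded_family[of B "nat I" "\<lambda>q. A (int q) c"] assms(2) unfolding formal_field_def by blast
  \<comment> \<open>From this index on the first sum is empty. The second involves only the vectors
    \<open>A (int q) c\<close> with q below \<open>nat I\<close>, for which \<open>N\<close> is a
    common bound.\<close>
  have "mprod A n B m c = 0" if m: "m \<ge> max J (N - n + int (nat I))" for m
  proof -
    have "mprod A n B m c = (\<Sum>q<0. bcoef n q *\<^sub>C A (n - int q) (B (m + int q) c))
      - ((- 1) powi n) *\<^sub>C (\<Sum>q<nat I. bcoef n q *\<^sub>C B (m + n - int q) (A (int q) c))"
      by (rule mprod_eq[OF assms J I]) (use m in auto)
    also have "(\<Sum>q<nat I. bcoef n q *\<^sub>C B (m + n - int q) (A (int q) c)) = 0"
    proof (rule sum.neutral, rule ballI)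
      fix q assume "q \<in> {..<nat I}"
      then have q: "q < nat I" by simp
      then have "int q < int (nat I)" by (simp only: of_nat_less_iff)
      then have "N \<le> m + n - int q" using m by linarith
      with q N have "B (m + n - int q) (A (int q) c) = 0" by blast
      then show "bcoef n q *\<^sub>C B (m + n - int q) (A (int q) c) = 0" by simp
    qed
    finally show ?thesis by simp
  qed
  then show "\<exists>N. \<forall>m\<ge>N. mprod A n B m c = 0" by blast
qed


text \<open>On a vector killed by the nonnegative modes the second sum of \<open>mprod_eq\<close> is
  empty, and at index -1 only q = 0 survives in the first. The product field thus creates a mode of
  A applied to the state created by B.\<close>

lemma mprod_creative:
  assumes "formal_field A" "formal_field B" "\<And>m. m \<ge> 0 \<Longrightarrow> A m v = 0" "\<And>m. m \<ge> 0 \<Longrightarrow> B m v = 0"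
  shows "m \<ge> 0 \<Longrightarrow> mprod A n B m v = 0"
    and "mprod A n B (- 1) v = A n (B (- 1) v)"
proof -
  show "mprod A n B m v = 0" if "m \<ge> 0"
  proof -
    have "mprod A n B m v = (\<Sum>q<0. bcoef n q *\<^sub>C A (n - int q) (B (m + int q) v))
      - ((- 1) powi n) *\<^sub>C (\<Sum>q<0. bcoef n q *\<^sub>C B (m + n - int q) (A (int q) v))"
      by (rule mprod_eq[OF assms(1,2), where J = 0 and I = 0]) (use assms(3,4) that in auto)
    then show ?thesis by simp
  qed
  have "mprod A n B (- 1) v = (\<Sum>q<1. bcoef n q *\<^sub>C A (n - int q) (B (- 1 + int q) v))
      - ((- 1) powi n) *\<^sub>C (\<Sum>q<0. bcoef n q *\<^sub>C B (- 1 + n - int q) (A (int q) v))"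
    by (rule mprod_eq[OF assms(1,2), where J = 0 and I = 0]) (use assms(3,4) in auto)
  then show "mprod A n B (- 1) v = A n (B (- 1) v)"
    by (simp add: bcoef_0 scaleC_one)
qed

text \<open>The commutator of \<open>D\<close> with A(z) is dA/dz, written in modes.\<close>

definition covariant :: "('v \<Rightarrow> 'v) \<Rightarrow> 'v::complex_vector modes \<Rightarrow> bool"
  where "covariant D A \<longleftrightarrow> (\<forall>m c. D (A m c) = A m (D c) - of_int m *\<^sub>C A (m - 1) c)"

lemma mprod_covariant:
  assumes fields: "formal_field A" "formal_field B" and D: "clinear D"
    and cov: "covariant D A" "covariant D B"
  shows "covariant D (mprod A n B)"
  unfolding covariant_def
proof (intro allI)
  note A = formal_field_clinear[OF fields(1)] and B = formal_field_clinear[OF fields(2)]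
  fix m c
  \<comment> \<open>The operator d/dx + d/dz in modes. It commutes with multiplication by (x - z)^n,
    which is the fact \<open>ep\<delta>\<close> proved next.\<close>
  define \<delta> :: "'a dist3 \<Rightarrow> 'a dist3" where
    "\<delta> T = (\<lambda>(l, i, j). - (of_int i *\<^sub>C T (l, i - 1, j) + of_int j *\<^sub>C T (l, i, j - 1)))" for T
  have z\<delta>: "zbd (\<delta> T)" if "zbd T" for T
    unfolding zbd_def
  proof
    fix l
    obtain J where J: "\<And>i j. j \<ge> J \<Longrightarrow> T (l, i, j) = 0" using \<open>zbd T\<close> unfolding zbd_def by blast
    have "\<delta> T (l, i, j) = 0" if "j \<ge> J + 1" for i j
      using J[of j "i - 1"] J[of "j - 1" i] that by (simp add: \<delta>_def)
    then show "\<exists>J. \<forall>i j. J \<le> j \<longrightarrow> \<delta> T (l, i, j) = 0" by blast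
  qed
  have ep\<delta>: "ep n (\<delta> T) = \<delta> (ep n T)" if zT: "zbd T" for T :: "'a dist3"
  proof
    fix p :: "int \<times> int \<times> int"
    obtain l i j where p: "p = (l, i, j)" by (cases p)
    obtain J where J: "\<And>n i j K. J \<le> j + int K \<Longrightarrow>
      ep n T (l, i, j) = (\<Sum>q<K. bcoef n q *\<^sub>C T (l, i + n - int q, j + int q))"
      "\<And>i j. j \<ge> J \<Longrightarrow> T (l, i, j) = 0"
      by (rule ep_eqE[OF zT, of l]) (rule that)
    define K where "K = nat (J - j)"
    have K: "J \<le> j + int K" "J \<le> j - 1 + int (Suc K)" by (auto simp: K_def)
    define t where "t q = T (l, i + n - int q - 1, j + int q)" for q
    define s where "s = T (l, i + n, j - 1)"
    have tK: "t K = 0" unfolding t_def using K by (intro J(2)) simp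
    have e: "i + n - int (Suc q) = i + n - int q - 1" "j + int (Suc q) - 1 = j + int q"
      "j - 1 + int (Suc q) = j + int q" "i - 1 + n - int q = i + n - int q - 1" for q by simp_all
    have c0: "bcoef n q *\<^sub>C \<delta> T (l, i + n - int q, j + int q)
        = - ((bcoef n q * of_int (i + n - int q)) *\<^sub>C t q
           + (bcoef n q * of_int (j + int q)) *\<^sub>C T (l, i + n - int q, j + int q - 1))" for q
      by (simp add: \<delta>_def t_def scaleC_add_right complex_vector.scale_right_diff_distrib)
    \<comment> \<open>The part of this coefficient produced by \<open>bcoef_absorb\<close> cancels
      against the second term of \<open>c2\<close>; only multiples of i and j remain.\<close>
    have c1: "bcoef n q * of_int (i + n - int q) = bcoef n q * of_int i - bcoef n (Suc q) * of_nat (Suc q)" for q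
    proof -
      have "bcoef n q * of_int (i + n - int q) = bcoef n q * of_int i + of_int (n - int q) * bcoef n q"
        by (simp add: algebra_simps)
      then show ?thesis by (simp only: bcoef_absorb) (simp add: algebra_simps)
    qed
    have c2: "bcoef n (Suc q) * of_int (j + int (Suc q))
        = bcoef n (Suc q) * of_int j + bcoef n (Suc q) * of_nat (Suc q)" for q
      by (simp add: distrib_left)
    have "ep n (\<delta> T) (l, i, j)
        = (\<Sum>q<Suc K. bcoef n q *\<^sub>C \<delta> T (l, i + n - int q, j + int q))"
    proof (rule ep_eq[where J = "J + 1"])
      show "\<delta> T (l, i, j) = 0" if "J + 1 \<le> j" for i j
        using J(2)[of j "i - 1"] J(2)[of "j - 1" i] that by (simp add: \<delta>_def)
    qed (use K in simp)
    also have "\<dots> = - ((\<Sum>q<Suc K. (bcoef n q * of_int (i + n - int q)) *\<^sub>C t q)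
        + (\<Sum>q<Suc K. (bcoef n q * of_int (j + int q)) *\<^sub>C T (l, i + n - int q, j + int q - 1)))"
      by (simp only: c0 sum_negf sum.distrib)
    also have "(\<Sum>q<Suc K. (bcoef n q * of_int (j + int q)) *\<^sub>C T (l, i + n - int q, j + int q - 1))
        = of_int j *\<^sub>C s + (\<Sum>q<K. (bcoef n (Suc q) * of_int (j + int (Suc q))) *\<^sub>C t q)"
      unfolding sum.lessThan_Suc_shift e by (simp add: s_def t_def bcoef_0)
    also have "\<dots> = of_int j *\<^sub>C s + ((\<Sum>q<K. (bcoef n (Suc q) * of_int j) *\<^sub>C t q)
        + (\<Sum>q<K. (bcoef n (Suc q) * of_nat (Suc q)) *\<^sub>C t q))"
      by (simp only: c2 scaleC_add_left sum.distrib)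
    finally have "ep n (\<delta> T) (l, i, j) = - ((\<Sum>q<Suc K. (bcoef n q * of_int (i + n - int q)) *\<^sub>C t q)
        + (of_int j *\<^sub>C s + ((\<Sum>q<K. (bcoef n (Suc q) * of_int j) *\<^sub>C t q)
        + (\<Sum>q<K. (bcoef n (Suc q) * of_nat (Suc q)) *\<^sub>C t q))))" .
    moreover have "(\<Sum>q<Suc K. (bcoef n q * of_int (i + n - int q)) *\<^sub>C t q)
        = (\<Sum>q<K. (bcoef n q * of_int i) *\<^sub>C t q) - (\<Sum>q<K. (bcoef n (Suc q) * of_nat (Suc q)) *\<^sub>C t q)"
      by (simp only: c1 complex_vector.scale_left_diff_distrib sum_subtractf sum.lessThan_Suc tK
          complex_vector.scale_zero_right add_0_right)
    moreover have "- ((a - d) + (x + (b + d))) = - (a + x + b)" for a b d x :: 'a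
      by simp
    ultimately have "ep n (\<delta> T) (l, i, j) = - ((\<Sum>q<K. (bcoef n q * of_int i) *\<^sub>C t q)
        + of_int j *\<^sub>C s + (\<Sum>q<K. (bcoef n (Suc q) * of_int j) *\<^sub>C t q))"
      by (simp only:)
    moreover have "ep n T (l, i - 1, j) = (\<Sum>q<K. bcoef n q *\<^sub>C t q)"
      unfolding J(1)[OF K(1)] e t_def ..
    moreover have "ep n T (l, i, j - 1) = s + (\<Sum>q<K. bcoef n (Suc q) *\<^sub>C t q)"
      unfolding J(1)[OF K(2)] sum.lessThan_Suc_shift e t_def by (simp add: s_def bcoef_0 scaleC_one)
    ultimately show "ep n (\<delta> T) p = \<delta> (ep n T) p"
      by (simp add: p \<delta>_def scaleC_add_right complex_vector.scale_sum_right mult.commute)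
  qed
  define T where "T = (\<lambda>(l::int, i, j). A i (B j c))"
  define S where "S = (\<lambda>(l::int, i, j). B i (A j c))"
  define T' where "T' = (\<lambda>(l::int, i, j). A i (B j (D c)))"
  define S' where "S' = (\<lambda>(l::int, i, j). B i (A j (D c)))"
  have z: "zbd T" "zbd S" "zbd T'" "zbd S'"
    unfolding T_def S_def T'_def S'_def by (rule zbd_comp[OF fields] zbd_comp[OF fields(2,1)])+
  have sw: "swap23 (\<lambda>(l, i, j). B j (A i c)) = (\<lambda>(l, i, j). B i (A j c))" for c
    by (auto simp: swap23_def)
  have P: "mprod A n B m c = ep n T (0, 0, m) - ((- 1) powi n) *\<^sub>C ep n S (0, m, 0)" for m
    unfolding mprod_def em_def sw T_def S_def by (simp add: swap23_def)
  have P': "mprod A n B m (D c) = ep n T' (0, 0, m) - ((- 1) powi n) *\<^sub>C ep n S' (0, m, 0)"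
    unfolding mprod_def em_def sw T'_def S'_def by (simp add: swap23_def)
  have DT: "(\<lambda>p. D (T p)) = (\<lambda>p. T' p - (\<lambda>p. - \<delta> T p) p)" "(\<lambda>p. D (S p)) = (\<lambda>p. S' p - (\<lambda>p. - \<delta> S p) p)"
    using cov unfolding covariant_def
    by (auto simp: T_def T'_def S_def S'_def \<delta>_def clinear_diff[OF A] clinear_diff[OF B]
        clinear_scale[OF A] clinear_scale[OF B])
  have zm: "zbd (\<lambda>p. - \<delta> T p)" "zbd (\<lambda>p. - \<delta> S p)"
    by (rule zbd_map[OF z\<delta>[OF z(1)]], simp) (rule zbd_map[OF z\<delta>[OF z(2)]], simp)
  have um: "clinear (uminus :: 'a \<Rightarrow> 'a)" by (rule clinearI) simp_all
  have "D (ep n T p) = ep n T' p + \<delta> (ep n T) p" for p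
    using ep_map[OF D z(1), of n p] unfolding DT ep_diff[OF z(3) zm(1)] ep_map[OF um z\<delta>[OF z(1)]]
    by (simp add: ep\<delta>[OF z(1)])
  moreover have "D (ep n S p) = ep n S' p + \<delta> (ep n S) p" for p
    using ep_map[OF D z(2), of n p] unfolding DT ep_diff[OF z(4) zm(2)] ep_map[OF um z\<delta>[OF z(2)]]
    by (simp add: ep\<delta>[OF z(2)])
  ultimately have "D (mprod A n B m c) = ep n T' (0, 0, m) + \<delta> (ep n T) (0, 0, m)
      - ((- 1) powi n) *\<^sub>C (ep n S' (0, m, 0) + \<delta> (ep n S) (0, m, 0))"
    unfolding P by (simp add: clinear_diff[OF D] clinear_scale[OF D])
  \<comment> \<open>At index 0 in x the x-derivative contributes nothing, since the residue of a
    derivative is zero; the z-derivative gives the asserted term.\<close>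
  then show "D (mprod A n B m c) = mprod A n B m (D c) - of_int m *\<^sub>C mprod A n B (m - 1) c"
    unfolding P P' by (simp add: \<delta>_def scaleC_add_right complex_vector.scale_right_diff_distrib mult.commute)
qed

subsection \<open>Uniqueness and skew-symmetry\<close>

text \<open>Index -1 is the constant term in w. As no negative powers of w occur, taking it amounts
  to setting w = 0, which turns (z - w)^N into z^N.\<close>

lemma dsh_pow_creative:
  assumes "\<And>i j. j \<ge> 0 \<Longrightarrow> P (i, j) = (0 :: 'v::complex_vector)"
  shows "(dsh (1, 0) (0, 1) ^^ N) P (i, - 1 :: int) = P (i + int N, - 1)"
  using assms
proof (induction N arbitrary: P i)
  case (Suc N)
  have "dsh (1, 0) (0, 1) P (i, j) = 0" if "j \<ge> 0" for i j
    using that Suc.prems by (simp add: dsh_apply)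
  then have "(dsh (1, 0) (0, 1) ^^ N) (dsh (1, 0) (0, 1) P) (i, - 1) = dsh (1, 0) (0, 1) P (i + int N, - 1)"
    by (rule Suc.IH)
  moreover have "(dsh (1, 0) (0, 1) ^^ Suc N) P = (dsh (1, 0) (0, 1) ^^ N) (dsh (1, 0) (0, 1) P)"
    by (simp only: funpow_Suc_right comp_apply)
  moreover have "dsh (1, 0) (0, 1) P (i + int N, - 1) = P (i + int (Suc N), - 1)"
    using Suc.prems[of 0] by (simp add: dsh_apply add_ac)
  ultimately show ?case by simp
qed simp

text \<open>Locality replaces (z - w)^N A(z) B(w) v by (z - w)^N B(w) A(z) v, which is zero. At w =
  0 the factor becomes z^N, a mere shift of indices.\<close>

lemma goddard_uniqueness:
  assumes "local N A B" "\<And>m. clinear (A m)" "\<And>m. clinear (B m)"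
    and "\<And>m. m \<ge> 0 \<Longrightarrow> B m v = 0" "\<And>m. A m v = 0"
  shows "A m (B (- 1) v) = 0"
proof -
  have "(dsh (1, 0) (0, 1) ^^ N) (\<lambda>(i, j). A i (B j v) - B j (A i v)) (m - int N, - 1) = 0"
    using assms(1) unfolding local_def by blast
  then show ?thesis
    using assms(4,5) by (subst (asm) dsh_pow_creative) (simp_all add: clinear_zero[OF assms(2)] clinear_zero[OF assms(3)])
qed

text \<open>The divided power D^k / k!, extended by zero to negative \<open>k\<close> so that index
  sets of sums can be enlarged freely.\<close>

definition dpow :: "('v::complex_vector \<Rightarrow> 'v) \<Rightarrow> int \<Rightarrow> 'v \<Rightarrow> 'v"
  where "dpow D k x = (if k \<ge> 0 then (1 / fact (nat k)) *\<^sub>C (D ^^ nat k) x else 0)"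

lemma dpow_Suc: "of_nat (Suc k) *\<^sub>C dpow D (int (Suc k)) x = D (dpow D (int k) x)" if "clinear D"
  by (simp add: dpow_def clinear_scale[OF that] field_simps del: of_nat_Suc)

text \<open>Since \<open>D v = 0\<close>, covariance makes the regular part of A(z) v a solution of
  df/dz = D f, hence exp(zD) applied to its constant term.\<close>

lemma covariant_vacuum:
  assumes D: "clinear D" "D v = 0" and A: "covariant D A" "\<And>m. clinear (A m)"
  shows "A (- 1 - int k) v = dpow D (int k) (A (- 1) v)"
proof (induction k)
  case 0
  show ?case by (simp add: dpow_def scaleC_one)
next
  case (Suc k)
  have "D (A (- 1 - int k) v) = of_nat (Suc k) *\<^sub>C A (- 1 - int (Suc k)) v"
    using A(1)[unfolded covariant_def, rule_format, of "- 1 - int k" v]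
    by (simp add: D(2) clinear_zero[OF A(2)] algebra_simps)
  then have "of_nat (Suc k) *\<^sub>C A (- 1 - int (Suc k)) v = of_nat (Suc k) *\<^sub>C dpow D (int (Suc k)) (A (- 1) v)"
    unfolding dpow_Suc[OF D(1)] Suc.IH by simp
  then show ?case by (simp del: of_nat_Suc)
qed

text \<open>The coefficients of B(w) exp(zD) = exp(zD) B(w - z), expanded in nonnegative powers of
  z.\<close>

lemma covariant_dpow:
  assumes D: "clinear D" and B: "covariant D B" "\<And>m. clinear (B m)"
  shows "B j (dpow D (int r) a) = (\<Sum>q\<le>r. (of_int j gchoose q) *\<^sub>C dpow D (int (r - q)) (B (j - int q) a))"
proof (induction r arbitrary: j)
  case 0
  show ?case by (simp add: dpow_def scaleC_one)
next
  case (Suc r)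
  let ?g = "\<lambda>j q. of_int j gchoose q :: complex"
  let ?t = "\<lambda>q. dpow D (int (Suc r - q)) (B (j - int q) a)"
  have sumD: "D (sum f A) = (\<Sum>x\<in>A. D (f x))" for f :: "nat \<Rightarrow> 'a" and A
    by (induction A rule: infinite_finite_induct) (simp_all add: clinear_zero[OF D] clinear_add[OF D])
  have "of_nat (Suc r) *\<^sub>C B j (dpow D (int (Suc r)) a) = B j (D (dpow D (int r) a))"
    by (simp only: dpow_Suc[OF D, symmetric] clinear_scale[OF B(2)])
  also have "\<dots> = D (B j (dpow D (int r) a)) + of_int j *\<^sub>C B (j - 1) (dpow D (int r) a)"
    using B(1) unfolding covariant_def by simp
  also have "D (B j (dpow D (int r) a)) = (\<Sum>q\<le>r. (?g j q * of_nat (Suc r - q)) *\<^sub>C ?t q)"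
    unfolding Suc.IH sumD
  proof (rule sum.cong[OF refl])
    fix q assume "q \<in> {..r}"
    then have "Suc r - q = Suc (r - q)" by auto
    then show "D (?g j q *\<^sub>C dpow D (int (r - q)) (B (j - int q) a)) = (?g j q * of_nat (Suc r - q)) *\<^sub>C ?t q"
      by (simp only: clinear_scale[OF D] dpow_Suc[OF D, symmetric] scaleC_scaleC)
  qed
  also have "\<dots> = (\<Sum>q\<le>Suc r. (?g j q * of_nat (Suc r - q)) *\<^sub>C ?t q)"
    by simp
  also have "of_int j *\<^sub>C B (j - 1) (dpow D (int r) a) = (\<Sum>q\<le>r. (?g j (Suc q) * of_nat (Suc q)) *\<^sub>C ?t (Suc q))"
    unfolding Suc.IH complex_vector.scale_sum_right
  proof (rule sum.cong[OF refl])
    fix q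
    have "of_int j * ?g (j - 1) q = ?g j (Suc q) * of_nat (Suc q)"
      using Suc_times_gbinomial[of q "of_int j - 1 :: complex"] by (simp add: mult.commute)
    moreover have "j - 1 - int q = j - int (Suc q)" by simp
    ultimately show "of_int j *\<^sub>C ?g (j - 1) q *\<^sub>C dpow D (int (r - q)) (B (j - 1 - int q) a)
        = (?g j (Suc q) * of_nat (Suc q)) *\<^sub>C ?t (Suc q)"
      by (simp only: scaleC_scaleC diff_Suc_Suc)
  qed
  also have "\<dots> = (\<Sum>q\<le>Suc r. (?g j q * of_nat q) *\<^sub>C ?t q)"
    by (subst sum.atMost_Suc_shift) simp
  \<comment> \<open>The contributions of the derivation and of the commutator carry the weights Suc
    r - q and q, whose sum \<open>Suc r\<close> can be cancelled.\<close>
  also have "(\<Sum>q\<le>Suc r. (?g j q * of_nat (Suc r - q)) *\<^sub>C ?t q) + (\<Sum>q\<le>Suc r. (?g j q * of_nat q) *\<^sub>C ?t q)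
      = (\<Sum>q\<le>Suc r. of_nat (Suc r) *\<^sub>C ?g j q *\<^sub>C ?t q)"
    unfolding sum.distrib[symmetric]
  proof (rule sum.cong[OF refl])
    fix q assume "q \<in> {..Suc r}"
    then have "of_nat (Suc r - q) + of_nat q = (of_nat (Suc r) :: complex)"
      by (simp flip: of_nat_add del: of_nat_Suc)
    then have "?g j q * of_nat (Suc r - q) + ?g j q * of_nat q = of_nat (Suc r) * ?g j q"
      by (simp only: distrib_left[symmetric]) (simp only: mult.commute)
    then show "(?g j q * of_nat (Suc r - q)) *\<^sub>C ?t q + (?g j q * of_nat q) *\<^sub>C ?t q
        = of_nat (Suc r) *\<^sub>C ?g j q *\<^sub>C ?t q"
      by (simp only: scaleC_add_left[symmetric] scaleC_scaleC)
  qed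
  finally have "of_nat (Suc r) *\<^sub>C B j (dpow D (int (Suc r)) a) = of_nat (Suc r) *\<^sub>C (\<Sum>q\<le>Suc r. ?g j q *\<^sub>C ?t q)"
    by (simp only: complex_vector.scale_sum_right)
  then show ?case by (simp only: complex_vector.scale_cancel_left of_nat_eq_0_iff nat.simps simp_thms)
qed

lemma gbinomial_minus_one: "(- 1 gchoose q) = ((- 1) ^ q :: complex)"
  using gbinomial_negated_upper[of "- 1 :: complex" q] by (simp add: binomial_gbinomial[symmetric])

lemma dpow_zero: "clinear D \<Longrightarrow> dpow D k 0 = 0"
proof -
  assume D: "clinear D"
  have "(D ^^ n) 0 = 0" for n by (induction n) (simp_all add: clinear_zero[OF D])
  then show ?thesis by (simp add: dpow_def)
qed

text \<open>With a and b the states created by A and B, locality and covariance give (z - w)^M A(z)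
  B(w) v = (z - w)^M exp(zD) B(w - z) a for large M. Setting w = 0 and dividing by z^M yields A(z) b
  = exp(zD) B(-z) a.\<close>

lemma skew_symmetry_modes:
  assumes loc: "local N A B" and A: "\<And>m. clinear (A m)" and B: "\<And>m. clinear (B m)"
    and D: "clinear D" "D v = 0" and cov: "covariant D A" "covariant D B"
    and creative: "\<And>m. m \<ge> 0 \<Longrightarrow> A m v = 0" "\<And>m. m \<ge> 0 \<Longrightarrow> B m v = 0"
    and J: "\<And>p. p \<ge> J \<Longrightarrow> B p (A (- 1) v) = 0"
  shows "A m (B (- 1) v) = (\<Sum>p\<in>{m..<J}. ((- 1) powi (p + 1)) *\<^sub>C dpow D (p - m) (B p (A (- 1) v)))"
proof -
  define a where "a = A (- 1) v"
  let ?g = "\<lambda>j q. of_int j gchoose q :: complex"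
  \<comment> \<open>The modes of (w - z)^r exp(zD) B(w - z) a. Multiplication by z - w raises r and
    changes the sign, which is \<open>dQ\<close>.\<close>
  define Q where "Q r = (\<lambda>(i, j). \<Sum>q<nat (- i). ?g j q *\<^sub>C dpow D (- 1 - i - int q) (B (j + int r - int q) a))" for r
  have Q: "Q r (i, j) = (\<Sum>q<K. ?g j q *\<^sub>C dpow D (- 1 - i - int q) (B (j + int r - int q) a))"
    if "nat (- i) \<le> K" for r i j K
    unfolding Q_def prod.case using that by (intro sum.mono_neutral_left) (auto simp: dpow_def)
  have Q0: "Q 0 (i, j) = B j (A i v)" for i j
  proof (cases "i \<ge> 0")
    case True
    then show ?thesis by (simp add: Q_def creative clinear_zero[OF B])
  next
    case False
    define k where "k = nat (- 1 - i)"
    have k: "i = - 1 - int k" "nat (- i) = Suc k" using False by (auto simp: k_def)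
    have "B j (A i v) = (\<Sum>q\<le>k. ?g j q *\<^sub>C dpow D (int (k - q)) (B (j - int q) a))"
      unfolding k(1) covariant_vacuum[OF D cov(1) A] a_def[symmetric]
      by (rule covariant_dpow[OF D(1) cov(2) B])
    also have "\<dots> = Q 0 (i, j)"
      unfolding Q_def prod.case k(2) lessThan_Suc_atMost
      by (intro sum.cong refl) (auto simp: k(1) of_nat_diff)
    finally show ?thesis by simp
  qed
  have dQ: "dsh (1, 0) (0, 1) (Q r) = (\<lambda>p. (- 1) *\<^sub>C Q (Suc r) p)" for r
  proof
    fix p :: "int \<times> int"
    obtain i j where p: "p = (i, j)" by (cases p)
    define K where "K = nat (- i)"
    define t where "t q = dpow D (- 1 - (i + 1) - int q) (B (j + int r - int q) a)" for q
    define s where "s = dpow D (- 1 - i) (B (j + 1 + int r) a)"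
    have e: "- 1 - i - int (Suc q) = - 1 - (i + 1) - int q" "j + 1 + int r - int (Suc q) = j + int r - int q"
      "j + int (Suc r) - int (Suc q) = j + int r - int q" for q by simp_all
    have le: "nat (- (i + 1)) \<le> K" "nat (- i) \<le> Suc K" by (simp_all add: K_def)
    have "Q r (i + 1, j) = (\<Sum>q<K. ?g j q *\<^sub>C t q)"
      unfolding Q[OF le(1)] t_def ..
    moreover have "Q r (i, j + 1) = s + (\<Sum>q<K. ?g (j + 1) (Suc q) *\<^sub>C t q)"
      unfolding Q[OF le(2)] sum.lessThan_Suc_shift e t_def by (simp add: s_def scaleC_one)
    moreover have "Q (Suc r) (i, j) = s + (\<Sum>q<K. ?g j (Suc q) *\<^sub>C t q)"
      unfolding Q[OF le(2)] sum.lessThan_Suc_shift e t_def by (simp add: s_def scaleC_one add_ac)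
    moreover have "?g (j + 1) (Suc q) = ?g j q + ?g j (Suc q)" for q
      using gbinomial_Suc_Suc[of "of_int j :: complex" q] by simp
    ultimately show "dsh (1, 0) (0, 1) (Q r) p = (- 1) *\<^sub>C Q (Suc r) p"
      by (simp add: p dsh_apply scaleC_add_left sum.distrib)
  qed
  have dQN: "(dsh (1, 0) (0, 1) ^^ N) (Q 0) = (\<lambda>p. (- 1) ^ N *\<^sub>C Q N p)" for N
  proof (induction N)
    case (Suc N)
    have "dsh (1, 0) (0, 1) (\<lambda>p. c *\<^sub>C T p) = (\<lambda>p. c *\<^sub>C dsh (1, 0) (0, 1) T p)" for c and T :: "int \<times> int \<Rightarrow> 'a"
      by (simp add: dsh_def fun_eq_iff complex_vector.scale_right_diff_distrib)
    then show ?case by (simp add: Suc.IH dQ)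
  qed (simp add: scaleC_one)
  \<comment> \<open>\<open>M\<close> is at least N for locality to apply, and at least J so that
    every nonzero term of B(w - z) a becomes polynomial in w - z and contributes at w = 0.\<close>
  define M where "M = max N (nat J)"
  define i where "i = m - int M"
  have "local M A B" using local_mono[OF loc] by (simp add: M_def)
  then have "(dsh (1, 0) (0, 1) ^^ M) (\<lambda>(i, j). A i (B j v) - B j (A i v)) (i, - 1) = 0"
    unfolding local_def by blast
  moreover have "(\<lambda>(i, j). A i (B j v) - B j (A i v)) = (\<lambda>p. (\<lambda>(i, j). A i (B j v)) p - Q 0 p)"
    by (auto simp: Q0)
  ultimately have "(dsh (1, 0) (0, 1) ^^ M) (\<lambda>(i, j). A i (B j v)) (i, - 1) = (- 1) ^ M *\<^sub>C Q M (i, - 1)"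
    by (simp add: dsh_pow_diff dQN)
  moreover have "(dsh (1, 0) (0, 1) ^^ M) (\<lambda>(i, j). A i (B j v)) (i, - 1) = A m (B (- 1) v)"
    by (subst dsh_pow_creative) (simp_all add: creative clinear_zero[OF A] i_def)
  ultimately have "A m (B (- 1) v) = (- 1) ^ M *\<^sub>C Q M (i, - 1)" by simp
  \<comment> \<open>At index -1 in w the binomial coefficients are those of -1, that is,
    signs.\<close>
  also have "\<dots> = (\<Sum>q<nat (int M - m). ((- 1) ^ (M + q)) *\<^sub>C dpow D (int M - 1 - int q - m) (B (int M - 1 - int q) a))"
    unfolding Q_def prod.case complex_vector.scale_sum_right
    by (intro sum.cong) (simp_all add: i_def gbinomial_minus_one power_add algebra_simps)
  also have "\<dots> = (\<Sum>p\<in>{m..<int M}. ((- 1) powi (p + 1)) *\<^sub>C dpow D (p - m) (B p a))"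
  proof (rule sum.reindex_bij_witness[where i = "\<lambda>p. nat (int M - 1 - p)" and j = "\<lambda>q. int M - 1 - int q"])
    fix q assume "q \<in> {..<nat (int M - m)}"
    have "(- 1 :: complex) powi (int M - 1 - int q + 1) = (- 1) ^ (M + q)"
      by (cases "even q") (simp_all add: power_int_diff power_add)
    then show "((- 1) powi (int M - 1 - int q + 1)) *\<^sub>C dpow D (int M - 1 - int q - m) (B (int M - 1 - int q) a)
        = ((- 1) ^ (M + q)) *\<^sub>C dpow D (int M - 1 - int q - m) (B (int M - 1 - int q) a)" by simp
  qed auto
  also have "\<dots> = (\<Sum>p\<in>{m..<J}. ((- 1) powi (p + 1)) *\<^sub>C dpow D (p - m) (B p a))"
  proof (rule sum.mono_neutral_right)
    show "\<forall>p\<in>{m..<int M} - {m..<J}. ((- 1) powi (p + 1)) *\<^sub>C dpow D (p - m) (B p a) = 0"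
      using J unfolding a_def by (auto simp: dpow_zero[OF D(1)])
  qed (auto simp: M_def)
  finally show ?thesis by (simp add: a_def)
qed

section \<open>The vacuum module\<close>

subsection \<open>Universal property\<close>

definition word_act :: "('l \<Rightarrow> 'e \<Rightarrow> 'e) \<Rightarrow> 'l word \<Rightarrow> 'e \<Rightarrow> 'e"
  where "word_act \<rho> w e = (case w of Word xs \<Rightarrow> foldr \<rho> xs e)"

definition free_act :: "('l \<Rightarrow> 'e \<Rightarrow> 'e::complex_vector) \<Rightarrow> 'l free_algebra \<Rightarrow> 'e \<Rightarrow> 'e"
  where "free_act \<rho> p e = lin_ext (\<lambda>w. word_act \<rho> w e) p"

lemma word_act_add: "word_act \<rho> (v + w) e = word_act \<rho> v (word_act \<rho> w e)"
  by (cases v; cases w) (simp add: word_act_def)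

lemma lin_ext_scale_fun: "lin_ext (\<lambda>k. c *\<^sub>C f k) p = c *\<^sub>C lin_ext f p"
  by (simp add: lin_ext_def complex_vector.scale_sum_right mult.commute)

lemma lin_ext_add_fun: "lin_ext (\<lambda>k. f k + g k) p = lin_ext f p + lin_ext g p"
  by (simp add: lin_ext_def scaleC_add_right sum.distrib)

locale lie_module =
  fixes \<rho> :: "'l::complex_lie_algebra \<Rightarrow> 'e::complex_vector \<Rightarrow> 'e"
  assumes act_linear: "clinear (\<rho> x)"
    and act_linear_left: "clinear (\<lambda>x. \<rho> x e)"
    and act_bracket: "\<rho> (lie_bracket x y) e = \<rho> x (\<rho> y e) - \<rho> y (\<rho> x e)"
begin

lemma clinear_word_act: "clinear (word_act \<rho> w)"
proof -
  obtain xs where w: "w = Word xs" by (cases w)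
  have "clinear (foldr \<rho> xs)"
  proof (induction xs)
    case (Cons x xs)
    show ?case
      by (rule clinearI) (simp_all add: clinear_add[OF Cons.IH] clinear_scale[OF Cons.IH]
          clinear_add[OF act_linear] clinear_scale[OF act_linear])
  qed (simp add: clinearI)
  then show ?thesis by (simp add: w word_act_def[abs_def])
qed

lemma clinear_free_act: "clinear (\<lambda>p. free_act \<rho> p e)" "clinear (free_act \<rho> p)"
proof -
  show "clinear (\<lambda>p. free_act \<rho> p e)" unfolding free_act_def by (rule clinear_lin_ext)
  show "clinear (free_act \<rho> p)"
    by (rule clinearI) (simp_all add: free_act_def clinear_add[OF clinear_word_act]
        clinear_scale[OF clinear_word_act] lin_ext_add_fun lin_ext_scale_fun)
qed

lemma free_act_single: "free_act \<rho> (Poly_Mapping.single w c) e = c *\<^sub>C word_act \<rho> w e"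
  by (simp add: free_act_def lin_ext_single)

lemma free_act_mult: "free_act \<rho> (p * q) e = free_act \<rho> p (free_act \<rho> q e)"
proof (induction p rule: free_induct)
  case zero
  then show ?case by (simp add: clinear_zero[OF clinear_free_act(1)])
next
  case (single v c)
  show ?case
  proof (induction q rule: free_induct)
    case zero
    then show ?case by (simp add: clinear_zero[OF clinear_free_act(1)] clinear_zero[OF clinear_free_act(2)])
  next
    case (single w d)
    show ?case
      by (simp add: mult_single free_act_single word_act_add clinear_scale[OF clinear_word_act])
  next
    case (add p q)
    then show ?case
      by (simp add: distrib_left clinear_add[OF clinear_free_act(1)] clinear_add[OF clinear_free_act(2)])
  qed
next
  case (add p q)
  then show ?case by (simp add: distrib_right clinear_add[OF clinear_free_act(1)])
qed

lemma free_act_gen: "free_act \<rho> (free_gen x) e = \<rho> x e"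
  by (simp add: free_gen_def free_act_single word_act_def scaleC_one)

lemma free_act_ideal:
  assumes "p \<in> cspan uea_ideal_gens"
  shows "free_act \<rho> p e = 0"
proof (rule clinear_vanishes_on_span[OF clinear_free_act(1) _ assms])
  fix p assume "p \<in> (uea_ideal_gens :: 'l free_algebra set)"
  then obtain a r b where p: "p = a * r * b" "r \<in> uea_rels"
    unfolding uea_ideal_gens_def by blast
  have "free_act \<rho> r e = 0" for e
    using p(2) by (auto simp: uea_rels_def clinear_diff[OF clinear_free_act(1)]
        clinear_scale[OF clinear_free_act(1)] free_act_gen free_act_mult clinear_add[OF act_linear_left]
        clinear_scale[OF act_linear_left] act_bracket)
  then show "free_act \<rho> p e = 0"
    by (simp add: p free_act_mult clinear_zero[OF clinear_free_act(2)])
qed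

definition uact :: "'l uea \<Rightarrow> 'e \<Rightarrow> 'e"
  where "uact u = free_act \<rho> (rep_uea u)"

lemma uact_abs: "uact (abs_uea p) e = free_act \<rho> p e"
proof -
  have "rep_uea (abs_uea p) - p \<in> cspan uea_ideal_gens"
    by (rule Quotient3_rep_abs[OF Quotient3_uea]) (simp add: complex_vector.span_zero)
  from free_act_ideal[OF this] show ?thesis
    by (simp add: uact_def clinear_diff[OF clinear_free_act(1)])
qed

lemma uact_simps:
  "uact (u + u') e = uact u e + uact u' e" "uact (c *\<^sub>C u) e = c *\<^sub>C uact u e"
  "uact (u * u') e = uact u (uact u' e)" "uact 1 e = e" "uact (uea_gen x) e = \<rho> x e"
proof -
  have *: "\<exists>p. u = abs_uea p" for u :: "'l uea" by (induct u rule: uea.abs_induct) blast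
  obtain p p' where p: "u = abs_uea p" "u' = abs_uea p'" using * by blast
  show "uact (u + u') e = uact u e + uact u' e" "uact (c *\<^sub>C u) e = c *\<^sub>C uact u e"
    "uact (u * u') e = uact u (uact u' e)"
    by (simp_all add: p plus_uea.abs_eq scaleC_uea.abs_eq times_uea.abs_eq uact_abs free_act_mult
        clinear_add[OF clinear_free_act(1)] clinear_scale[OF clinear_free_act(1)])
  have one: "(1 :: 'l free_algebra) = Poly_Mapping.single (Word []) 1"
    by (simp add: zero_word_def[symmetric])
  show "uact 1 e = e"
    unfolding one_uea.abs_eq uact_abs one free_act_single by (simp add: word_act_def scaleC_one)
  show "uact (uea_gen x) e = \<rho> x e"
    by (simp add: uea_gen.abs_eq uact_abs free_act_gen)
qed

lemma clinear_uact: "clinear (uact u)" "clinear (\<lambda>u. uact u e)"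
  using clinear_free_act(2) by (simp_all add: uact_def[abs_def] clinearI uact_simps[unfolded uact_def])

end

lemma uea_induct [case_names one gen add scale]:
  fixes u :: "'l::complex_lie_algebra uea"
  assumes "P 1" "\<And>x u. P u \<Longrightarrow> P (uea_gen x * u)" "\<And>u v. P u \<Longrightarrow> P v \<Longrightarrow> P (u + v)"
    "\<And>c u. P u \<Longrightarrow> P (c *\<^sub>C u)"
  shows "P u"
proof -
  have word: "P (abs_uea (Poly_Mapping.single (Word xs) 1))" for xs :: "'l list"
  proof (induction xs)
    case Nil
    then show ?case using assms(1) by (simp add: one_uea.abs_eq zero_word_def[symmetric])
  next
    case (Cons x xs)
    have "uea_gen x * abs_uea (Poly_Mapping.single (Word xs) 1) = abs_uea (Poly_Mapping.single (Word (x # xs)) 1)"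
      by (simp add: uea_gen.abs_eq times_uea.abs_eq free_gen_def mult_single)
    then show ?case using assms(2)[OF Cons.IH, of x] by simp
  qed
  have single: "P (abs_uea (Poly_Mapping.single w c))" for w :: "'l word" and c
  proof -
    obtain xs where w: "w = Word xs" by (cases w)
    have "abs_uea (Poly_Mapping.single w c) = c *\<^sub>C abs_uea (Poly_Mapping.single (Word xs) 1)"
      by (simp add: w scaleC_uea.abs_eq scaleC_single scaleC_complex_def)
    then show ?thesis using assms(4)[OF word] by simp
  qed
  have "P (abs_uea p)" for p
  proof (induction p rule: free_induct)
    case zero
    show ?case using assms(4)[OF assms(1), of 0] by (simp add: zero_uea_def)
  qed (use single assms(3) in \<open>simp_all flip: plus_uea.abs_eq\<close>)
  then show ?thesis by (induct u rule: uea.abs_induct) blast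
qed

text \<open>Through \<open>f\<close> the target algebra is a module under left multiplication, and
  \<open>uea_lift f u\<close> is the action of \<open>u\<close> on 1. All four rules are thus
  instances of the module action already constructed.\<close>

lemma uea_lift_abs:
  fixes f :: "'l::complex_lie_algebra \<Rightarrow> 'a::complex_algebra_1"
  assumes "clinear f" "\<And>x y. f (lie_bracket x y) = f x * f y - f y * f x"
  shows "uea_lift f (u + v) = uea_lift f u + uea_lift f v"
    "uea_lift f (c *\<^sub>C u) = c *\<^sub>C uea_lift f u"
    "uea_lift f (uea_gen x * u) = f x * uea_lift f u" "uea_lift f 1 = 1"
proof -
  interpret lie_module "\<lambda>x e. f x * e"
    by unfold_locales (auto intro!: clinearI simp: clinear_add[OF assms(1)] clinear_scale[OF assms(1)]
        assms(2) algebra_simps mult_scaleC_left mult_scaleC_right)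
  have "foldr (\<lambda>x e. f x * e) xs 1 = prod_list (map f xs)" for xs
    by (induction xs) simp_all
  then have "(\<lambda>w. word_act (\<lambda>x e. f x * e) w 1) = (\<lambda>w. case w of Word xs \<Rightarrow> prod_list (map f xs))"
    by (auto simp: word_act_def fun_eq_iff split: word.split)
  then have "uea_lift f u = uact u 1" for u
    by (simp add: uea_lift_def uact_def free_act_def)
  then show "uea_lift f (u + v) = uea_lift f u + uea_lift f v"
    "uea_lift f (c *\<^sub>C u) = c *\<^sub>C uea_lift f u"
    "uea_lift f (uea_gen x * u) = f x * uea_lift f u" "uea_lift f 1 = 1"
    by (simp_all add: uact_simps)
qed

lemma Rep_loop_ann_hom:
  "Rep_loop_ann (x + y) = Rep_loop_ann x + Rep_loop_ann y"
  "Rep_loop_ann (c *\<^sub>C x) = c *\<^sub>C Rep_loop_ann x"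
  "Rep_loop_ann (lie_bracket x y) = lie_bracket (Rep_loop_ann x) (Rep_loop_ann y)"
  by (simp_all add: plus_loop_ann.rep_eq scaleC_loop_ann.rep_eq lie_bracket_loop_ann.rep_eq)

lemma uea_gen_hom:
  "uea_gen (x + y) = uea_gen x + uea_gen y" "uea_gen (c *\<^sub>C x) = c *\<^sub>C uea_gen x"
  "uea_gen (lie_bracket x y) = uea_gen x * uea_gen y - uea_gen y * uea_gen x"
proof -
  have *: "r \<in> cspan uea_ideal_gens" if "r \<in> uea_rels" for r :: "'a free_algebra"
    using that unfolding uea_ideal_gens_def
    by (intro complex_vector.span_base CollectI exI[of _ 1] exI[of _ r]) simp
  have "free_gen (x + y) - free_gen x - free_gen y \<in> cspan uea_ideal_gens"
    "free_gen (c *\<^sub>C x) - c *\<^sub>C free_gen x \<in> cspan uea_ideal_gens"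
    "free_gen x * free_gen y - free_gen y * free_gen x - free_gen (lie_bracket x y) \<in> cspan uea_ideal_gens"
    by (rule *; force simp: uea_rels_def)+
  note r = this complex_vector.span_neg[OF this(3)]
  show "uea_gen (x + y) = uea_gen x + uea_gen y" "uea_gen (c *\<^sub>C x) = c *\<^sub>C uea_gen x"
    "uea_gen (lie_bracket x y) = uea_gen x * uea_gen y - uea_gen y * uea_gen x"
    unfolding uea_gen.abs_eq plus_uea.abs_eq scaleC_uea.abs_eq times_uea.abs_eq minus_uea.abs_eq
      uea.abs_eq_iff using r by (simp_all add: algebra_simps)
qed

lemma ann_incl_simps:
  "ann_incl (u + v) = ann_incl u + ann_incl v" "ann_incl (c *\<^sub>C u) = c *\<^sub>C ann_incl u"
  "ann_incl (uea_gen x * u) = uea_gen (Rep_loop_ann x) * ann_incl u" "ann_incl 1 = 1"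
proof -
  have f: "clinear (\<lambda>x. uea_gen (Rep_loop_ann x))"
    by (rule clinearI) (simp_all only: Rep_loop_ann_hom uea_gen_hom)
  show "ann_incl (u + v) = ann_incl u + ann_incl v" "ann_incl (c *\<^sub>C u) = c *\<^sub>C ann_incl u"
    "ann_incl (uea_gen x * u) = uea_gen (Rep_loop_ann x) * ann_incl u" "ann_incl 1 = 1"
    unfolding ann_incl_def
    by (rule uea_lift_abs[OF f]; simp only: Rep_loop_ann_hom uea_gen_hom)+
qed

lemma clinear_const_0: "clinear (\<lambda>_. 0)"
  by (rule clinearI) simp_all

lemma ann_trivial_simps:
  "ann_trivial (u + v) = ann_trivial u + ann_trivial v" "ann_trivial (c *\<^sub>C u) = c *\<^sub>C ann_trivial u"
  "ann_trivial (uea_gen x * u) = 0" "ann_trivial 1 = 1"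
proof -
  have f: "(0 :: complex) = 0 * 0 - 0 * 0" by simp
  show "ann_trivial (u + v) = ann_trivial u + ann_trivial v" "ann_trivial (c *\<^sub>C u) = c *\<^sub>C ann_trivial u"
    "ann_trivial (uea_gen x * u) = 0" "ann_trivial 1 = 1"
    unfolding ann_trivial_def by (simp_all only: uea_lift_abs[OF clinear_const_0 f] mult_zero_left)
qed

subsection \<open>Currents\<close>

lemma induced_tensor_simps:
  "induced_tensor (u + u') z = induced_tensor u z + induced_tensor u' z"
  "induced_tensor (c *\<^sub>C u) z = c *\<^sub>C induced_tensor u z"
  "induced_tensor u (z + z') = induced_tensor u z + induced_tensor u z'"
  "induced_tensor u (c * z) = c *\<^sub>C induced_tensor u z"
  by (simp_all add: induced_tensor_def tensor_bilinear(1,2,3) plus_vacuum_module.abs_eq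
      scaleC_vacuum_module.abs_eq tensor_bilinear(4)[where y = "y :: complex" for y, unfolded scaleC_complex_def])

lemma induced_tensor_balanced: "induced_tensor (u * ann_incl a) z = induced_tensor u (ann_trivial a * z)"
  unfolding induced_tensor_def vacuum_module.abs_eq_iff balancing_rels_def
  by (rule complex_vector.span_base) blast

lemma vacuum_module_induct [case_names tensor add]:
  assumes "\<And>u z. P (induced_tensor u z)" "\<And>v w. P v \<Longrightarrow> P w \<Longrightarrow> P (v + w)"
  shows "P v"
proof -
  have "P (abs_vacuum_module t)" for t
    by (induct t) (use assms in \<open>simp_all add: induced_tensor_def flip: plus_vacuum_module.abs_eq\<close>)
  then show ?thesis by (induct v rule: vacuum_module.abs_induct) blast
qed

lemma clinear_uea_act: "clinear (uea_act u)"
proof -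
  let ?f = "\<lambda>x z. (u * x) \<otimes>\<^sub>C (z :: complex)"
  have b: "cbilinear ?f"
    by (intro cbilinearI) (simp_all add: tensor_bilinear algebra_simps mult_scaleC_right)
  have pres: "tensor_lift ?f s \<in> cspan balancing_rels" if "s \<in> cspan balancing_rels" for s
  proof (rule clinear_preserves_span[OF clinear_tensor_lift[OF b] _ that])
    fix r :: "('a loop uea, complex) tensor" assume "r \<in> balancing_rels"
    then obtain v a z where "r = (v * ann_incl a) \<otimes>\<^sub>C z - v \<otimes>\<^sub>C (ann_trivial a * z)"
      unfolding balancing_rels_def by blast
    then have "tensor_lift ?f r = (u * v * ann_incl a) \<otimes>\<^sub>C z - (u * v) \<otimes>\<^sub>C (ann_trivial a * z)"
      by (simp add: clinear_diff[OF clinear_tensor_lift[OF b]] tensor_lift_tensor[OF b] mult.assoc)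
    then show "tensor_lift ?f r \<in> cspan balancing_rels"
      unfolding balancing_rels_def by (intro complex_vector.span_base) blast
  qed
  have *: "uea_act u (abs_vacuum_module t) = abs_vacuum_module (tensor_lift ?f t)" for t
  proof -
    have "rep_vacuum_module (abs_vacuum_module t) - t \<in> cspan balancing_rels"
      by (rule Quotient3_rep_abs[OF Quotient3_vacuum_module]) (simp add: complex_vector.span_zero)
    from pres[OF this] show ?thesis
      by (simp add: uea_act_def vacuum_module.abs_eq_iff clinear_diff[OF clinear_tensor_lift[OF b]])
  qed
  have ex: "\<exists>t. v = abs_vacuum_module t" for v :: "'a vacuum_module"
    by (induct v rule: vacuum_module.abs_induct) blast
  show ?thesis
  proof (rule clinearI)
    fix v w :: "'a vacuum_module" and c
    obtain s t where v: "v = abs_vacuum_module s" "w = abs_vacuum_module t" using ex by blast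
    show "uea_act u (v + w) = uea_act u v + uea_act u w" "uea_act u (c *\<^sub>C v) = c *\<^sub>C uea_act u v"
      by (simp_all add: v * plus_vacuum_module.abs_eq scaleC_vacuum_module.abs_eq
          clinear_add[OF clinear_tensor_lift[OF b]] clinear_scale[OF clinear_tensor_lift[OF b]])
  qed
qed

lemma uea_act_simps:
  "uea_act (u + u') v = uea_act u v + uea_act u' v" "uea_act (u - u') v = uea_act u v - uea_act u' v"
  "uea_act (c *\<^sub>C u) v = c *\<^sub>C uea_act u v" "uea_act (u * u') v = uea_act u (uea_act u' v)"
proof -
  show add: "uea_act (u + u') v = uea_act u v + uea_act u' v" for u u'
    by (induction v rule: vacuum_module_induct)
       (simp_all add: uea_act_induced_tensor distrib_right induced_tensor_simps clinear_add[OF clinear_uea_act])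
  show scale: "uea_act (c *\<^sub>C u) v = c *\<^sub>C uea_act u v" for c u
    by (induction v rule: vacuum_module_induct)
       (simp_all add: uea_act_induced_tensor mult_scaleC_left induced_tensor_simps
         clinear_add[OF clinear_uea_act] scaleC_add_right)
  show "uea_act (u - u') v = uea_act u v - uea_act u' v"
    using add[of "u - u'" u'] by simp
  show "uea_act (u * u') v = uea_act u (uea_act u' v)"
    by (induction v rule: vacuum_module_induct)
       (simp_all add: uea_act_induced_tensor mult.assoc clinear_add[OF clinear_uea_act])
qed

lemma clinear_current: "clinear (current X F)"
  unfolding current_def by (rule clinear_uea_act)

lemma current_simps:
  "current (X + Y) F v = current X F v + current Y F v"
  "current (c *\<^sub>C X) F v = c *\<^sub>C current X F v"
  "current X (F + G) v = current X F v + current X G v"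
  "current X (c *\<^sub>C F) v = c *\<^sub>C current X F v"
  by (simp_all add: current_def tensor_bilinear uea_gen_hom uea_act_simps)

lemma current_bracket:
  "current (lie_bracket X Y) (F * G) v = current X F (current Y G v) - current Y G (current X F v)"
  by (simp add: current_def uea_gen_hom uea_act_simps flip: lie_tensor)

text \<open>Balancing moves the polynomial current across the tensor sign, where it acts on the
  trivial module.\<close>

lemma current_vacuum: "current X (of_poly p) vacuum_vector = 0"
proof -
  have "X \<otimes>\<^sub>C of_poly p \<in> cspan {X \<otimes>\<^sub>C of_poly p | X p. True}"
    by (rule complex_vector.span_base) blast
  then have x: "Rep_loop_ann (Abs_loop_ann (X \<otimes>\<^sub>C of_poly p)) = X \<otimes>\<^sub>C of_poly p"
    by (rule Abs_loop_ann_inverse)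
  define x where "x = Abs_loop_ann (X \<otimes>\<^sub>C of_poly p)"
  have "current X (of_poly p) vacuum_vector = induced_tensor (1 * ann_incl (uea_gen x * 1)) 1"
    unfolding ann_incl_simps by (simp add: current_def vacuum_vector_def uea_act_induced_tensor x x_def)
  also have "\<dots> = 0 *\<^sub>C induced_tensor 1 1"
    unfolding induced_tensor_balanced ann_trivial_simps by (subst induced_tensor_simps(4)[symmetric]) simp
  finally show ?thesis by simp
qed

lemma vacuum_induct [case_names vac current add scale]:
  fixes v :: "'g::complex_lie_algebra vacuum_module"
  assumes "P vacuum_vector" "\<And>X F v. P v \<Longrightarrow> P (current X F v)"
    "\<And>v w. P v \<Longrightarrow> P w \<Longrightarrow> P (v + w)" "\<And>c v. P v \<Longrightarrow> P (c *\<^sub>C v)"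
  shows "P v"
proof (induction v rule: vacuum_module_induct)
  case (tensor u z)
  have "P (induced_tensor u 1)"
  proof (induction u rule: uea_induct)
    case one
    show ?case using assms(1) by (simp add: vacuum_vector_def)
  next
    case (gen x u)
    show ?case
    proof (induct x)
      case (tensor X F)
      then show ?case using assms(2)[OF gen, of X F] by (simp add: current_def uea_act_induced_tensor)
    next
      case (add s t)
      then show ?case using assms(3) by (simp add: uea_gen_hom distrib_right induced_tensor_simps)
    qed
  qed (simp_all add: induced_tensor_simps assms)
  then show ?case using assms(4) induced_tensor_simps(4)[of u z 1] by simp
qed (rule assms(3))

text \<open>Frobenius reciprocity for the induced module. It is applied to twisted actions, so that
  the resulting maps need not commute with the currents.\<close>

theorem vacuum_universal:
  fixes c :: "'g::complex_lie_algebra \<Rightarrow> kfun \<Rightarrow> 'e::complex_vector \<Rightarrow> 'e"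
  assumes lin: "\<And>X F. clinear (c X F)" "\<And>F e. clinear (\<lambda>X. c X F e)" "\<And>X e. clinear (\<lambda>F. c X F e)"
    and bracket: "\<And>X Y F G e. c (lie_bracket X Y) (F * G) e = c X F (c Y G e) - c Y G (c X F e)"
    and vac: "\<And>X p. c X (of_poly p) e0 = 0"
  obtains \<Psi> where "clinear \<Psi>" "\<Psi> vacuum_vector = e0" "\<And>X F v. \<Psi> (current X F v) = c X F (\<Psi> v)"
proof -
  define \<rho> where "\<rho> t e = tensor_lift (\<lambda>X F. c X F e) t" for t e
  have b: "cbilinear (\<lambda>X F. c X F e)" for e
    using lin unfolding cbilinear_def by blast
  have \<rho>_tensor: "\<rho> (X \<otimes>\<^sub>C F) e = c X F e" for X F e
    by (simp add: \<rho>_def tensor_lift_tensor[OF b])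
  have \<rho>_left: "clinear (\<lambda>t. \<rho> t e)" for e
    unfolding \<rho>_def by (rule clinear_tensor_lift[OF b])
  have \<rho>: "clinear (\<rho> t)" for t
    by (rule clinearI) (simp_all add: \<rho>_def clinear_add[OF lin(1)] clinear_scale[OF lin(1)]
        tensor_lift_fun_add tensor_lift_fun_scale)
  interpret lie_module \<rho>
  proof (rule lie_module.intro)
    fix s t :: "'g loop" and e
    show "\<rho> (lie_bracket s t) e = \<rho> s (\<rho> t e) - \<rho> t (\<rho> s e)"
    proof (induct s)
      case (tensor X F)
      show ?case
      proof (induct t)
        case (tensor Y G)
        show ?case by (simp add: lie_tensor \<rho>_tensor bracket)
      qed (simp add: lie_add_right clinear_add[OF \<rho>_left] clinear_add[OF \<rho>])
    qed (simp add: lie_add_left clinear_add[OF \<rho>_left] clinear_add[OF \<rho>])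
  qed (rule \<rho> \<rho>_left)+
  \<comment> \<open>The polynomial currents kill \<open>e0\<close>, so the subalgebra acts on it
    through the trivial character; this is what the balancing relations require of the
    target.\<close>
  have ann: "uact (ann_incl a) e0 = ann_trivial a *\<^sub>C e0" for a
  proof (induction a rule: uea_induct)
    case (gen x u)
    have "\<rho> (Rep_loop_ann x) e0 = 0"
      by (rule clinear_vanishes_on_span[OF \<rho>_left _ Rep_loop_ann]) (auto simp: \<rho>_tensor vac)
    then show ?case
      by (simp add: ann_incl_simps ann_trivial_simps uact_simps gen clinear_scale[OF \<rho>])
  qed (simp_all add: ann_incl_simps ann_trivial_simps uact_simps scaleC_one scaleC_add_left
      scaleC_complex_def)
  let ?f = "\<lambda>u z. z *\<^sub>C uact u e0"
  have f: "cbilinear ?f"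
    by (intro cbilinearI)
       (simp_all add: uact_simps scaleC_add_right scaleC_add_left scaleC_complex_def mult.commute)
  define \<Psi> where "\<Psi> v = tensor_lift ?f (rep_vacuum_module v)" for v
  have bal: "tensor_lift ?f t = 0" if "t \<in> cspan balancing_rels" for t
  proof (rule clinear_vanishes_on_span[OF clinear_tensor_lift[OF f] _ that])
    fix r :: "('g loop uea, complex) tensor" assume "r \<in> balancing_rels"
    then obtain v a z where "r = (v * ann_incl a) \<otimes>\<^sub>C z - v \<otimes>\<^sub>C (ann_trivial a * z)"
      unfolding balancing_rels_def by blast
    then show "tensor_lift ?f r = 0"
      by (simp add: clinear_diff[OF clinear_tensor_lift[OF f]] tensor_lift_tensor[OF f] uact_simps ann
          clinear_scale[OF clinear_uact(1)] mult.commute)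
  qed
  have \<Psi>: "\<Psi> (abs_vacuum_module t) = tensor_lift ?f t" for t
  proof -
    have "rep_vacuum_module (abs_vacuum_module t) - t \<in> cspan balancing_rels"
      by (rule Quotient3_rep_abs[OF Quotient3_vacuum_module]) (simp add: complex_vector.span_zero)
    from bal[OF this] show ?thesis
      by (simp add: \<Psi>_def clinear_diff[OF clinear_tensor_lift[OF f]])
  qed
  have \<Psi>_ind: "\<Psi> (induced_tensor u z) = z *\<^sub>C uact u e0" for u z
    by (simp add: induced_tensor_def \<Psi> tensor_lift_tensor[OF f])
  have ex: "\<exists>t. v = abs_vacuum_module t" for v :: "'g vacuum_module"
    by (induct v rule: vacuum_module.abs_induct) blast
  have lin\<Psi>: "clinear \<Psi>"
  proof (rule clinearI)
    fix v w :: "'g vacuum_module" and c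
    obtain s t where v: "v = abs_vacuum_module s" "w = abs_vacuum_module t" using ex by blast
    show "\<Psi> (v + w) = \<Psi> v + \<Psi> w" "\<Psi> (c *\<^sub>C v) = c *\<^sub>C \<Psi> v"
      by (simp_all add: v \<Psi> plus_vacuum_module.abs_eq scaleC_vacuum_module.abs_eq
          clinear_add[OF clinear_tensor_lift[OF f]] clinear_scale[OF clinear_tensor_lift[OF f]])
  qed
  show thesis
  proof (rule that[OF lin\<Psi>])
    show "\<Psi> vacuum_vector = e0"
      by (simp add: vacuum_vector_def \<Psi>_ind uact_simps scaleC_one)
    fix X F v
    show "\<Psi> (current X F v) = c X F (\<Psi> v)"
    proof (induction v rule: vacuum_module_induct)
      case (tensor u z)
      show ?case
        by (simp add: current_def uea_act_induced_tensor \<Psi>_ind uact_simps \<rho>_tensor clinear_scale[OF lin(1)])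
    next
      case (add v w)
      then show ?case
        by (simp add: clinear_add[OF lin\<Psi>] clinear_add[OF lin(1)] clinear_add[OF clinear_current])
    qed
  qed
qed

subsection \<open>Translation and derivation\<close>

text \<open>Twisting the action by the automorphism F(tau) to F(tau + n) of K gives another
  representation on the same space. The automorphism preserves polynomials, so the vacuum is still
  annihilated.\<close>

lemma ex_vshift:
  "\<exists>\<Psi> :: 'g::complex_lie_algebra vacuum_module \<Rightarrow> 'g vacuum_module. clinear \<Psi> \<and> \<Psi> vacuum_vector = vacuum_vector
     \<and> (\<forall>X F v. \<Psi> (current X F v) = current X (shift n F) (\<Psi> v))"
proof -
  obtain \<Psi> :: "'g vacuum_module \<Rightarrow> 'g vacuum_module" where
    "clinear \<Psi>" "\<Psi> vacuum_vector = vacuum_vector"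
    "\<And>X F v. \<Psi> (current X F v) = current X (shift n F) (\<Psi> v)"
  proof (rule vacuum_universal[of "\<lambda>X F. current X (shift n F)" vacuum_vector])
    show "clinear (current X (shift n F))" for X :: 'g and F by (rule clinear_current)
    show "clinear (\<lambda>X :: 'g. current X (shift n F) e)" "clinear (\<lambda>F. current X (shift n F) e)" for X F e
      by (rule clinearI; simp add: shift_hom current_simps)+
    show "current (lie_bracket X Y) (shift n (F * G)) e
        = current X (shift n F) (current Y (shift n G) e) - current Y (shift n G) (current X (shift n F) e)"
      for X Y :: 'g and F G e
      by (simp add: shift_hom current_bracket)
    show "current X (shift n (of_poly p)) vacuum_vector = 0" for X :: 'g and p
      by (simp add: shift_of_poly current_vacuum)
  qed (rule that)
  then show ?thesis by blast
qed

text \<open>The operator \<open>T\<^sup>n\<close> on states; it translates the insertion points by \<open>n\<close>.\<close>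

definition vshift :: "int \<Rightarrow> 'g::complex_lie_algebra vacuum_module \<Rightarrow> 'g vacuum_module"
  where "vshift n = (SOME \<Psi>. clinear \<Psi> \<and> \<Psi> vacuum_vector = vacuum_vector
     \<and> (\<forall>X F v. \<Psi> (current X F v) = current X (shift (- n) F) (\<Psi> v)))"

lemma clinear_vshift: "clinear (vshift n)"
  and vshift_vacuum: "vshift n vacuum_vector = vacuum_vector"
  and vshift_current: "vshift n (current X F v) = current X (shift (- n) F) (vshift n v)"
  using someI_ex[OF ex_vshift[of "- n"], folded vshift_def] by blast+

lemma vshift_vshift: "vshift n (vshift m v) = vshift (n + m) v"
  by (induction v rule: vacuum_induct)
     (simp_all add: vshift_vacuum vshift_current shift_shift clinear_add[OF clinear_vshift]
       clinear_scale[OF clinear_vshift] add.commute)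

lemma vshift_0: "vshift 0 v = v"
  by (induction v rule: vacuum_induct)
     (simp_all add: vshift_vacuum vshift_current shift_0 clinear_add[OF clinear_vshift]
       clinear_scale[OF clinear_vshift])

instantiation prod :: (complex_vector, complex_vector) complex_vector
begin
definition scaleC_prod :: "complex \<Rightarrow> 'a \<times> 'b \<Rightarrow> 'a \<times> 'b"
  where "scaleC_prod c p = (c *\<^sub>C fst p, c *\<^sub>C snd p)"
instance
  by standard (auto simp: scaleC_prod_def scaleC_add_right scaleC_add_left scaleC_one plus_prod_def)
end

text \<open>The universal property yields module maps, not derivations. The derivation is therefore
  read off from a map v to v + eps D(v) over the dual numbers, where X_{F} acts as X_{F} - eps
  X_{F'}; the pairs are the components in 1 and eps.\<close>

lemma ex_vderiv:
  "\<exists>D :: 'g::complex_lie_algebra vacuum_module \<Rightarrow> 'g vacuum_module. clinear D \<and> D vacuum_vector = 0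
     \<and> (\<forall>X F v. D (current X F v) = current X F (D v) - current X (kderiv F) v)"
proof -
  let ?c = "\<lambda>(X :: 'g) F (e :: 'g vacuum_module \<times> 'g vacuum_module).
    (current X F (fst e), current X F (snd e) - current X (kderiv F) (fst e))"
  obtain \<Psi> :: "'g vacuum_module \<Rightarrow> 'g vacuum_module \<times> 'g vacuum_module" where
    \<Psi>: "clinear \<Psi>" "\<Psi> vacuum_vector = (vacuum_vector, 0)" "\<And>X F v. \<Psi> (current X F v) = ?c X F (\<Psi> v)"
  proof (rule vacuum_universal[of ?c "(vacuum_vector, 0)"])
    show "clinear (?c X F)" for X F
      by (rule clinearI) (simp_all add: scaleC_prod_def clinear_add[OF clinear_current]
          clinear_scale[OF clinear_current] complex_vector.scale_right_diff_distrib)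
    show "clinear (\<lambda>X. ?c X F e)" "clinear (\<lambda>F. ?c X F e)" for X F e
      by (rule clinearI; simp add: scaleC_prod_def current_simps kderiv_hom
          complex_vector.scale_right_diff_distrib)+
    show "?c (lie_bracket X Y) (F * G) e = ?c X F (?c Y G e) - ?c Y G (?c X F e)" for X Y F G e
      by (simp add: current_bracket kderiv_hom current_simps clinear_diff[OF clinear_current])
    show "?c X (of_poly p) (vacuum_vector, 0) = 0" for X p
      by (simp add: current_vacuum kderiv_of_poly clinear_zero[OF clinear_current] zero_prod_def)
  qed (rule that)
  have fst: "fst (\<Psi> v) = v" for v
    by (induction v rule: vacuum_induct)
       (simp_all add: \<Psi> clinear_add[OF \<Psi>(1)] clinear_scale[OF \<Psi>(1)] scaleC_prod_def)
  have "clinear (\<lambda>v. snd (\<Psi> v))"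
    by (rule clinearI) (simp_all add: clinear_add[OF \<Psi>(1)] clinear_scale[OF \<Psi>(1)] scaleC_prod_def)
  then show ?thesis
    by (intro exI[of _ "\<lambda>v. snd (\<Psi> v)"]) (simp add: \<Psi> fst)
qed

definition vderiv :: "'g::complex_lie_algebra vacuum_module \<Rightarrow> 'g vacuum_module"
  where "vderiv = (SOME D. clinear D \<and> D vacuum_vector = 0
     \<and> (\<forall>X F v. D (current X F v) = current X F (D v) - current X (kderiv F) v))"

lemma clinear_vderiv: "clinear vderiv"
  and vderiv_vacuum: "vderiv vacuum_vector = 0"
  and vderiv_current: "vderiv (current X F v) = current X F (vderiv v) - current X (kderiv F) v"
  using someI_ex[OF ex_vderiv, folded vderiv_def] by blast+

subsection \<open>Local modes of the currents\<close>

text \<open>Moving X_{F} past Y_{G} leaves the bracket current at GF, and multiplication by G is a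
  convolution of Laurent coefficients.\<close>

lemma ex_cmode_current:
  assumes "laurent_family w" "\<And>F. current X F v = pair F w"
    and "laurent_family w'" "\<And>F. current (lie_bracket X Y) F v = pair F w'"
  shows "laurent_family (\<lambda>k m. current Y G (w k m) + conv G w' k m)"
    and "current X F (current Y G v) = pair F (\<lambda>k m. current Y G (w k m) + conv G w' k m)"
proof -
  have l: "laurent_family (\<lambda>k m. current Y G (w k m))" "laurent_family (conv G w')"
    by (rule laurent_family_map[OF assms(1)], simp add: clinear_zero[OF clinear_current])
       (rule laurent_family_conv[OF assms(3)])
  show "laurent_family (\<lambda>k m. current Y G (w k m) + conv G w' k m)"
    by (rule laurent_family_add[OF l])
  have "current X F (current Y G v) = current Y G (current X F v) + current (lie_bracket X Y) (G * F) v"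
    by (simp add: current_bracket mult.commute[of G])
  also have "\<dots> = pair F (\<lambda>k m. current Y G (w k m)) + pair F (conv G w')"
    by (simp only: assms(2,4) pair_map[OF clinear_current assms(1)] pair_mult[OF assms(3)])
  finally show "current X F (current Y G v) = pair F (\<lambda>k m. current Y G (w k m) + conv G w' k m)"
    by (simp only: pair_add_right[OF l])
qed

lemma ex_cmode_vacuum:
  "laurent_family (\<lambda>k m. if m < 0 then current X (pole (- k) ^ nat (- m)) vacuum_vector else 0)"
  "current X F vacuum_vector
    = pair F (\<lambda>k m. if m < 0 then current X (pole (- k) ^ nat (- m)) vacuum_vector else 0)"
proof -
  show "laurent_family (\<lambda>k m. if m < 0 then current X (pole (- k) ^ nat (- m)) vacuum_vector else 0)"
    by (rule laurent_family_singular) simp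
  show "current X F vacuum_vector
    = pair F (\<lambda>k m. if m < 0 then current X (pole (- k) ^ nat (- m)) vacuum_vector else 0)"
    by (rule pair_of_vanishing) (auto intro!: clinearI simp: current_simps current_vacuum)
qed

text \<open>The quantifier over \<open>X\<close> belongs inside the induction, since the step for a
  current in \<open>Y\<close> uses the coefficients of the bracket of \<open>X\<close> and
  \<open>Y\<close>.\<close>

lemma ex_cmode: "\<forall>X. \<exists>w. laurent_family w \<and> (\<forall>F. current X F v = pair F w)"
proof (induction v rule: vacuum_induct)
  case vac
  show ?case using ex_cmode_vacuum by blast
next
  case (current Y G v)
  show ?case
  proof
    fix X
    obtain w w' where "laurent_family w" "\<And>F. current X F v = pair F w"
      "laurent_family w'" "\<And>F. current (lie_bracket X Y) F v = pair F w'"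
      using current by blast
    from ex_cmode_current[OF this]
    show "\<exists>w. laurent_family w \<and> (\<forall>F. current X F (current Y G v) = pair F w)" by blast
  qed
next
  case (add v u)
  show ?case
  proof
    fix X
    obtain w w' where w: "laurent_family w" "\<And>F. current X F v = pair F w"
      "laurent_family w'" "\<And>F. current X F u = pair F w'"
      using add by blast
    show "\<exists>w. laurent_family w \<and> (\<forall>F. current X F (v + u) = pair F w)"
      by (intro exI[of _ "\<lambda>k m. w k m + w' k m"])
         (simp add: laurent_family_add w pair_add_right clinear_add[OF clinear_current])
  qed
next
  case (scale c v)
  show ?case
  proof
    fix X
    obtain w where w: "laurent_family w" "\<And>F. current X F v = pair F w"
      using scale by blast
    show "\<exists>w. laurent_family w \<and> (\<forall>F. current X F (c *\<^sub>C v) = pair F w)"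
      by (intro exI[of _ "\<lambda>k m. c *\<^sub>C w k m"])
         (simp add: laurent_family_scale w pair_scale_right clinear_scale[OF clinear_current])
  qed
qed

text \<open>
  The operator \<open>X\<^bsub>{\<phi>}\<^esub>\<close> for the local function \<open>\<phi>\<close> that is \<open>(\<tau> - k)\<^sup>m\<close> near \<open>k\<close> and vanishes near all
  other integers.
\<close>

definition cmode :: "'g::complex_lie_algebra \<Rightarrow> int \<Rightarrow> int \<Rightarrow> 'g vacuum_module \<Rightarrow> 'g vacuum_module"
  where "cmode X k m v = (SOME w. laurent_family w \<and> (\<forall>F. current X F v = pair F w)) k m"

lemma cmode_family: "laurent_family (\<lambda>k m. cmode X k m v)"
  and current_cmode: "current X F v = pair F (\<lambda>k m. cmode X k m v)"
  using someI_ex[OF ex_cmode[rule_format, of X v]] unfolding cmode_def by blast+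

lemma cmode_eqI:
  assumes "laurent_family w" "\<And>F. current X F v = pair F w"
  shows "cmode X k m v = w k m"
proof -
  have "(\<lambda>k m. cmode X k m v) = w"
    by (rule pair_unique[OF cmode_family assms(1)]) (simp flip: assms(2) current_cmode)
  then show ?thesis by (simp add: fun_eq_iff)
qed

lemma clinear_cmode: "clinear (cmode X k m)"
proof (rule clinearI)
  fix v u and c
  show "cmode X k m (v + u) = cmode X k m v + cmode X k m u"
    by (rule cmode_eqI)
       (simp_all add: laurent_family_add cmode_family pair_add_right clinear_add[OF clinear_current]
         flip: current_cmode)
  show "cmode X k m (c *\<^sub>C v) = c *\<^sub>C cmode X k m v"
    by (rule cmode_eqI)
       (simp_all add: laurent_family_scale cmode_family pair_scale_right clinear_scale[OF clinear_current]
         flip: current_cmode)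
qed

lemma cmode_vacuum: "m \<ge> 0 \<Longrightarrow> cmode X k m vacuum_vector = 0"
  by (subst cmode_eqI[OF ex_cmode_vacuum]) simp

lemma cmode_current:
  "cmode X k m (current Y G v)
    = current Y G (cmode X k m v) + conv G (\<lambda>k m. cmode (lie_bracket X Y) k m v) k m"
  by (rule cmode_eqI[OF ex_cmode_current]) (rule cmode_family current_cmode)+

text \<open>For a fixed position the convolution is itself a distribution in \<open>F\<close>, with
  coefficients supported at the integer \<open>k\<close>. In this form \<open>pair_unique\<close>
  can compare it with other distributions.\<close>

lemma conv_as_pair:
  assumes "laurent_family w"
  shows "laurent_family (\<lambda>l n. if l = k then w k (n + m) else 0)"
    and "conv F w k m = pair F (\<lambda>l n. if l = k then w k (n + m) else 0)"
proof -
  let ?u = "\<lambda>l n. if l = k then w k (n + m) else 0"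
  obtain N where N: "N \<ge> 0" "\<And>n m. w n m \<noteq> 0 \<Longrightarrow> m \<ge> 0 \<Longrightarrow> \<bar>n\<bar> \<le> N"
    "\<And>n m. w n m \<noteq> 0 \<Longrightarrow> m \<le> N" by (rule laurent_familyE[OF assms]) (rule that)
  show u: "laurent_family ?u"
  proof (rule laurent_familyI[where N = "N - m" and N' = "\<bar>k\<bar>"])
    fix l n assume "?u l n \<noteq> 0"
    then have "l = k" "w k (n + m) \<noteq> 0" by (auto split: if_splits)
    then show "n \<le> N - m \<and> \<bar>l\<bar> \<le> \<bar>k\<bar>" using N(3)[of k "n + m"] by simp
  qed
  have "pair F ?u = (\<Sum>(l, n)\<in>(\<lambda>n. (k, n)) ` {n. cf F k n \<noteq> 0 \<and> w k (n + m) \<noteq> 0}. cf F l n *\<^sub>C ?u l n)"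
  proof (rule pair_superset)
    have "(\<lambda>n. (k, n)) ` {n. cf F k n \<noteq> 0 \<and> w k (n + m) \<noteq> 0} \<subseteq> {(l, n). cf F l n \<noteq> 0 \<and> ?u l n \<noteq> 0}"
      by auto
    then show "finite ((\<lambda>n. (k, n)) ` {n. cf F k n \<noteq> 0 \<and> w k (n + m) \<noteq> 0})"
      by (rule finite_subset) (rule finite_pair_support[OF u])
  qed (auto split: if_splits)
  also have "\<dots> = conv F w k m"
    unfolding conv_def by (subst sum.reindex) (auto simp: inj_on_def)
  finally show "conv F w k m = pair F ?u" by simp
qed

text \<open>Both sides are the coefficients of one distribution: \<open>cmode_current\<close> is
  read as an identity in the function of the second current, and uniqueness is applied a second
  time. The bracket term is supported at \<open>k\<close>, whence modes at distinct integers
  commute.\<close>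

lemma cmode_bracket:
  "cmode X k m (cmode Y l n v)
    = cmode Y l n (cmode X k m v) + (if l = k then cmode (lie_bracket X Y) k (n + m) v else 0)"
proof -
  let ?u = "\<lambda>l n. if l = k then cmode (lie_bracket X Y) k (n + m) v else 0"
  have uf: "laurent_family ?u" by (rule conv_as_pair(1)[OF cmode_family])
  have L: "laurent_family (\<lambda>l n. cmode X k m (cmode Y l n v))"
    by (rule laurent_family_map[OF cmode_family[of Y v]]) (simp add: clinear_zero[OF clinear_cmode])
  have R: "laurent_family (\<lambda>l n. cmode Y l n (cmode X k m v) + ?u l n)"
    by (rule laurent_family_add[OF cmode_family uf])
  have "pair F (\<lambda>l n. cmode X k m (cmode Y l n v)) = pair F (\<lambda>l n. cmode Y l n (cmode X k m v) + ?u l n)" for F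
  proof -
    have "pair F (\<lambda>l n. cmode X k m (cmode Y l n v)) = cmode X k m (current Y F v)"
      by (simp only: pair_map[OF clinear_cmode cmode_family] current_cmode[of Y F v])
    also have "\<dots> = current Y F (cmode X k m v) + conv F (\<lambda>k m. cmode (lie_bracket X Y) k m v) k m"
      by (rule cmode_current)
    also have "\<dots> = pair F (\<lambda>l n. cmode Y l n (cmode X k m v)) + pair F ?u"
      by (simp only: conv_as_pair(2)[OF cmode_family] current_cmode[of Y F "cmode X k m v"])
    finally show ?thesis by (simp only: pair_add_right[OF cmode_family uf])
  qed
  from pair_unique[OF L R this] show ?thesis by meson
qed

lemma pair_shift: "laurent_family w \<Longrightarrow> pair (shift n F) w = pair F (\<lambda>k m. w (k - n) m)"
  and laurent_family_shift: "laurent_family w \<Longrightarrow> laurent_family (\<lambda>k m. w (k - n) m)"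
proof -
  assume w: "laurent_family w"
  obtain N where N: "N \<ge> 0" "\<And>n m. w n m \<noteq> 0 \<Longrightarrow> m \<ge> 0 \<Longrightarrow> \<bar>n\<bar> \<le> N"
    "\<And>n m. w n m \<noteq> 0 \<Longrightarrow> m \<le> N" by (rule laurent_familyE[OF w]) (rule that)
  show "laurent_family (\<lambda>k m. w (k - n) m)"
    by (rule laurent_familyI[where N = N and N' = "N + \<bar>n\<bar>"]) (use N(2,3) in force)
  show "pair (shift n F) w = pair F (\<lambda>k m. w (k - n) m)"
    unfolding pair_def loc_shift
    by (rule sum.reindex_bij_witness[where i = "\<lambda>(k, m). (k - n, m)" and j = "\<lambda>(k, m). (k + n, m)"]) auto
qed

lemma vshift_cmode: "vshift n (cmode X k m v) = cmode X (k + n) m (vshift n v)"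
proof -
  have l: "laurent_family (\<lambda>k m. vshift n (cmode X k m v))"
    by (rule laurent_family_map[OF cmode_family[of X v]]) (simp add: clinear_zero[OF clinear_vshift])
  have "cmode X (k + n) m (vshift n v) = vshift n (cmode X (k + n - n) m v)"
  proof (rule cmode_eqI[OF laurent_family_shift[OF l]])
    fix F
    have "current X F (vshift n v) = vshift n (current X (shift n F) v)"
      by (simp add: vshift_current shift_shift shift_0)
    also have "\<dots> = pair (shift n F) (\<lambda>k m. vshift n (cmode X k m v))"
      by (simp only: pair_map[OF clinear_vshift cmode_family] current_cmode[of X "shift n F" v])
    also have "\<dots> = pair F (\<lambda>k m. vshift n (cmode X (k - n) m v))"
      by (rule pair_shift[OF l])
    finally show "current X F (vshift n v) = pair F (\<lambda>k m. vshift n (cmode X (k - n) m v))" .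
  qed
  then show ?thesis by simp
qed

lemma pair_kderiv:
  assumes "laurent_family w"
  shows "laurent_family (\<lambda>k m. of_int m *\<^sub>C w k (m - 1))"
    and "pair (kderiv F) w = pair F (\<lambda>k m. of_int m *\<^sub>C w k (m - 1))"
proof -
  obtain N where N: "N \<ge> 0" "\<And>n m. w n m \<noteq> 0 \<Longrightarrow> m \<ge> 0 \<Longrightarrow> \<bar>n\<bar> \<le> N"
    "\<And>n m. w n m \<noteq> 0 \<Longrightarrow> m \<le> N" by (rule laurent_familyE[OF assms]) (rule that)
  show l: "laurent_family (\<lambda>k m. of_int m *\<^sub>C w k (m - 1))"
  proof (rule laurent_familyI[where N = "N + 1" and N' = N])
    fix k m :: int assume "m \<ge> 0" "of_int m *\<^sub>C w k (m - 1) \<noteq> 0"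
    then have "m \<ge> 1" "w k (m - 1) \<noteq> 0" by (cases "m = 0", auto)
    then show "m \<le> N + 1 \<and> \<bar>k\<bar> \<le> N" using N(2,3)[of k "m - 1"] by simp
  qed
  have nz: "(of_int b + 1 = (0 :: complex)) = (b + 1 = 0)" for b
    by (metis of_int_0 of_int_1 of_int_add of_int_eq_iff)
  have "pair F (\<lambda>k m. of_int m *\<^sub>C w k (m - 1))
      = (\<Sum>(k, m)\<in>{(k, m). cf F k m \<noteq> 0 \<and> of_int m *\<^sub>C w k (m - 1) \<noteq> 0}. (of_int m * cf F k m) *\<^sub>C w k (m - 1))"
    unfolding pair_def by (intro sum.cong) (auto simp: mult.commute)
  also have "\<dots> = pair (kderiv F) w"
    unfolding pair_def cf_kderiv
    by (rule sum.reindex_bij_witness[where i = "\<lambda>(k, m). (k, m + 1)" and j = "\<lambda>(k, m). (k, m - 1)"])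
       (auto simp: nz)
  finally show "pair (kderiv F) w = pair F (\<lambda>k m. of_int m *\<^sub>C w k (m - 1))" by simp
qed

lemma covariant_cmode: "covariant vderiv (cmode X k)"
  unfolding covariant_def
proof (intro allI)
  fix m v
  note d = pair_kderiv[OF cmode_family[of X v]]
  have l: "laurent_family (\<lambda>k m. vderiv (cmode X k m v))"
    by (rule laurent_family_map[OF cmode_family[of X v]]) (simp add: clinear_zero[OF clinear_vderiv])
  have "cmode X k m (vderiv v) = vderiv (cmode X k m v) + of_int m *\<^sub>C cmode X k (m - 1) v"
  proof (rule cmode_eqI[OF laurent_family_add[OF l d(1)]])
    fix F
    have "current X F (vderiv v) = vderiv (current X F v) + current X (kderiv F) v"
      by (simp add: vderiv_current)
    also have "\<dots> = pair F (\<lambda>k m. vderiv (cmode X k m v)) + pair F (\<lambda>k m. of_int m *\<^sub>C cmode X k (m - 1) v)"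
      by (simp only: pair_map[OF clinear_vderiv cmode_family] current_cmode[of X _ v] d(2))
    finally show "current X F (vderiv v)
        = pair F (\<lambda>k m. vderiv (cmode X k m v) + of_int m *\<^sub>C cmode X k (m - 1) v)"
      by (simp only: pair_add_right[OF l d(1)])
  qed
  then show "vderiv (cmode X k m v) = cmode X k m (vderiv v) - of_int m *\<^sub>C cmode X k (m - 1) v"
    by simp
qed

lemma formal_field_cmode: "formal_field (cmode X k)"
  unfolding formal_field_def
proof (intro conjI allI)
  fix v
  obtain N where N: "N \<ge> 0" "\<And>n m. cmode X n m v \<noteq> 0 \<Longrightarrow> m \<ge> 0 \<Longrightarrow> \<bar>n\<bar> \<le> N"
    "\<And>n m. cmode X n m v \<noteq> 0 \<Longrightarrow> m \<le> N"
    by (rule laurent_familyE[OF cmode_family]) (rule that)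
  have "cmode X k m v = 0" if "m \<ge> N + 1" for m
    using N(3)[of k m] that by (cases "cmode X k m v = 0") auto
  then show "\<exists>N. \<forall>m\<ge>N. cmode X k m v = 0" by blast
qed (rule clinear_cmode)

text \<open>The loop algebra has no central term, so the commutator of two currents is a delta
  function without derivatives, and order 1 suffices.\<close>

lemma local_cmode: "local 1 (cmode X k) (cmode Y l)"
  unfolding local_def by (auto simp: dsh_apply cmode_bracket[of X k] algebra_simps)

lemma local_cmode_neq: "k \<noteq> l \<Longrightarrow> local 0 (cmode X k) (cmode Y l)"
  unfolding local_0 by (simp add: cmode_bracket[of X k])

section \<open>The state-field correspondence\<close>

text \<open>Products are taken only with a mode family of a current on the left. By
  \<open>mprod_creative\<close> this matches the way states are built by applying modes to the
  vacuum, so every state is reached.\<close>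

inductive state_field :: "'g::complex_lie_algebra vacuum_module modes \<Rightarrow> bool" where
  ident: "state_field (\<lambda>m c. if m = - 1 then c else 0)"
| mode: "state_field (cmode X k)"
| product: "state_field A \<Longrightarrow> state_field (mprod (cmode X k) n A)"
| add: "state_field A \<Longrightarrow> state_field B \<Longrightarrow> state_field (\<lambda>m c. A m c + B m c)"
| scale: "state_field A \<Longrightarrow> state_field (\<lambda>m c. a *\<^sub>C A m c)"

lemma state_field_formal: "state_field A \<Longrightarrow> formal_field A"
proof (induction rule: state_field.induct)
  case ident
  show ?case
    unfolding formal_field_def
    by (intro conjI allI clinearI exI[of _ 0]) simp_all
next
  case (add A B)
  show ?case
    unfolding formal_field_def
  proof (intro conjI allI)
    show "clinear (\<lambda>c. A m c + B m c)" for m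
      using add.IH[THEN formal_field_clinear]
      by (intro clinearI) (simp_all add: clinear_add clinear_scale scaleC_add_right)
    fix c
    obtain N where "\<And>m. m \<ge> N \<Longrightarrow> A m c = 0" by (rule formal_field_bound[OF add.IH(1)]) (rule that)
    moreover obtain N' where "\<And>m. m \<ge> N' \<Longrightarrow> B m c = 0" by (rule formal_field_bound[OF add.IH(2)]) (rule that)
    ultimately have "A m c + B m c = 0" if "m \<ge> max N N'" for m
      using that by simp
    then show "\<exists>N. \<forall>m\<ge>N. A m c + B m c = 0" by blast
  qed
next
  case (scale A a)
  show ?case
    unfolding formal_field_def
  proof (intro conjI allI)
    show "clinear (\<lambda>c. a *\<^sub>C A m c)" for m
      using scale.IH[THEN formal_field_clinear]
      by (intro clinearI) (simp_all add: clinear_add clinear_scale scaleC_add_right mult.commute)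
    fix c
    obtain N where "\<And>m. m \<ge> N \<Longrightarrow> A m c = 0" by (rule formal_field_bound[OF scale.IH]) (rule that)
    then have "a *\<^sub>C A m c = 0" if "m \<ge> N" for m using that by simp
    then show "\<exists>N. \<forall>m\<ge>N. a *\<^sub>C A m c = 0" by blast
  qed
qed (simp_all add: formal_field_cmode formal_field_mprod)

lemma state_field_clinear: "state_field A \<Longrightarrow> clinear (A m)"
  by (rule formal_field_clinear[OF state_field_formal])

lemma state_field_vacuum: "state_field A \<Longrightarrow> m \<ge> 0 \<Longrightarrow> A m vacuum_vector = 0"
proof (induction arbitrary: m rule: state_field.induct)
  case (product A X k n)
  then show ?case
    using mprod_creative(1)[OF formal_field_cmode state_field_formal[OF product.hyps] cmode_vacuum product.IH]
    by blast
qed (simp_all add: cmode_vacuum)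

lemma state_field_covariant: "state_field A \<Longrightarrow> covariant vderiv A"
proof (induction rule: state_field.induct)
  case ident
  show ?case
    unfolding covariant_def by (auto simp: clinear_zero[OF clinear_vderiv])
next
  case (product A X k n)
  show ?case
    by (rule mprod_covariant[OF formal_field_cmode state_field_formal[OF product.hyps] clinear_vderiv
          covariant_cmode product.IH])
next
  case (add A B)
  then show ?case
    unfolding covariant_def by (simp add: clinear_add[OF clinear_vderiv] scaleC_add_right)
next
  case (scale A a)
  then show ?case
    unfolding covariant_def
    by (simp add: clinear_scale[OF clinear_vderiv] complex_vector.scale_right_diff_distrib mult.commute)
qed (rule covariant_cmode)

section \<open>Locality of state fields\<close>

lemma local_add:
  assumes "local N A C" "local N B C" "\<And>m. clinear (C m)"
  shows "local N (\<lambda>m c. A m c + B m c) C"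
  unfolding local_def
proof (intro allI)
  fix c p
  let ?A = "\<lambda>(i, j). A i (C j c) - C j (A i c)" and ?B = "\<lambda>(i, j). B i (C j c) - C j (B i c)"
  have "(\<lambda>(i, j). A i (C j c) + B i (C j c) - C j (A i c + B i c)) = (\<lambda>p. ?A p + ?B p)"
    by (auto simp: clinear_add[OF assms(3)])
  then show "(dsh (1, 0) (0, 1) ^^ N) (\<lambda>(i, j). A i (C j c) + B i (C j c) - C j (A i c + B i c)) p = 0"
    using assms(1,2) by (simp only: dsh_pow_add_fun local_def add_0_left)
qed

lemma local_scale:
  assumes "local N A C" "\<And>m. clinear (C m)"
  shows "local N (\<lambda>m c. a *\<^sub>C A m c) C"
  unfolding local_def
proof (intro allI)
  fix c p
  let ?A = "\<lambda>(i, j). A i (C j c) - C j (A i c)"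
  have "(\<lambda>(i, j). a *\<^sub>C A i (C j c) - C j (a *\<^sub>C A i c)) = (\<lambda>p. a *\<^sub>C ?A p)"
    by (auto simp: clinear_scale[OF assms(2)] complex_vector.scale_right_diff_distrib)
  then show "(dsh (1, 0) (0, 1) ^^ N) (\<lambda>(i, j). a *\<^sub>C A i (C j c) - C j (a *\<^sub>C A i c)) p = 0"
    using assms(1) by (simp only: dsh_pow_scale local_def complex_vector.scale_zero_right)
qed

lemma local_ident: "(\<And>m. clinear (C m)) \<Longrightarrow> local 0 (\<lambda>m c. if m = - 1 then c else 0) C"
  unfolding local_0 by (simp add: clinear_zero)

lemma dong_ex:
  assumes "formal_field A" "formal_field B" "formal_field C"
    and "local N1 A B" "local N2 A C" "local N3 B C"
  shows "\<exists>N. local N (mprod A n B) C"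
proof -
  define N where "N = N1 + N2 + N3"
  have "local N A B" "local N A C" "local N B C"
    by (rule local_mono[OF assms(4)] local_mono[OF assms(5)] local_mono[OF assms(6)]; simp add: N_def)+
  from dong[OF assms(1-3) this] show ?thesis by blast
qed

text \<open>Dong's lemma consumes locality of all three pairs of fields. Locality is therefore first
  proved against single currents, which then feed the induction for two arbitrary state
  fields.\<close>

lemma state_field_local_cmode: "state_field C \<Longrightarrow> \<forall>X k. \<exists>N. local N (cmode X k) C"
proof (induction rule: state_field.induct)
  case ident
  show ?case by (blast intro: local_sym local_ident clinear_cmode)
next
  case (mode Y l)
  show ?case using local_cmode by blast
next
  case (product A Y l n)
  show ?case
  proof (intro allI)
    fix X k
    obtain N1 N2 where N: "local N1 (cmode Y l) A" "local N2 (cmode X k) A" using product.IH by blast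
    have "\<exists>N. local N (mprod (cmode Y l) n A) (cmode X k)"
      by (rule dong_ex[OF formal_field_cmode state_field_formal[OF product.hyps] formal_field_cmode
            N(1) local_cmode local_sym[OF N(2)]])
    then show "\<exists>N. local N (cmode X k) (mprod (cmode Y l) n A)" using local_sym by blast
  qed
next
  case (add A B)
  show ?case
  proof (intro allI)
    fix X k
    obtain N1 N2 where "local N1 (cmode X k) A" "local N2 (cmode X k) B" using add.IH by blast
    then have "local (N1 + N2) A (cmode X k)" "local (N1 + N2) B (cmode X k)"
      by (auto intro: local_mono[OF local_sym])
    from local_sym[OF local_add[OF this clinear_cmode]]
    show "\<exists>N. local N (cmode X k) (\<lambda>m c. A m c + B m c)" by blast
  qed
next
  case (scale A a)
  then show ?case by (blast intro: local_sym local_scale clinear_cmode)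
qed

lemma state_field_local: "state_field A \<Longrightarrow> state_field B \<Longrightarrow> \<exists>N. local N A B"
proof (induction rule: state_field.induct)
  case ident
  then show ?case by (blast intro: local_ident state_field_clinear)
next
  case (mode X k)
  then show ?case using state_field_local_cmode by blast
next
  case (product A X k n)
  obtain N1 N2 N3 where "local N1 (cmode X k) A" "local N2 (cmode X k) B" "local N3 A B"
    using product state_field_local_cmode by blast
  then show ?case
    by (rule dong_ex[OF formal_field_cmode state_field_formal[OF product.hyps] state_field_formal[OF product.prems]])
next
  case (add A A')
  then obtain N1 N2 where "local N1 A B" "local N2 A' B" by blast
  then have "local (N1 + N2) A B" "local (N1 + N2) A' B" by (auto intro: local_mono)
  from local_add[OF this state_field_clinear[OF add.prems]] show ?case by blast
next
  case (scale A a)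
  then show ?case by (blast intro: local_scale state_field_clinear)
qed

text \<open>The field of the translated state, see \<open>field_of_vshift\<close>.\<close>

definition conj :: "int \<Rightarrow> 'g::complex_lie_algebra vacuum_module modes \<Rightarrow> 'g vacuum_module modes"
  where "conj n A = (\<lambda>m c. vshift n (A m (vshift (- n) c)))"

lemma conj_ident: "conj n (\<lambda>m c. if m = - 1 then c else 0) = (\<lambda>m c. if m = - 1 then c else 0)"
  by (auto simp: conj_def fun_eq_iff vshift_vshift vshift_0 clinear_zero[OF clinear_vshift])

lemma conj_cmode: "conj n (cmode X k) = cmode X (k + n)"
  by (simp add: conj_def fun_eq_iff vshift_cmode vshift_vshift vshift_0)

lemma conj_add: "conj n (\<lambda>m c. A m c + B m c) = (\<lambda>m c. conj n A m c + conj n B m c)"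
  by (simp add: conj_def clinear_add[OF clinear_vshift])

lemma conj_scale: "conj n (\<lambda>m c. a *\<^sub>C A m c) = (\<lambda>m c. a *\<^sub>C conj n A m c)"
  by (simp add: conj_def clinear_scale[OF clinear_vshift])

lemma conj_mprod:
  assumes "formal_field A" "formal_field B"
  shows "conj n (mprod A k B) = mprod (conj n A) k (conj n B)"
proof (intro ext)
  fix m c
  let ?T = "\<lambda>(l::int, i, j). A i (B j (vshift (- n) c))" and ?S = "\<lambda>(l::int, i, j). B j (A i (vshift (- n) c))"
  note z = zbd_comp[OF assms, of "\<lambda>_. vshift (- n) c"]
  have "conj n (mprod A k B) m c = ep k (\<lambda>p. vshift n (?T p)) (0, 0, m) - em k (\<lambda>p. vshift n (?S p)) (0, 0, m)"
    unfolding conj_def mprod_def clinear_diff[OF clinear_vshift]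
    by (simp only: ep_map[OF clinear_vshift z(1)] em_map[OF clinear_vshift z(2)])
  moreover have "(\<lambda>p. vshift n (?T p)) = (\<lambda>(l, i, j). conj n A i (conj n B j c))"
    "(\<lambda>p. vshift n (?S p)) = (\<lambda>(l, i, j). conj n B j (conj n A i c))"
    by (auto simp: conj_def vshift_vshift vshift_0)
  ultimately show "conj n (mprod A k B) m c = mprod (conj n A) k (conj n B) m c"
    unfolding mprod_def by (simp only:)
qed

lemma state_field_conj: "state_field A \<Longrightarrow> state_field (conj n A)"
proof (induction rule: state_field.induct)
  case (product A X k m)
  show ?case
    unfolding conj_mprod[OF formal_field_cmode state_field_formal[OF product.hyps]] conj_cmode
    by (rule state_field.product[OF product.IH])
qed (simp_all add: conj_ident conj_cmode conj_add conj_scale state_field.intros)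

text \<open>A state field is assembled from currents at finitely many integers, and a current at any
  other integer commutes with all of them.\<close>

lemma state_field_far_cmode:
  "state_field C \<Longrightarrow> \<forall>X. \<exists>K. \<forall>k. \<bar>k\<bar> > K \<longrightarrow> local 0 (cmode X k) C"
proof (induction rule: state_field.induct)
  case ident
  show ?case by (blast intro: local_sym local_ident clinear_cmode)
next
  case (mode Y l)
  have "local 0 (cmode X k) (cmode Y l)" if "\<bar>k\<bar> > \<bar>l\<bar>" for X k
    using that by (intro local_cmode_neq) auto
  then show ?case by blast
next
  case (product A Y l n)
  show ?case
  proof
    fix X
    obtain K where K: "\<And>k. \<bar>k\<bar> > K \<Longrightarrow> local 0 (cmode X k) A" using product.IH by blast
    have "local 0 (cmode X k) (mprod (cmode Y l) n A)" if "\<bar>k\<bar> > max K \<bar>l\<bar>" for k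
    proof -
      have "k \<noteq> l" "\<bar>k\<bar> > K" using that by auto
      then show ?thesis
        by (intro local_sym[OF mprod_local_0] formal_field_cmode state_field_formal[OF product.hyps]
            local_cmode_neq local_sym[OF K]) auto
    qed
    then show "\<exists>K. \<forall>k. \<bar>k\<bar> > K \<longrightarrow> local 0 (cmode X k) (mprod (cmode Y l) n A)" by blast
  qed
next
  case (add A B)
  show ?case
  proof
    fix X
    obtain K K' where "\<And>k. \<bar>k\<bar> > K \<Longrightarrow> local 0 (cmode X k) A"
      "\<And>k. \<bar>k\<bar> > K' \<Longrightarrow> local 0 (cmode X k) B" using add.IH by blast
    then have "local 0 (cmode X k) (\<lambda>m c. A m c + B m c)" if "\<bar>k\<bar> > max K K'" for k
      using that by (intro local_sym[OF local_add] clinear_cmode) (auto intro: local_sym)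
    then show "\<exists>K. \<forall>k. \<bar>k\<bar> > K \<longrightarrow> local 0 (cmode X k) (\<lambda>m c. A m c + B m c)" by blast
  qed
next
  case (scale A a)
  then show ?case by (blast intro: local_sym local_scale clinear_cmode)
qed

lemma state_field_far:
  "state_field A \<Longrightarrow> state_field B \<Longrightarrow> \<exists>K. \<forall>n. \<bar>n\<bar> > K \<longrightarrow> local 0 (conj n A) B"
proof (induction rule: state_field.induct)
  case ident
  then show ?case by (auto simp: conj_ident intro: local_ident state_field_clinear)
next
  case (mode X k)
  obtain K where "\<And>k. \<bar>k\<bar> > K \<Longrightarrow> local 0 (cmode X k) B"
    using state_field_far_cmode[OF mode.prems] by blast
  then have "local 0 (conj n (cmode X k)) B" if "\<bar>n\<bar> > K + \<bar>k\<bar>" for n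
    using that by (auto simp: conj_cmode)
  then show ?case by blast
next
  case (product A X k m)
  obtain K where K: "\<And>k. \<bar>k\<bar> > K \<Longrightarrow> local 0 (cmode X k) B"
    using state_field_far_cmode[OF product.prems] by blast
  obtain K' where K': "\<And>n. \<bar>n\<bar> > K' \<Longrightarrow> local 0 (conj n A) B" using product.IH[OF product.prems] by blast
  have "local 0 (conj n (mprod (cmode X k) m A)) B" if "\<bar>n\<bar> > max (K + \<bar>k\<bar>) K'" for n
    unfolding conj_mprod[OF formal_field_cmode state_field_formal[OF product.hyps]] conj_cmode
    using that by (intro mprod_local_0 formal_field_cmode K K' state_field_formal[OF product.prems]
        state_field_formal[OF state_field_conj[OF product.hyps]]) auto
  then show ?case by blast
next
  case (add A A')
  obtain K K' where "\<And>n. \<bar>n\<bar> > K \<Longrightarrow> local 0 (conj n A) B" "\<And>n. \<bar>n\<bar> > K' \<Longrightarrow> local 0 (conj n A') B"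
    using add by blast
  then have "local 0 (conj n (\<lambda>m c. A m c + A' m c)) B" if "\<bar>n\<bar> > max K K'" for n
    unfolding conj_add using that by (intro local_add state_field_clinear[OF add.prems]) auto
  then show ?case by blast
next
  case (scale A a)
  then show ?case unfolding conj_scale by (blast intro: local_scale state_field_clinear)
qed

text \<open>Outside a finite window the fields commute, and inside it the sum of the finitely many
  orders bounds each of them.\<close>

lemma state_field_local_uniform:
  assumes "state_field A" "state_field B"
  obtains N and K :: int where "\<And>n. local N (conj n A) B" "\<And>n. \<bar>n\<bar> > K \<Longrightarrow> local 0 (conj n A) B"
proof -
  obtain K where K: "\<And>n. \<bar>n\<bar> > K \<Longrightarrow> local 0 (conj n A) B" using state_field_far[OF assms] by blast
  have "\<forall>n. \<exists>N. local N (conj n A) B" using state_field_local[OF state_field_conj[OF assms(1)] assms(2)] by blast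
  from choice[OF this] obtain r where r: "\<And>n. local (r n) (conj n A) B" by blast
  have "local (sum r {-K..K}) (conj n A) B" for n
  proof (cases "\<bar>n\<bar> > K")
    case True
    from local_mono[OF K[OF this]] show ?thesis by simp
  next
    case False
    then have "r n \<le> sum r {-K..K}" by (intro member_le_sum) auto
    from local_mono[OF r this] show ?thesis .
  qed
  then show thesis using K by (rule that)
qed

text \<open>A current applied to v is a finite combination of vectors \<open>cmode X k m v\<close>,
  and each of these is created by the m-th product with a field creating v.\<close>

lemma state_field_surj:
  fixes a :: "'g::complex_lie_algebra vacuum_module"
  shows "\<exists>A. state_field A \<and> A (- 1) vacuum_vector = a"
proof (induction a rule: vacuum_induct)
  case vac
  show ?case using state_field.ident by (intro exI[of _ "\<lambda>m c. if m = - 1 then c else 0"]) simp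
next
  case (current X F v)
  then obtain A where A: "state_field A" "A (- 1) vacuum_vector = v" by blast
  let ?P = "\<lambda>a :: 'g vacuum_module. \<exists>A. state_field A \<and> A (- 1) vacuum_vector = a"
  have zero: "?P 0"
    using state_field.scale[OF state_field.ident, of 0] by (intro exI[of _ "\<lambda>m c. 0"]) simp
  have plus: "?P (x + y)" if xy: "?P x" "?P y" for x y
  proof -
    obtain A B where "state_field A" "A (- 1) vacuum_vector = x" "state_field B" "B (- 1) vacuum_vector = y"
      using xy by blast
    then show ?thesis using state_field.add by (intro exI[of _ "\<lambda>m c. A m c + B m c"]) simp
  qed
  have monomial: "?P (c *\<^sub>C cmode X k m v)" for c k m
    using state_field.scale[OF state_field.product[OF A(1)], of c X k m]
      mprod_creative(2)[OF formal_field_cmode state_field_formal[OF A(1)] cmode_vacuum state_field_vacuum[OF A(1)], of X k m]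
    by (intro exI[of _ "\<lambda>i b. c *\<^sub>C mprod (cmode X k) m A i b"]) (simp add: A(2))
  have "?P (\<Sum>p\<in>S. case p of (k, m) \<Rightarrow> cf F k m *\<^sub>C cmode X k m v)" for S
  proof (induction S rule: infinite_finite_induct)
    case (insert p S)
    have "?P (case p of (k, m) \<Rightarrow> cf F k m *\<^sub>C cmode X k m v)"
      unfolding case_prod_beta by (rule monomial)
    from plus[OF this insert.IH] show ?case
      unfolding sum.insert[OF insert.hyps] .
  qed (use zero in simp_all)
  then show ?case unfolding current_cmode pair_def by blast
next
  case (add v w)
  then obtain A B where "state_field A" "A (- 1) vacuum_vector = v" "state_field B" "B (- 1) vacuum_vector = w"
    by blast
  then show ?case using state_field.add by (intro exI[of _ "\<lambda>m c. A m c + B m c"]) simp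
next
  case (scale c v)
  then obtain A where "state_field A" "A (- 1) vacuum_vector = v" by blast
  then show ?case using state_field.scale by (intro exI[of _ "\<lambda>m b. c *\<^sub>C A m b"]) simp
qed

text \<open>The difference of two fields creating the same state has vanishing mode -1 on the
  vacuum. Covariance extends this to all modes on the vacuum, and Goddard's argument to all states,
  since each is created by a local field.\<close>

lemma state_field_unique:
  assumes A: "state_field A" "state_field A'" and eq: "A (- 1) vacuum_vector = A' (- 1) vacuum_vector"
  shows "A = A'"
proof -
  define E where "E = (\<lambda>m c. A m c + (- 1) *\<^sub>C A' m c)"
  have E: "state_field E" unfolding E_def by (intro state_field.add state_field.scale A)
  have "E m vacuum_vector = 0" for m
  proof (cases "m \<ge> 0")
    case False
    have "E (- 1 - int (nat (- 1 - m))) vacuum_vector = dpow vderiv (int (nat (- 1 - m))) (E (- 1) vacuum_vector)"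
      by (rule covariant_vacuum[OF clinear_vderiv vderiv_vacuum state_field_covariant[OF E] state_field_clinear[OF E]])
    moreover have "E (- 1) vacuum_vector = 0" by (simp add: E_def eq)
    ultimately show ?thesis using False by (simp add: dpow_zero[OF clinear_vderiv])
  qed (rule state_field_vacuum[OF E])
  then have vac: "E m vacuum_vector = 0" for m .
  have "E m c = 0" for m c
  proof -
    obtain B where B: "state_field B" "B (- 1) vacuum_vector = c" using state_field_surj by blast
    obtain N where N: "local N E B" using state_field_local[OF E B(1)] by blast
    have "E m (B (- 1) vacuum_vector) = 0"
      by (rule goddard_uniqueness[where A = E and B = B and N = N])
         (rule N state_field_clinear[OF E] state_field_clinear[OF B(1)] state_field_vacuum[OF B(1)] vac; assumption?)+
    then show ?thesis by (simp only: B(2))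
  qed
  then show ?thesis by (auto simp: E_def fun_eq_iff)
qed

section \<open>The field of a state\<close>

definition field_of :: "'g::complex_lie_algebra vacuum_module \<Rightarrow> 'g vacuum_module modes"
  where "field_of a = (THE A. state_field A \<and> A (- 1) vacuum_vector = a)"

lemma field_of_eqI: "state_field A \<Longrightarrow> A (- 1) vacuum_vector = a \<Longrightarrow> field_of a = A"
  unfolding field_of_def by (rule the_equality) (use state_field_unique in blast)+

lemma state_field_field_of: "state_field (field_of a)"
  and field_of_state: "field_of a (- 1) vacuum_vector = a"
proof -
  obtain A where A: "state_field A" "A (- 1) vacuum_vector = a" using state_field_surj[of a] by blast
  show "state_field (field_of a)" "field_of a (- 1) vacuum_vector = a"
    unfolding field_of_eqI[OF A] by (rule A)+
qed

lemma field_of_add: "field_of (a + b) m c = field_of a m c + field_of b m c"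
  by (subst field_of_eqI[OF state_field.add[OF state_field_field_of[of a] state_field_field_of[of b]]])
     (simp_all add: field_of_state)

lemma field_of_scale: "field_of (z *\<^sub>C a) m c = z *\<^sub>C field_of a m c"
  by (subst field_of_eqI[OF state_field.scale[OF state_field_field_of[of a], of z]]) (simp_all add: field_of_state)

lemma field_of_vacuum: "field_of vacuum_vector = (\<lambda>m c. if m = - 1 then c else 0)"
  by (rule field_of_eqI[OF state_field.ident]) simp

lemma field_of_vshift: "field_of (vshift n a) = conj n (field_of a)"
  by (rule field_of_eqI[OF state_field_conj[OF state_field_field_of]])
     (simp add: conj_def vshift_vacuum field_of_state)

lemma field_of_current: "field_of (current X inv_tau vacuum_vector) = cmode X 0"
proof (rule field_of_eqI[OF state_field.mode])
  show "cmode X 0 (- 1) vacuum_vector = current X inv_tau vacuum_vector"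
    by (subst cmode_eqI[OF ex_cmode_vacuum]) simp
qed

lemma clinear_field_of: "clinear (field_of a m)" "clinear (\<lambda>a. field_of a m c)"
  by (rule state_field_clinear[OF state_field_field_of])
     (rule clinearI; simp add: field_of_add field_of_scale)

lemma field_of_creation:
  "m \<ge> 0 \<Longrightarrow> field_of a m vacuum_vector = 0"
  "field_of a (- 1 - int k) vacuum_vector = dpow vderiv (int k) a"
proof -
  show "m \<ge> 0 \<Longrightarrow> field_of a m vacuum_vector = 0"
    by (rule state_field_vacuum[OF state_field_field_of])
  show "field_of a (- 1 - int k) vacuum_vector = dpow vderiv (int k) a"
    using covariant_vacuum[OF clinear_vderiv vderiv_vacuum
        state_field_covariant[OF state_field_field_of] state_field_clinear[OF state_field_field_of], of a k]
    by (simp add: field_of_state)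
qed

text \<open>Far from the origin the field of the translated state commutes with the field creating
  \<open>b\<close>, so its nonnegative modes can be moved onto the vacuum, which they kill. Finitely
  many integers remain, each with its own bound on the modes.\<close>

lemma field_of_family: "laurent_family (\<lambda>n m. field_of (vshift n a) m b)"
proof -
  obtain N K where K: "\<And>n. \<bar>n\<bar> > K \<Longrightarrow> local 0 (conj n (field_of a)) (field_of b)"
    by (rule state_field_local_uniform[OF state_field_field_of state_field_field_of]) (rule that)
  have far: "field_of (vshift n a) m b = 0" if "\<bar>n\<bar> > K" "m \<ge> 0" for n m
  proof -
    have "field_of (vshift n a) m b = field_of (vshift n a) m (field_of b (- 1) vacuum_vector)"
      by (simp add: field_of_state)
    also have "\<dots> = field_of b (- 1) (field_of (vshift n a) m vacuum_vector)"
      using K[OF that(1)] unfolding local_0 field_of_vshift by blast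
    also have "\<dots> = 0"
      using that(2) by (simp add: field_of_creation clinear_zero[OF clinear_field_of(1)])
    finally show ?thesis .
  qed
  have "\<forall>n. \<exists>M. \<forall>m\<ge>M. field_of (vshift n a) m b = 0"
    using state_field_formal[OF state_field_field_of] unfolding formal_field_def by blast
  from choice[OF this] obtain r where r: "\<And>n m. m \<ge> r n \<Longrightarrow> field_of (vshift n a) m b = 0" by blast
  show ?thesis
  proof (rule laurent_familyI[where N = "(\<Sum>n\<in>{-K..K}. \<bar>r n\<bar>)" and N' = K])
    fix n m :: int assume *: "m \<ge> 0" "field_of (vshift n a) m b \<noteq> 0"
    then have n: "\<bar>n\<bar> \<le> K" using far by force
    then have "\<bar>r n\<bar> \<le> (\<Sum>n\<in>{-K..K}. \<bar>r n\<bar>)"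
      by (intro member_le_sum) auto
    moreover have "m < r n" using r[of n m] * by force
    ultimately show "m \<le> (\<Sum>n\<in>{-K..K}. \<bar>r n\<bar>) \<and> \<bar>n\<bar> \<le> K" using n by linarith
  qed
qed

lemma field_of_skew:
  assumes "\<And>p. p \<ge> J \<Longrightarrow> field_of b p a = 0"
  shows "field_of a m b = (\<Sum>p\<in>{m..<J}. ((- 1) powi (p + 1)) *\<^sub>C dpow vderiv (p - m) (field_of b p a))"
proof -
  obtain N where "local N (field_of a) (field_of b)"
    using state_field_local[OF state_field_field_of state_field_field_of] by blast
  from skew_symmetry_modes[OF this clinear_field_of(1) clinear_field_of(1) clinear_vderiv vderiv_vacuum
      state_field_covariant[OF state_field_field_of] state_field_covariant[OF state_field_field_of]
      field_of_creation(1) field_of_creation(1), where m = m and J = J]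
  show ?thesis using assms by (simp add: field_of_state)
qed

section \<open>The trace\<close>

lemma has_laurent_expansion_poly:
  "(\<lambda>z. poly p (of_int n + z)) has_laurent_expansion loc_poly n p"
proof -
  let ?r = "pcompose p [:of_int n, 1:]"
  have "(\<lambda>z. poly ?r z) has_fps_expansion fps_of_poly ?r"
    by (simp add: has_fps_expansion_def)
  moreover have "(\<lambda>z. poly ?r z) = (\<lambda>z. poly p (of_int n + z))"
    by (simp add: poly_pcompose fun_eq_iff)
  ultimately show ?thesis
    unfolding loc_poly_def by (simp add: has_fps_expansion_to_laurent)
qed

text \<open>Links the analytic residue in \<open>Tr\<close> to formal coefficients. Both
  \<open>kfun_eval\<close> and \<open>loc\<close> use the numerator and denominator chosen by
  \<open>some_quot\<close>, so one is the expansion of the other.\<close>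

lemma residue_kfun_eval: "residue (kfun_eval F) (of_int n) = cf F n (- 1)"
proof -
  obtain p q where pq: "some_quot (Rep_kfun F) = (p, q)" by fastforce
  have "(\<lambda>z. kfun_eval F (of_int n + z)) has_laurent_expansion loc F n"
    unfolding kfun_eval_def loc_def pq prod.case
    by (intro has_laurent_expansion_divide has_laurent_expansion_poly)
  from has_laurent_expansion_residue[OF this] show ?thesis by simp
qed

definition residue_family :: "int \<Rightarrow> int \<Rightarrow> complex"
  where "residue_family n m = (if m = - 1 then 1 else 0)"

lemma residue_family_0: "m \<ge> 0 \<Longrightarrow> residue_family n m = 0"
  by (simp add: residue_family_def)

lemma laurent_family_residue: "laurent_family residue_family"
  by (rule laurent_family_singular) (rule residue_family_0)

lemma Tr_pair: "Tr F = pair F residue_family"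
proof -
  have "pair F residue_family = (\<Sum>n | cf F n (- 1) \<noteq> 0. cf F n (- 1))"
    unfolding pair_def
    by (rule sum.reindex_bij_witness[where i = "\<lambda>n. (n, - 1)" and j = fst])
       (auto simp: residue_family_def scaleC_complex_def split: if_splits)
  then show ?thesis
    by (simp add: Tr_def residue_kfun_eval Sum_any.expand_set)
qed

lemma Tr_mult: "Tr (F * G) = pair F (\<lambda>n m. cf G n (- 1 - m))"
proof -
  have "conv G residue_family n m = cf G n (- 1 - m)" for n m
  proof -
    have "conv G residue_family n m = (\<Sum>l\<in>{- 1 - m}. cf G n l *\<^sub>C residue_family n (l + m))"
      by (rule conv_superset) (auto simp: residue_family_def split: if_splits)
    then show ?thesis by (simp add: residue_family_def scaleC_complex_def)
  qed
  then have "conv G residue_family = (\<lambda>n m. cf G n (- 1 - m))" by blast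
  then show ?thesis
    by (simp add: Tr_pair mult.commute[of F] pair_mult[OF laurent_family_residue])
qed

lemma clinear_Tr: "clinear Tr"
  using clinear_pair[OF laurent_family_residue] by (simp add: Tr_pair[abs_def])

lemma Tr_pole_power: "Tr (pole n ^ Suc k) = (if k = 0 then 1 else 0)"
  using pair_pole_power[where n = "- n" and k = k and w = residue_family, OF residue_family_0]
  by (simp add: Tr_pair residue_family_def del: power_Suc)

lemma Tr_of_poly_pole: "Tr (pole (- n) ^ Suc k * of_poly p) = cf (of_poly p) n (int k)"
  unfolding Tr_mult by (subst pair_pole_power) (simp_all add: cf_of_poly_neg)

lemma Tr_pole_power_mult_pole: "Tr (pole m ^ Suc k * pole n) = 0"
proof (cases "m = n")
  case True
  then have "pole m ^ Suc k * pole n = pole n ^ Suc (Suc k)"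
    by (simp add: mult_ac)
  then show ?thesis by (simp only: Tr_pole_power) simp
next
  case False
  show ?thesis
  proof (induction k)
    case 0
    show ?case
      using False Tr_pole_power[of m 0] Tr_pole_power[of n 0]
      by (simp add: pole_mult_pole clinear_scale[OF clinear_Tr] clinear_diff[OF clinear_Tr])
  next
    case (Suc k)
    show ?case unfolding pole_power_mult_pole_neq[OF False]
      by (simp only: clinear_scale[OF clinear_Tr] clinear_diff[OF clinear_Tr] Suc.IH Tr_pole_power) simp
  qed
qed

text \<open>The residue theorem on K: a product of two functions vanishing at infinity is O(tau^-2)
  and has no residue there, so its finite residues add up to zero. The proof is by partial
  fractions.\<close>

lemma Tr_sing_pole_power:
  assumes "F \<in> K_sing"
  shows "Tr (F * pole n ^ Suc k) = 0"
proof -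
  have 1: "Tr (G * pole n) = 0" if "G \<in> K_sing" for G
    using that
    by (induction rule: K_sing_induct)
       (simp_all only: Tr_pole_power_mult_pole distrib_right mult_scaleC_left mult_zero_left
         clinear_zero[OF clinear_Tr] clinear_add[OF clinear_Tr] clinear_scale[OF clinear_Tr]
         add_0_left complex_vector.scale_zero_right)
  have "F * pole n ^ k \<in> K_sing"
  proof (induction k)
    case (Suc k)
    have "F * pole n ^ Suc k = F * pole n ^ k * pole n" by (simp add: mult_ac)
    then show ?case by (simp only: K_sing_mult_pole[OF Suc])
  qed (simp add: assms)
  from 1[OF this] show ?thesis by (simp add: mult_ac)
qed

text \<open>A coefficient \<open>w n m\<close> with \<open>m \<ge> 0\<close> meets the m-th Taylor
  coefficient at n, which is the trace against (tau - n)^(-m-1); this dictates the kernel.\<close>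

lemma rational_singularities_pair:
  assumes w: "laurent_family w"
  shows "rational_singularities (\<lambda>G. pair G w)"
proof -
  obtain N where N: "N \<ge> 0" "\<And>n m. w n m \<noteq> 0 \<Longrightarrow> m \<ge> 0 \<Longrightarrow> \<bar>n\<bar> \<le> N"
    "\<And>n m. w n m \<noteq> 0 \<Longrightarrow> m \<le> N" by (rule laurent_familyE[OF w]) (rule that)
  obtain xs where xs: "set xs = {-N..N} \<times> {0..N}" "distinct xs"
    using finite_distinct_list[of "{-N..N} \<times> {0..N}"] by auto
  define ws where "ws = map (\<lambda>(n, m). (w n m, pole (- n) ^ Suc (nat m))) xs"
  have "pair (of_poly p) w = (\<Sum>(w, F)\<leftarrow>ws. Tr (F * of_poly p) *\<^sub>C w)" for p
  proof -
    have "pair (of_poly p) w = (\<Sum>(n, m)\<in>{-N..N} \<times> {0..N}. cf (of_poly p) n m *\<^sub>C w n m)"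
    proof (rule pair_superset)
      fix n m assume *: "cf (of_poly p) n m \<noteq> 0" "w n m \<noteq> 0"
      then have "m \<ge> 0" using cf_of_poly_neg[of m p n] by linarith
      then show "(n, m) \<in> {-N..N} \<times> {0..N}" using N(2,3)[OF *(2)] by auto
    qed simp
    also have "\<dots> = (\<Sum>(n, m)\<leftarrow>xs. cf (of_poly p) n m *\<^sub>C w n m)"
      by (simp only: xs(1)[symmetric] sum.distinct_set_conv_list[OF xs(2)])
    also have "\<dots> = (\<Sum>(w, F)\<leftarrow>ws. Tr (F * of_poly p) *\<^sub>C w)"
      unfolding ws_def map_map
    proof (rule arg_cong[where f = sum_list], rule map_cong[OF refl])
      fix x assume "x \<in> set xs"
      then obtain n m where x: "x = (n, m)" "m \<ge> 0" unfolding xs(1) by auto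
      show "(case x of (n, m) \<Rightarrow> cf (of_poly p) n m *\<^sub>C w n m)
          = ((\<lambda>(w, F). Tr (F * of_poly p) *\<^sub>C w) \<circ> (\<lambda>(n, m). (w n m, pole (- n) ^ Suc (nat m)))) x"
        using x(2) by (simp only: x(1) comp_apply prod.case Tr_of_poly_pole) simp
    qed
    finally show ?thesis .
  qed
  moreover have "snd ` set ws \<subseteq> K_sing"
    unfolding ws_def using K_sing_pole_power by (auto simp del: power_Suc)
  ultimately show ?thesis
    unfolding rational_singularities_def singular_kernel_def using clinear_pair[OF w] by blast
qed

section \<open>The Hopf algebra action\<close>

lemma clinear_antipode: "clinear antipode"
  unfolding antipode_def by (rule clinear_lin_ext)

lemma clinear_hact: "clinear (\<lambda>h. hact h F)"
  unfolding hact_def by (rule clinear_lin_ext)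

lemma Dtau_power: "Dtau ^ k = Poly_Mapping.single (0, k) 1"
proof (induction k)
  case 0
  show ?case by (simp add: zero_prod_def[symmetric])
next
  case (Suc k)
  then show ?case by (simp add: Dtau_def mult_single)
qed

lemma antipode_single: "antipode (Poly_Mapping.single (n, k) 1) = (- 1) ^ k *\<^sub>C Poly_Mapping.single (- n, k) 1"
proof -
  have "(- Dtau) ^ k = (- 1) ^ k *\<^sub>C Dtau ^ k"
  proof (induction k)
    case (Suc k)
    then show ?case by (simp add: mult_scaleC_right)
  qed (simp add: scaleC_one)
  then show ?thesis
    by (simp add: antipode_def lin_ext_single scaleC_one Tpow_def Dtau_power mult_scaleC_right mult_single)
qed

lemma kderiv_funpow_inv_tau: "(kderiv ^^ k) inv_tau = ((- 1) ^ k * fact k) *\<^sub>C pole 0 ^ Suc k"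
proof (induction k)
  case (Suc k)
  show ?case
    by (simp only: funpow.simps comp_apply Suc.IH kderiv_hom kderiv_pole_power scaleC_scaleC)
       (simp add: algebra_simps)
qed (simp add: scaleC_one)

text \<open>The sign of the antipode cancels the sign of the k-th derivative of 1/tau. The remaining
  factorial is the one that separates powers of the derivation from the divided powers
  \<open>dpow\<close>.\<close>

lemma hact_antipode_single:
  "hact (antipode (Poly_Mapping.single (n, k) 1)) inv_tau = fact k *\<^sub>C pole (- n) ^ Suc k"
proof -
  have "hact (antipode (Poly_Mapping.single (n, k) 1)) inv_tau
      = (- 1) ^ k *\<^sub>C shift (- n) (((- 1) ^ k * fact k) *\<^sub>C pole 0 ^ Suc k)"
    unfolding antipode_single clinear_scale[OF clinear_hact]
    by (simp only: hact_def lin_ext_single prod.case kderiv_funpow_inv_tau scaleC_one)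
  also have "\<dots> = fact k *\<^sub>C pole (- n) ^ Suc k"
    by (simp only: shift_hom shift_pole_power scaleC_scaleC) (simp flip: power_mult_distrib)
  finally show ?thesis .
qed

lemma hhat_ext:
  assumes "clinear f" "clinear g" "\<And>n k. f (Poly_Mapping.single (n, k) 1) = g (Poly_Mapping.single (n, k) (1 :: complex))"
  shows "f h = g h"
proof (induction h rule: free_induct)
  case (single p c)
  have *: "Poly_Mapping.single p c = c *\<^sub>C Poly_Mapping.single p (1 :: complex)"
    by (simp add: scaleC_single scaleC_complex_def)
  show ?case unfolding * by (cases p) (simp add: clinear_scale[OF assms(1)] clinear_scale[OF assms(2)] assms(3))
qed (simp_all add: clinear_zero[OF assms(1)] clinear_zero[OF assms(2)] clinear_add[OF assms(1)] clinear_add[OF assms(2)])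

text \<open>Resolves the definite description in \<open>sing_map\<close>: the elements S(h) 1/tau
  for monomials h are pole powers up to a factorial, so together with the polynomials they determine
  a linear map on K.\<close>

lemma sing_map_eqI:
  assumes "clinear r" "\<And>p. r (of_poly p) = 0" "clinear \<phi>"
    and "\<And>n k. fact k *\<^sub>C r (pole (- n) ^ Suc k) = \<phi> (Poly_Mapping.single (n, k) 1)"
  shows "sing_map \<phi> = r"
  unfolding sing_map_def
proof (rule the_equality)
  have lin: "clinear (\<lambda>h. r (hact (antipode h) inv_tau))" if "clinear r" for r :: "kfun \<Rightarrow> 'a"
    by (rule clinearI) (simp_all only: clinear_add[OF clinear_antipode] clinear_add[OF clinear_hact]
        clinear_add[OF that] clinear_scale[OF clinear_antipode] clinear_scale[OF clinear_hact]
        clinear_scale[OF that])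
  have "r (hact (antipode h) inv_tau) = \<phi> h" for h
    by (rule hhat_ext[OF lin[OF assms(1)] assms(3)])
       (simp only: hact_antipode_single clinear_scale[OF assms(1)] assms(4))
  then show "clinear r \<and> (\<forall>p. r (of_poly p) = 0) \<and> (\<forall>h. r (hact (antipode h) inv_tau) = \<phi> h)"
    using assms by blast
  fix s assume s: "clinear s \<and> (\<forall>p. s (of_poly p) = 0) \<and> (\<forall>h. s (hact (antipode h) inv_tau) = \<phi> h)"
  then have ls: "clinear s" by blast
  show "s = r"
  proof
    fix F
    show "s F = r F"
    proof (rule clinear_ext_kfun[OF ls assms(1)])
      show "s (of_poly p) = r (of_poly p)" for p using s assms(2) by simp
      fix n k
      have "fact k *\<^sub>C s (pole (- n) ^ Suc k) = fact k *\<^sub>C r (pole (- n) ^ Suc k)"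
        using s by (simp only: assms(4) hact_antipode_single[symmetric] clinear_scale[OF ls, symmetric])
      then show "s (pole (- n) ^ Suc k) = r (pole (- n) ^ Suc k)" by (simp del: power_Suc)
    qed
  qed
qed

text \<open>The binomial theorem for the two commuting summands of the coproduct of the
  derivation.\<close>

lemma coproduct_single:
  "coproduct (Poly_Mapping.single (n, k) 1)
    = (\<Sum>i\<le>k. of_nat (k choose i) *\<^sub>C (Poly_Mapping.single (n, i) 1 \<otimes>\<^sub>C Poly_Mapping.single (n, k - i) 1))"
proof -
  have l: "(Dtau \<otimes>\<^sub>C 1) ^ i = Dtau ^ i \<otimes>\<^sub>C (1 :: hhat)" and r: "(1 \<otimes>\<^sub>C Dtau) ^ i = (1 :: hhat) \<otimes>\<^sub>C Dtau ^ i" for i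
    by (induction i) (simp_all add: one_tensor_def tensor_mult)
  have of_nat: "(of_nat j :: (hhat, hhat) tensor) * t = of_nat j *\<^sub>C t" for j t
    by (induction j) (simp_all add: distrib_right scaleC_add_left scaleC_one)
  have "coproduct (Poly_Mapping.single (n, k) 1)
      = (Tpow n \<otimes>\<^sub>C Tpow n) * (\<Sum>i\<le>k. of_nat (k choose i) * (Dtau \<otimes>\<^sub>C 1) ^ i * (1 \<otimes>\<^sub>C Dtau) ^ (k - i))"
    by (simp add: coproduct_def lin_ext_single scaleC_one binomial_ring)
  also have "\<dots> = (\<Sum>i\<le>k. of_nat (k choose i) *\<^sub>C ((Tpow n \<otimes>\<^sub>C Tpow n) * ((Dtau \<otimes>\<^sub>C 1) ^ i * (1 \<otimes>\<^sub>C Dtau) ^ (k - i))))"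
    by (simp add: sum_distrib_left mult.assoc of_nat mult_scaleC_left mult_scaleC_right)
  also have "\<dots> = (\<Sum>i\<le>k. of_nat (k choose i) *\<^sub>C (Poly_Mapping.single (n, i) 1 \<otimes>\<^sub>C Poly_Mapping.single (n, k - i) 1))"
    by (simp add: l r tensor_mult Dtau_power Tpow_def mult_single)
  finally show ?thesis .
qed

section \<open>The vertex algebra\<close>

definition vop :: "'g::complex_lie_algebra vacuum_module \<Rightarrow> kfun \<Rightarrow> 'g vacuum_module \<Rightarrow> 'g vacuum_module"
  where "vop a F b = pair F (\<lambda>n m. field_of (vshift n a) m b)"

interpretation V: HT_vertex_algebra_data vacuum_vector vop .

lemma laurent_family_comp:
  "clinear L \<Longrightarrow> laurent_family w \<Longrightarrow> laurent_family (\<lambda>n m. L (w n m))"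
  by (erule laurent_family_map) (simp add: clinear_zero)

lemma clinear_vop: "clinear (\<lambda>F. vop a F b)" "clinear (vop a F)" "clinear (\<lambda>a. vop a F b)"
proof -
  show "clinear (\<lambda>F. vop a F b)" unfolding vop_def by (rule clinear_pair[OF field_of_family])
  show "clinear (vop a F)"
    by (rule clinearI) (simp_all add: vop_def clinear_add[OF clinear_field_of(1)]
        clinear_scale[OF clinear_field_of(1)] pair_add_right pair_scale_right field_of_family)
  show "clinear (\<lambda>a. vop a F b)"
    by (rule clinearI) (simp_all add: vop_def clinear_add[OF clinear_vshift] clinear_scale[OF clinear_vshift]
        field_of_add field_of_scale pair_add_right pair_scale_right field_of_family)
qed

lemma vop_vacuum: "vop vacuum_vector F v = Tr F *\<^sub>C v"
proof -
  have L: "clinear (\<lambda>z. z *\<^sub>C v)" by (rule clinearI) (simp_all add: scaleC_add_left scaleC_complex_def)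
  have "(\<lambda>n m. field_of (vshift n vacuum_vector) m v) = (\<lambda>n m. residue_family n m *\<^sub>C v)"
    by (auto simp: fun_eq_iff vshift_vacuum field_of_vacuum residue_family_def scaleC_one)
  then show ?thesis
    unfolding vop_def by (simp only: pair_map[OF L laurent_family_residue] Tr_pair)
qed

lemma vop_creation: "vop a (of_poly p) vacuum_vector = 0"
  "vop a (pole (- n) ^ Suc k) vacuum_vector = dpow vderiv (int k) (vshift n a)"
proof -
  show "vop a (of_poly p) vacuum_vector = 0"
    unfolding vop_def by (rule pair_of_poly_0) (rule field_of_creation(1))
  have "vop a (pole (- n) ^ Suc k) vacuum_vector = field_of (vshift n a) (- 1 - int k) vacuum_vector"
    unfolding vop_def by (rule pair_pole_power) (rule field_of_creation(1))
  then show "vop a (pole (- n) ^ Suc k) vacuum_vector = dpow vderiv (int k) (vshift n a)"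
    by (simp only: field_of_creation(2))
qed

lemma vop_current: "vop (current X inv_tau vacuum_vector) F = current X F"
proof
  fix v
  show "vop (current X inv_tau vacuum_vector) F v = current X F v"
    unfolding vop_def field_of_vshift field_of_current conj_cmode current_cmode[of X F v] by simp
qed

lemma vop_shift: "vop a (shift n F) = vop (vshift (- n) a) (F :: kfun)"
proof
  fix b
  show "vop a (shift n F) b = vop (vshift (- n) a) F b"
    unfolding vop_def by (simp add: pair_shift field_of_family vshift_vshift)
qed

lemma clinear_state_act: "clinear (\<lambda>h. V.state_act h f)" "clinear (V.state_act h)"
  by (rule clinearI; simp add: V.state_act_def clinear_add[OF clinear_antipode] clinear_scale[OF clinear_antipode]
      clinear_add[OF clinear_hact] clinear_scale[OF clinear_hact]
      clinear_add[OF clinear_vop(1)] clinear_scale[OF clinear_vop(1)]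
      clinear_add[OF clinear_vop(3)] clinear_scale[OF clinear_vop(3)])+

lemma state_act_single:
  "V.state_act (Poly_Mapping.single (n, k) 1) f = fact k *\<^sub>C dpow vderiv (int k) (vshift n f)"
  by (simp only: V.state_act_def hact_antipode_single clinear_scale[OF clinear_vop(1)] vop_creation)

lemma vop_covariant:
  assumes "h \<in> H_T"
  shows "vop f (hact (antipode h) F) = vop (V.state_act h f) F"
  using assms unfolding H_T_def
proof (induction rule: complex_vector.span_induct_alt)
  case base
  then show ?case
    by (simp add: clinear_zero[OF clinear_antipode] clinear_zero[OF clinear_hact]
        clinear_zero[OF clinear_state_act(1)] fun_eq_iff clinear_zero[OF clinear_vop(1)] clinear_zero[OF clinear_vop(3)])
next
  case (step c x y)
  obtain n where x: "x = Tpow n" using step(1) by blast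
  have "vop f (hact (antipode x) F) = vop (V.state_act x f) F"
    by (simp add: x Tpow_def antipode_single hact_def lin_ext_single scaleC_one vop_shift state_act_single dpow_def)
  then show ?case
    using step(2)
    by (simp add: fun_eq_iff clinear_add[OF clinear_antipode] clinear_scale[OF clinear_antipode]
        clinear_add[OF clinear_hact] clinear_scale[OF clinear_hact]
        clinear_add[OF clinear_state_act(1)] clinear_scale[OF clinear_state_act(1)]
        clinear_add[OF clinear_vop(1)] clinear_scale[OF clinear_vop(1)]
        clinear_add[OF clinear_vop(3)] clinear_scale[OF clinear_vop(3)])
qed

subsection \<open>Mutual rationality\<close>

lemma local_conj:
  assumes "local N A B" 
  shows "local N (conj n A) (conj n B)"
  unfolding local_def
proof (intro allI)
  fix c p
  let ?T = "\<lambda>(i, j). A i (B j (vshift (- n) c)) - B j (A i (vshift (- n) c))"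
  have "(\<lambda>(i, j). conj n A i (conj n B j c) - conj n B j (conj n A i c)) = (\<lambda>p. vshift n (?T p))"
    by (auto simp: conj_def vshift_vshift vshift_0 clinear_diff[OF clinear_vshift])
  moreover have "(dsh (1, 0) (0, 1) ^^ N) ?T p = 0" using assms unfolding local_def by blast
  ultimately show "(dsh (1, 0) (0, 1) ^^ N) (\<lambda>(i, j). conj n A i (conj n B j c) - conj n B j (conj n A i c)) p = 0"
    by (simp only: dsh_pow_map[OF clinear_vshift] clinear_zero[OF clinear_vshift])
qed

section \<open>Pairing in two variables and multiplication by differences\<close>

type_synonym 'v dist4 = "int \<Rightarrow> int \<Rightarrow> int \<Rightarrow> int \<Rightarrow> 'v"

definition pair2 :: "'v::complex_vector dist4 \<Rightarrow> kfun \<Rightarrow> kfun \<Rightarrow> 'v"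
  where "pair2 T G G' = pair G (\<lambda>n i. pair G' (T n i))"

text \<open>What the iterated pairing requires: a family in the inner variable for each outer index,
  and a family in the outer variable for each inner argument.\<close>

definition laurent_family2 :: "'v::complex_vector dist4 \<Rightarrow> bool"
  where "laurent_family2 T \<longleftrightarrow>
    (\<forall>n i. laurent_family (T n i)) \<and> (\<forall>G'. laurent_family (\<lambda>n i. pair G' (T n i)))"

lemma conv_tau:
  assumes "laurent_family w"
  shows "conv tau w = (\<lambda>n m. w n (m + 1) + of_int n *\<^sub>C w n m)"
proof (intro ext)
  fix n m
  have loc: "loc tau n = fls_const (of_int n) + fls_X"
    unfolding loc_of_poly using loc_poly_linear[of n 0] by simp
  have "conv tau w n m = (\<Sum>l\<in>{0, 1}. cf tau n l *\<^sub>C w n (l + m))"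
    by (rule conv_superset) (auto simp: loc split: if_splits)
  then show "conv tau w n m = w n (m + 1) + of_int n *\<^sub>C w n m"
    by (simp add: loc scaleC_one add.commute)
qed

text \<open>Multiplication by \<open>\<tau>\<^sub>1 - \<tau>\<^sub>2 - q\<close> in local coordinates at \<open>(n, m)\<close>.\<close>

definition dop :: "int \<Rightarrow> 'v::complex_vector dist4 \<Rightarrow> 'v dist4"
  where "dop q T = (\<lambda>n i m j. T n (i + 1) m j - T n i m (j + 1) + of_int (n - m - q) *\<^sub>C T n i m j)"

lemma pair2_dop:
  assumes T: "laurent_family2 T"
  shows "laurent_family2 (dop q T)"
    and "pair2 (dop q T) G G' = pair2 T (tau * G) G' - pair2 T G (tau * G') - of_int q *\<^sub>C pair2 T G G'"
proof -
  have L: "laurent_family (T n i)" "laurent_family (\<lambda>n i. pair G' (T n i))" for n i G'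
    using T unfolding laurent_family2_def by blast+
  define T1 where "T1 = (\<lambda>n i m j. T n (i + 1) m j + of_int n *\<^sub>C T n i m j)"
  define T2 where "T2 = (\<lambda>n i m j. T n i m (j + 1) + of_int m *\<^sub>C T n i m j)"
  have T2: "T2 n i = conv tau (T n i)" for n i
    unfolding conv_tau[OF L(1)] T2_def ..
  have l1: "laurent_family (T1 n i)" for n i
    unfolding T1_def by (intro laurent_family_add laurent_family_scale L)
  have l2: "laurent_family (T2 n i)" for n i
    unfolding T2 by (rule laurent_family_conv[OF L(1)])
  have p1: "(\<lambda>n i. pair G' (T1 n i)) = conv tau (\<lambda>n i. pair G' (T n i))" for G'
    unfolding conv_tau[OF L(2)] T1_def
    by (simp add: pair_add_right pair_scale_right laurent_family_scale L)
  have p2: "pair G' (T2 n i) = pair (tau * G') (T n i)" for G' n i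
    unfolding T2 by (rule pair_mult[OF L(1), symmetric])
  have D: "dop q T n i = (\<lambda>m j. T1 n i m j - T2 n i m j - of_int q *\<^sub>C T n i m j)" for n i
    by (simp add: dop_def T1_def T2_def fun_eq_iff complex_vector.scale_left_diff_distrib)
  have pD: "pair G' (dop q T n i) = pair G' (T1 n i) - pair G' (T2 n i) - of_int q *\<^sub>C pair G' (T n i)" for G' n i
    unfolding D by (simp add: pair_diff_right pair_scale_right laurent_family_diff laurent_family_scale l1 l2 L)
  have lp1: "laurent_family (\<lambda>n i. pair G' (T1 n i))" for G'
    unfolding p1 by (rule laurent_family_conv[OF L(2)])
  have lp2: "laurent_family (\<lambda>n i. pair G' (T2 n i))" for G'
    unfolding p2 by (rule L(2))
  show "laurent_family2 (dop q T)"
    unfolding laurent_family2_def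
  proof (intro conjI allI)
    show "laurent_family (dop q T n i)" for n i
      unfolding D by (intro laurent_family_diff laurent_family_scale l1 l2 L)
    show "laurent_family (\<lambda>n i. pair G' (dop q T n i))" for G'
      unfolding pD by (intro laurent_family_diff laurent_family_scale lp1 lp2 L)
  qed
  have "pair2 (dop q T) G G' = pair G (\<lambda>n i. pair G' (T1 n i)) - pair G (\<lambda>n i. pair G' (T2 n i))
      - of_int q *\<^sub>C pair2 T G G'"
    unfolding pair2_def pD
    by (simp add: pair_diff_right pair_scale_right laurent_family_diff laurent_family_scale lp1 lp2 L)
  then show "pair2 (dop q T) G G' = pair2 T (tau * G) G' - pair2 T G (tau * G') - of_int q *\<^sub>C pair2 T G G'"
    unfolding p1 pair_mult[OF L(2), symmetric] p2 unfolding pair2_def .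
qed

lemma cbilinear_pair2:
  assumes "laurent_family2 T"
  shows "cbilinear (pair2 T)"
proof -
  have L: "laurent_family (T n i)" "laurent_family (\<lambda>n i. pair G' (T n i))" for n i G'
    using assms unfolding laurent_family2_def by blast+
  show ?thesis
    unfolding pair2_def
    by (rule cbilinearI)
       (simp_all add: pair_add_left pair_scale_left pair_add_right pair_scale_right L)
qed

lemma tensor_lift_pair2_dop:
  assumes T: "laurent_family2 T"
  shows "tensor_lift (pair2 T) ((tau \<otimes>\<^sub>C 1 - 1 \<otimes>\<^sub>C tau - of_int q *\<^sub>C 1) * t) = tensor_lift (pair2 (dop q T)) t"
proof -
  note b = cbilinear_pair2[OF T] cbilinear_pair2[OF pair2_dop(1)[OF T]]
  note l = clinear_tensor_lift[OF b(1)] clinear_tensor_lift[OF b(2)]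
  show ?thesis
  proof (induct t)
    case (tensor G G')
    have "(tau \<otimes>\<^sub>C 1 - 1 \<otimes>\<^sub>C tau - of_int q *\<^sub>C 1) * (G \<otimes>\<^sub>C G')
        = (tau * G) \<otimes>\<^sub>C G' - G \<otimes>\<^sub>C (tau * G') - of_int q *\<^sub>C (G \<otimes>\<^sub>C G')"
      by (simp add: left_diff_distrib tensor_mult mult_scaleC_left)
    then show ?case
      by (simp only: clinear_diff[OF l(1)] clinear_scale[OF l(1)] tensor_lift_tensor[OF b(1)]
          tensor_lift_tensor[OF b(2)]) (simp only: pair2_dop(2)[OF T])
  qed (simp add: distrib_left clinear_add[OF l(1)] clinear_add[OF l(2)])
qed

lemma poly_at_difference_mult:
  "poly_at_difference ([:of_int (- q), 1:] * F)
    = (tau \<otimes>\<^sub>C 1 - 1 \<otimes>\<^sub>C tau - of_int q *\<^sub>C 1) * poly_at_difference F"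
proof -
  let ?f = "\<lambda>c. c *\<^sub>C (1 :: (kfun, kfun) tensor)"
  let ?x = "tau \<otimes>\<^sub>C 1 - 1 \<otimes>\<^sub>C tau :: (kfun, kfun) tensor"
  have add: "map_poly ?f (p + r) = map_poly ?f p + map_poly ?f r" for p r
    by (rule poly_eqI) (simp add: coeff_map_poly scaleC_add_left)
  have smult: "map_poly ?f (smult c p) = smult (?f c) (map_poly ?f p)" for c p
    by (rule poly_eqI) (simp add: coeff_map_poly mult_scaleC_left)
  have pCons: "map_poly ?f (pCons 0 F) = pCons 0 (map_poly ?f F)"
    by (rule poly_eqI) (simp add: coeff_map_poly coeff_pCons split: nat.split)
  have eq: "[:of_int (- q), 1:] * F = smult (of_int (- q)) F + pCons 0 F" by simp
  have "poly_at_difference ([:of_int (- q), 1:] * F)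
      = ?f (of_int (- q)) * poly (map_poly ?f F) ?x + ?x * poly (map_poly ?f F) ?x"
    unfolding poly_at_difference_def eq add smult pCons by simp
  then show ?thesis
    unfolding poly_at_difference_def by (simp add: algebra_simps)
qed

lemma poly_at_difference_1: "poly_at_difference 1 = 1"
  by (simp add: poly_at_difference_def scaleC_one)

definition denom :: "int list \<Rightarrow> complex poly"
  where "denom qs = foldr (\<lambda>q F. [:of_int (- q), 1:] * F) qs 1"

lemma denom_in_int_denoms: "denom qs \<in> int_denoms"
  unfolding denom_def by (induction qs) (simp_all add: int_denoms.intros del: mult_pCons_left of_int_minus)

text \<open>Multiplication by the polynomial in the difference of the variables is transposed to the
  coefficients, one linear factor at a time.\<close>

lemma tensor_lift_denom:
  assumes "laurent_family2 T"
  shows "tensor_lift (pair2 T) (poly_at_difference (denom qs) * t) = tensor_lift (pair2 (fold dop qs T)) t"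
  using assms
proof (induction qs arbitrary: T)
  case Nil
  then show ?case by (simp add: denom_def poly_at_difference_1)
next
  case (Cons q qs)
  have "denom (q # qs) = [:of_int (- q), 1:] * denom qs" by (simp add: denom_def)
  then have "poly_at_difference (denom (q # qs)) * t
      = (tau \<otimes>\<^sub>C 1 - 1 \<otimes>\<^sub>C tau - of_int q *\<^sub>C 1) * (poly_at_difference (denom qs) * t)"
    by (simp only: poly_at_difference_mult mult.assoc)
  then show ?case
    by (simp only: tensor_lift_pair2_dop[OF Cons.prems] Cons.IH[OF pair2_dop(1)[OF Cons.prems]] fold.simps comp_apply)
qed

text \<open>At the pair (n, m) the factor with root q is the difference of the local coordinates
  plus the constant n - m - q. For q = n - m it uses up one order of locality; the other factors
  commute with \<open>dsh\<close> and preserve the vanishing.\<close>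

lemma fold_dop_eq_0:
  assumes "\<And>p. (dsh (1, 0) (0, 1) ^^ k) (\<lambda>(i, j). T n i m j) p = 0" "k \<le> count_list qs (n - m)"
  shows "fold dop qs T n i m j = 0"
  using assms
proof (induction qs arbitrary: T k)
  case Nil
  from Nil.prems(1)[of "(i, j)"] Nil.prems(2) show ?case by simp
next
  case (Cons q qs)
  let ?f = "\<lambda>(i, j). T n i m j" and ?d = "dsh (1, 0) (0, 1)"
  have d: "(\<lambda>(i, j). dop q T n i m j) = (\<lambda>p. ?d ?f p + of_int (n - m - q) *\<^sub>C ?f p)"
    by (auto simp: dop_def dsh_def)
  have 0: "(?d ^^ k) ?f = (\<lambda>p. 0)" using Cons.prems(1) by blast
  have s: "clinear (\<lambda>x. of_int (n - m - q) *\<^sub>C x)" by (rule clinear_scaleC)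
  show ?case
  proof (cases "q = n - m")
    case True
    have d': "(\<lambda>(i, j). dop q T n i m j) = ?d ?f"
      unfolding d by (simp add: True)
    \<comment> \<open>For k = 0 the truncated exponent is 0, and \<open>?f\<close> itself already
      vanishes.\<close>
    have "(?d ^^ (k - 1)) (?d ?f) p = 0" for p
    proof (cases k)
      case 0
      then have "?f = (\<lambda>p. 0)" using \<open>(?d ^^ k) ?f = (\<lambda>p. 0)\<close> by simp
      then show ?thesis unfolding 0 by (simp add: dsh_def)
    next
      case (Suc k')
      then show ?thesis using 0 by (simp only: funpow_Suc_right comp_apply diff_Suc_1)
    qed
    then have "(?d ^^ (k - 1)) (\<lambda>(i, j). dop q T n i m j) p = 0" for p
      by (simp only: d')
    then have "fold dop qs (dop q T) n i m j = 0"
      by (rule Cons.IH) (use Cons.prems(2) True in simp)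
    then show ?thesis by simp
  next
    case False
    have "(?d ^^ k) (?d ?f) = ?d ((?d ^^ k) ?f)"
      by (rule funpow_swap1[symmetric])
    moreover have "(?d ^^ k) (\<lambda>p. of_int (n - m - q) *\<^sub>C ?f p) = (\<lambda>p. of_int (n - m - q) *\<^sub>C (?d ^^ k) ?f p)"
      by (rule dsh_pow_map[OF s])
    ultimately have "(?d ^^ k) (\<lambda>(i, j). dop q T n i m j) p = 0" for p
      unfolding d dsh_pow_add_fun 0 by (simp add: dsh_def)
    then have "fold dop qs (dop q T) n i m j = 0"
      by (rule Cons.IH) (use Cons.prems(2) False in \<open>simp split: if_splits\<close>)
    then show ?thesis by simp
  qed
qed

lemma count_list_concat_replicate:
  "x \<in> set xs \<Longrightarrow> N \<le> count_list (concat (replicate N xs)) x"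
proof (induction N)
  case (Suc N)
  then have "count_list xs x \<noteq> 0" by (simp add: count_list_0_iff)
  with Suc show ?case by simp
qed simp

lemma vop_mutually_rational: "mutually_rational (vop a) (vop b)"
proof -
  obtain N K where NK: "\<And>n. local N (conj n (field_of a)) (field_of b)"
    "\<And>n. \<bar>n\<bar> > K \<Longrightarrow> local 0 (conj n (field_of a)) (field_of b)"
    by (rule state_field_local_uniform[OF state_field_field_of state_field_field_of]) (rule that)
  \<comment> \<open>The roots of the polynomial: each integer of the window with multiplicity
    \<open>N\<close>. A pair (n, m) uses the root n - m, and pairs further apart than
    \<open>K\<close> commute outright.\<close>
  define qs where "qs = concat (replicate N [- K..K])"
  have loc: "\<exists>k \<le> count_list qs (n - m). local k (field_of (vshift n a)) (field_of (vshift m b))" for n m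
  proof -
    \<comment> \<open>A simultaneous translation reduces the pair (n, m) to (n - m, 0), for which
      the bounds were chosen.\<close>
    have e: "field_of (vshift n a) = conj m (conj (n - m) (field_of a))"
      unfolding field_of_vshift[symmetric] by (simp add: vshift_vshift)
    show ?thesis
    proof (cases "\<bar>n - m\<bar> > K")
      case True
      from local_conj[OF NK(2)[OF this], of m] show ?thesis
        unfolding e by (intro exI[of _ 0]) (simp add: field_of_vshift)
    next
      case False
      then have "N \<le> count_list qs (n - m)"
        unfolding qs_def by (intro count_list_concat_replicate) auto
      moreover have "local N (field_of (vshift n a)) (field_of (vshift m b))"
        using local_conj[OF NK(1)[of "n - m"], of m] unfolding e field_of_vshift[of m b] .
      ultimately show ?thesis by blast
    qed
  qed
  have "tensor_lift (\<lambda>G G'. vop a G (vop b G' c) - vop b G' (vop a G c)) (poly_at_difference (denom qs) * t) = 0"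
    for t c
  proof -
    define T where "T = (\<lambda>n i m j. field_of (vshift n a) i (field_of (vshift m b) j c)
      - field_of (vshift m b) j (field_of (vshift n a) i c))"
    have p: "pair G' (T n i) = field_of (vshift n a) i (vop b G' c) - vop b G' (field_of (vshift n a) i c)"
      for G' n i
      unfolding T_def vop_def
      by (simp only: pair_diff_right[OF laurent_family_comp[OF clinear_field_of(1) field_of_family] field_of_family]
          pair_map[OF clinear_field_of(1) field_of_family])
    have T: "laurent_family2 T"
      unfolding laurent_family2_def p unfolding T_def
      by (intro conjI allI laurent_family_diff laurent_family_comp[OF clinear_field_of(1)]
          laurent_family_comp[OF clinear_vop(2)] field_of_family)
    have "pair2 T = (\<lambda>G G'. vop a G (vop b G' c) - vop b G' (vop a G c))"
    proof (intro ext)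
      fix G G'
      show "pair2 T G G' = vop a G (vop b G' c) - vop b G' (vop a G c)"
        unfolding pair2_def p
        by (simp only: pair_diff_right[OF field_of_family laurent_family_comp[OF clinear_vop(2) field_of_family]]
            pair_map[OF clinear_vop(2) field_of_family] vop_def[symmetric])
    qed
    moreover have "fold dop qs T n i m j = 0" for n i m j
    proof -
      obtain k where k: "k \<le> count_list qs (n - m)" "local k (field_of (vshift n a)) (field_of (vshift m b))"
        using loc by blast
      show ?thesis
      proof (rule fold_dop_eq_0[OF _ k(1)])
        show "(dsh (1, 0) (0, 1) ^^ k) (\<lambda>(i, j). T n i m j) p = 0" for p
          using k(2) unfolding local_def T_def by blast
      qed
    qed
    then have "fold dop qs T = (\<lambda>n i m j. 0)" by blast
    then have "tensor_lift (pair2 (fold dop qs T)) t = 0"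
      by (simp add: tensor_lift_def lin_ext_def pair2_def pair_def case_prod_beta)
    ultimately show ?thesis using tensor_lift_denom[OF T, of qs t] by simp
  qed
  then show ?thesis
    unfolding mutually_rational_def using denom_in_int_denoms by blast
qed


subsection \<open>Skew-symmetry\<close>

text \<open>
  The Laurent coefficients of \<open>\<R>\<^sub>V(\<tau>) D\<close> for a distribution \<open>D\<close> with Laurent coefficients \<open>w\<close>;
  near \<open>n\<close>, \<open>\<R>\<^sub>V(\<tau>)\<close> is \<open>T\<^sup>n exp ((\<tau> - n) \<partial>)\<close>. Terms with \<open>p < m\<close> vanish by the convention for \<open>dpow\<close>.
\<close>

definition rop :: "(int \<Rightarrow> int \<Rightarrow> 'g::complex_lie_algebra vacuum_module) \<Rightarrow> int \<Rightarrow> int \<Rightarrow> 'g vacuum_module"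
  where "rop w n m = (\<Sum>p | m \<le> p \<and> w n p \<noteq> 0. dpow vderiv (p - m) (vshift n (w n p)))"

lemma dpow_negative: "k < 0 \<Longrightarrow> dpow D k x = 0"
  by (simp add: dpow_def)

lemma clinear_dpow: "clinear D \<Longrightarrow> clinear (dpow D k)"
proof -
  assume D: "clinear D"
  have "(D ^^ n) (x + y) = (D ^^ n) x + (D ^^ n) y" "(D ^^ n) (c *\<^sub>C x) = c *\<^sub>C (D ^^ n) x" for n x y c
    by (induction n) (simp_all add: clinear_add[OF D] clinear_scale[OF D])
  then show ?thesis
    by (intro clinearI) (simp_all add: dpow_def scaleC_add_right mult.commute)
qed

lemma rop_superset:
  assumes "finite A" "\<And>p. m \<le> p \<Longrightarrow> w n p \<noteq> 0 \<Longrightarrow> p \<in> A"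
  shows "rop w n m = (\<Sum>p\<in>A. dpow vderiv (p - m) (vshift n (w n p)))"
  unfolding rop_def
proof (rule sum.mono_neutral_left[OF assms(1)])
  show "{p. m \<le> p \<and> w n p \<noteq> 0} \<subseteq> A" using assms(2) by blast
  show "\<forall>p\<in>A - {p. m \<le> p \<and> w n p \<noteq> 0}. dpow vderiv (p - m) (vshift n (w n p)) = 0"
  proof
    fix p assume "p \<in> A - {p. m \<le> p \<and> w n p \<noteq> 0}"
    then consider "p - m < 0" | "w n p = 0" by force
    then show "dpow vderiv (p - m) (vshift n (w n p)) = 0"
      by cases (simp_all add: dpow_negative clinear_zero[OF clinear_vshift] dpow_zero[OF clinear_vderiv])
  qed
qed

lemma rop_nonzeroE:
  assumes "rop w n m \<noteq> 0"
  obtains p where "m \<le> p" "w n p \<noteq> 0"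
proof (rule ccontr)
  assume "\<not> thesis"
  then have "{p. m \<le> p \<and> w n p \<noteq> 0} = {}" using that by blast
  then show False using assms unfolding rop_def by (simp only: sum.empty simp_thms)
qed

lemma laurent_family_rop:
  assumes "laurent_family w"
  shows "laurent_family (rop w)"
proof -
  obtain N where N: "N \<ge> 0" "\<And>n m. w n m \<noteq> 0 \<Longrightarrow> m \<ge> 0 \<Longrightarrow> \<bar>n\<bar> \<le> N"
    "\<And>n m. w n m \<noteq> 0 \<Longrightarrow> m \<le> N" by (rule laurent_familyE[OF assms]) (rule that)
  show ?thesis
  proof (rule laurent_familyI[where N = N and N' = N])
    fix n m :: int assume "m \<ge> 0" "rop w n m \<noteq> 0"
    then obtain p where "m \<le> p" "w n p \<noteq> 0" by (elim rop_nonzeroE)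
    then show "m \<le> N \<and> \<bar>n\<bar> \<le> N" using N(2,3)[of n p] \<open>m \<ge> 0\<close> by simp
  qed
qed

lemma rop_add:
  assumes "laurent_family w" "laurent_family w'"
  shows "rop (\<lambda>n m. w n m + w' n m) n m = rop w n m + rop w' n m"
proof -
  obtain N where N: "N \<ge> 0" "\<And>n m. w n m \<noteq> 0 \<Longrightarrow> m \<ge> 0 \<Longrightarrow> \<bar>n\<bar> \<le> N"
    "\<And>n m. w n m \<noteq> 0 \<Longrightarrow> m \<le> N" by (rule laurent_familyE[OF assms(1)]) (rule that)
  obtain N' where N': "N' \<ge> 0" "\<And>n m. w' n m \<noteq> 0 \<Longrightarrow> m \<ge> 0 \<Longrightarrow> \<bar>n\<bar> \<le> N'"
    "\<And>n m. w' n m \<noteq> 0 \<Longrightarrow> m \<le> N'" by (rule laurent_familyE[OF assms(2)]) (rule that)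
  let ?A = "{m..max N N'}"
  have A: "p \<in> ?A" if "m \<le> p" "w n p \<noteq> 0 \<or> w' n p \<noteq> 0" for p
    using that N(3)[of n p] N'(3)[of n p] by auto
  have "rop w n m = (\<Sum>p\<in>?A. dpow vderiv (p - m) (vshift n (w n p)))"
    "rop w' n m = (\<Sum>p\<in>?A. dpow vderiv (p - m) (vshift n (w' n p)))"
    by (rule rop_superset[OF finite_atLeastAtMost_int]; use A in blast)+
  moreover have "rop (\<lambda>n m. w n m + w' n m) n m = (\<Sum>p\<in>?A. dpow vderiv (p - m) (vshift n (w n p + w' n p)))"
  proof (rule rop_superset[OF finite_atLeastAtMost_int])
    fix p assume "m \<le> p" "w n p + w' n p \<noteq> 0"
    then show "p \<in> ?A" using A[of p] by (cases "w n p = 0") auto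
  qed
  ultimately show ?thesis
    by (simp add: clinear_add[OF clinear_vshift] clinear_add[OF clinear_dpow[OF clinear_vderiv]] sum.distrib)
qed

text \<open>The Laurent coefficients of the rational function \<open>F v\<close>.\<close>

definition kernel_family :: "'w::complex_vector \<times> kfun \<Rightarrow> int \<Rightarrow> int \<Rightarrow> 'w"
  where "kernel_family x n m = cf (snd x) n (- 1 - m) *\<^sub>C fst x"

lemma laurent_family_cf: "laurent_family (\<lambda>n m. cf F n (- 1 - m))"
proof -
  obtain N where N: "N \<ge> 0" "\<And>n m. cf F n m \<noteq> 0 \<Longrightarrow> - N \<le> m"
    "\<And>n m. cf F n m \<noteq> 0 \<Longrightarrow> m < 0 \<Longrightarrow> \<bar>n\<bar> \<le> N" by (rule cf_boundedE[of F]) (rule that)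
  show ?thesis
  proof (rule laurent_familyI[where N = N and N' = N])
    fix n m :: int assume "m \<ge> 0" "cf F n (- 1 - m) \<noteq> 0"
    then show "m \<le> N \<and> \<bar>n\<bar> \<le> N" using N(2,3)[of n "- 1 - m"] by simp
  qed
qed

lemma kernel_family:
  "laurent_family (kernel_family x)" "pair G (kernel_family x) = Tr (snd x * G) *\<^sub>C fst x"
proof -
  have L: "clinear (\<lambda>z. z *\<^sub>C fst x)" by (rule clinearI) (simp_all add: scaleC_add_left scaleC_complex_def)
  have k: "kernel_family x = (\<lambda>n m. cf (snd x) n (- 1 - m) *\<^sub>C fst x)"
    by (simp add: kernel_family_def fun_eq_iff)
  show "laurent_family (kernel_family x)"
    unfolding k by (rule laurent_family_comp[OF L laurent_family_cf])
  show "pair G (kernel_family x) = Tr (snd x * G) *\<^sub>C fst x"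
    unfolding k by (simp only: pair_map[OF L laurent_family_cf] mult.commute[of "snd x"] Tr_mult)
qed

definition kernels_family :: "('w::complex_vector \<times> kfun) list \<Rightarrow> int \<Rightarrow> int \<Rightarrow> 'w"
  where "kernels_family ws n m = (\<Sum>x\<leftarrow>ws. kernel_family x n m)"

lemma kernels_family_Cons: "kernels_family (x # ws) = (\<lambda>n m. kernel_family x n m + kernels_family ws n m)"
  by (simp add: kernels_family_def fun_eq_iff)

lemma kernels_family:
  "laurent_family (kernels_family ws)"
  "pair G (kernels_family ws) = (\<Sum>(v, F)\<leftarrow>ws. Tr (F * G) *\<^sub>C v)"
proof -
  have N: "kernels_family [] = (\<lambda>n m. 0)" by (simp add: kernels_family_def fun_eq_iff)
  show l: "laurent_family (kernels_family ws)" for ws :: "('a \<times> kfun) list"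
  proof (induction ws)
    case Nil
    show ?case unfolding N by (rule laurent_family_singular) simp
  qed (simp add: kernels_family_Cons laurent_family_add kernel_family)
  show "pair G (kernels_family ws) = (\<Sum>(v, F)\<leftarrow>ws. Tr (F * G) *\<^sub>C v)"
    by (induction ws)
       (simp_all add: N kernels_family_Cons pair_add_right kernel_family l case_prod_beta, simp add: pair_def)
qed

section \<open>The two parts of the R-operator on Laurent coefficients\<close>

lemma R_V_eq: "V.R_V v = (\<lambda>F. vop v F vacuum_vector)"
  unfolding V.R_V_def
  by (rule sing_map_eqI[OF clinear_vop(1) vop_creation(1) clinear_state_act(1)])
     (simp only: state_act_single vop_creation(2))

text \<open>Near n the distribution R(v) is exp((tau - n) D) T^n v, whose coefficients are
  \<open>u\<close>. Multiplying the vector v by the expansion of F before or after applying this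
  operator gives the same series.\<close>

lemma pair_rop_kernel_family: "pair G (rop (kernel_family x)) = V.R_V (fst x) (snd x * G)"
proof -
  obtain v F where x: "x = (v, F)" by (cases x)
  define u where "u n m = field_of (vshift n v) m vacuum_vector" for n m
  have u: "u n m = dpow vderiv (- 1 - m) (vshift n v)" for n m
  proof (cases "m \<ge> 0")
    case False
    define k where "k = nat (- 1 - m)"
    have "m = - 1 - int k" "- 1 - m = int k" using False by (simp_all add: k_def)
    then show ?thesis using field_of_creation(2)[of "vshift n v" k] by (simp only: u_def)
  qed (simp add: u_def field_of_creation dpow_negative)
  have "conv F u n m = rop (kernel_family x) n m" for n m
  proof -
    have "conv F u n m = (\<Sum>p | m \<le> p \<and> kernel_family x n p \<noteq> 0. cf F n (- 1 - p) *\<^sub>C u n (- 1 - p + m))"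
    proof -
      \<comment> \<open>The substitution l = -1 - p passes from the exponent of the local coordinate
        to the index of the corresponding coefficient in a family.\<close>
      have "conv F u n m = (\<Sum>l\<in>(\<lambda>p. - 1 - p) ` {p. m \<le> p \<and> kernel_family x n p \<noteq> 0}. cf F n l *\<^sub>C u n (l + m))"
      proof (rule conv_superset)
        obtain N where N: "N \<ge> 0" "\<And>n m. cf F n m \<noteq> 0 \<Longrightarrow> - N \<le> m"
          "\<And>n m. cf F n m \<noteq> 0 \<Longrightarrow> m < 0 \<Longrightarrow> \<bar>n\<bar> \<le> N" by (rule cf_boundedE[of F]) (rule that)
        have "{p. m \<le> p \<and> kernel_family x n p \<noteq> 0} \<subseteq> {m..N}"
          using N(2)[of n "- 1 - _"] by (force simp: kernel_family_def x)
        then show "finite ((\<lambda>p. - 1 - p) ` {p. m \<le> p \<and> kernel_family x n p \<noteq> 0})"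
          by (intro finite_imageI) (rule finite_subset, assumption, simp)
        fix l assume l: "cf F n l \<noteq> 0" "u n (l + m) \<noteq> 0"
        have "m \<le> - 1 - l"
          using l(2) unfolding u by (rule contrapos_np) (simp add: dpow_negative)
        moreover have "v \<noteq> 0"
          using l(2) unfolding u by (auto simp: clinear_zero[OF clinear_vshift] dpow_zero[OF clinear_vderiv])
        ultimately show "l \<in> (\<lambda>p. - 1 - p) ` {p. m \<le> p \<and> kernel_family x n p \<noteq> 0}"
          using l(1) by (intro image_eqI[of _ _ "- 1 - l"]) (simp_all add: kernel_family_def x)
      qed
      then show ?thesis by (simp add: sum.reindex inj_on_def)
    qed
    also have "\<dots> = rop (kernel_family x) n m"
      unfolding rop_def
      by (intro sum.cong refl) (simp add: u kernel_family_def x clinear_scale[OF clinear_vshift]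
          clinear_scale[OF clinear_dpow[OF clinear_vderiv]])
    finally show ?thesis .
  qed
  then have "conv F u = rop (kernel_family x)" by blast
  moreover have "u = (\<lambda>n m. field_of (vshift n v) m vacuum_vector)" by (simp add: u_def fun_eq_iff)
  ultimately show ?thesis
    by (simp add: R_V_eq x vop_def pair_mult[OF field_of_family])
qed

lemma pair_rop_kernels_family: "pair G (rop (kernels_family ws)) = (\<Sum>(v, F)\<leftarrow>ws. V.R_V v (F * G))"
proof (induction ws)
  case Nil
  have 0: "rop (kernels_family []) = (\<lambda>n m. 0)" by (simp add: rop_def kernels_family_def fun_eq_iff)
  show ?case unfolding 0 by (simp add: pair_def)
next
  case (Cons x ws)
  have "rop (kernels_family (x # ws)) = (\<lambda>n m. rop (kernel_family x) n m + rop (kernels_family ws) n m)"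
    unfolding kernels_family_Cons by (intro ext rop_add kernel_family kernels_family)
  then show ?case
    using Cons.IH by (simp add: pair_add_right laurent_family_rop kernel_family kernels_family
        pair_rop_kernel_family case_prod_beta)
qed

text \<open>On the monomial T^n d^k the coproduct formula becomes a Leibniz sum, and after division
  by k! this is the coefficient of exp((tau - n) D) T^n applied to a series without coefficients of
  nonnegative index.\<close>

lemma R_hol_eq:
  assumes D: "clinear D" and h0: "\<And>n m. m \<ge> 0 \<Longrightarrow> h n m = 0"
    and h: "\<And>n k. D (pole (- n) ^ Suc k) = h n (- 1 - int k)"
  shows "V.R_hol D = (\<lambda>G. pair G (rop h))"
  unfolding V.R_hol_def
proof (rule sing_map_eqI)
  have l: "laurent_family h" by (rule laurent_family_singular[OF h0])
  show "clinear (\<lambda>G. pair G (rop h))" by (rule clinear_pair[OF laurent_family_rop[OF l]])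
  have rop0: "rop h n m = 0" if "m \<ge> 0" for n m
  proof -
    have "{p. m \<le> p \<and> h n p \<noteq> 0} = {}" using h0 that by force
    then show ?thesis unfolding rop_def by (simp only: sum.empty)
  qed
  show "pair (of_poly p) (rop h) = 0" for p by (rule pair_of_poly_0[OF rop0])
  let ?b = "\<lambda>h' h''. V.state_act h' (D (hact (antipode h'') inv_tau))"
  have b: "cbilinear ?b"
    by (intro cbilinearI)
       (simp_all add: clinear_add[OF clinear_state_act(1)] clinear_scale[OF clinear_state_act(1)]
         clinear_add[OF clinear_state_act(2)] clinear_scale[OF clinear_state_act(2)]
         clinear_add[OF D] clinear_scale[OF D] clinear_add[OF clinear_antipode] clinear_scale[OF clinear_antipode]
         clinear_add[OF clinear_hact] clinear_scale[OF clinear_hact])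
  have c: "clinear coproduct" unfolding coproduct_def by (rule clinear_lin_ext)
  note t = clinear_tensor_lift[OF b]
  show "clinear (\<lambda>h. tensor_lift ?b (coproduct h))"
    by (rule clinearI) (simp_all add: clinear_add[OF c] clinear_scale[OF c] clinear_add[OF t] clinear_scale[OF t])
  fix n k
  have "tensor_lift ?b (coproduct (Poly_Mapping.single (n, k) 1))
      = (\<Sum>i\<le>k. of_nat (k choose i) *\<^sub>C ?b (Poly_Mapping.single (n, i) 1) (Poly_Mapping.single (n, k - i) 1))"
    unfolding coproduct_single clinear_sum[OF t] clinear_scale[OF t] tensor_lift_tensor[OF b] ..
  also have "\<dots> = (\<Sum>i\<le>k. fact k *\<^sub>C dpow vderiv (int i) (vshift n (h n (- 1 - int (k - i)))))"
  proof (rule sum.cong[OF refl])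
    fix i assume "i \<in> {..k}"
    \<comment> \<open>The factorials come from the state action of one tensor factor and from S(h)
      1/tau of the other; with the binomial coefficient they make up the k! on the left.\<close>
    then have "fact i * fact (k - i) * (k choose i) = (fact k :: nat)"
      by (intro binomial_fact_lemma) simp
    then have "of_nat (fact i * fact (k - i) * (k choose i)) = (of_nat (fact k) :: complex)"
      by (rule arg_cong)
    then have "of_nat (k choose i) * (fact i * fact (k - i)) = (fact k :: complex)"
      by (simp only: of_nat_mult of_nat_fact mult_ac)
    then show "of_nat (k choose i) *\<^sub>C ?b (Poly_Mapping.single (n, i) 1) (Poly_Mapping.single (n, k - i) 1)
        = fact k *\<^sub>C dpow vderiv (int i) (vshift n (h n (- 1 - int (k - i))))"
      by (simp only: hact_antipode_single clinear_scale[OF D] h state_act_single clinear_scale[OF clinear_vshift]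
          clinear_scale[OF clinear_dpow[OF clinear_vderiv]] scaleC_scaleC)
  qed
  also have "\<dots> = fact k *\<^sub>C rop h n (- 1 - int k)"
  proof -
    have "rop h n (- 1 - int k)
        = (\<Sum>p\<in>{- 1 - int k..- 1}. dpow vderiv (p - (- 1 - int k)) (vshift n (h n p)))"
    proof (rule rop_superset)
      fix p assume "- 1 - int k \<le> p" "h n p \<noteq> 0"
      then show "p \<in> {- 1 - int k..- 1}" using h0[of p n] by (cases "p \<ge> 0") auto
    qed simp
    also have "\<dots> = (\<Sum>i\<le>k. dpow vderiv (int i) (vshift n (h n (- 1 - int (k - i)))))"
      by (rule sum.reindex_bij_witness[where i = "\<lambda>i. int i - 1 - int k" and j = "\<lambda>p. nat (p + 1 + int k)"])
         (auto simp: nat_le_iff algebra_simps)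
    finally show ?thesis by (simp add: complex_vector.scale_sum_right)
  qed
  finally show "fact k *\<^sub>C pair (pole (- n) ^ Suc k) (rop h) = tensor_lift ?b (coproduct (Poly_Mapping.single (n, k) 1))"
    by (simp only: pair_pole_power[where w = "rop h", OF rop0])
qed

lemma laurent_family_reflect: "laurent_family w \<Longrightarrow> laurent_family (\<lambda>n m. (z m :: complex) *\<^sub>C w (- n) m)"
  and pair_reflect: "pair (reflect F) w = pair F (\<lambda>n m. ((- 1) powi m) *\<^sub>C w (- n) m)"
proof -
  assume w: "laurent_family w"
  obtain N where N: "N \<ge> 0" "\<And>n m. w n m \<noteq> 0 \<Longrightarrow> m \<ge> 0 \<Longrightarrow> \<bar>n\<bar> \<le> N"
    "\<And>n m. w n m \<noteq> 0 \<Longrightarrow> m \<le> N" by (rule laurent_familyE[OF w]) (rule that)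
  show "laurent_family (\<lambda>n m. (z m :: complex) *\<^sub>C w (- n) m)"
  proof (rule laurent_familyI[where N = N and N' = N])
    fix n m :: int assume "m \<ge> 0" "z m *\<^sub>C w (- n) m \<noteq> 0"
    then show "m \<le> N \<and> \<bar>n\<bar> \<le> N" using N(2,3)[of "- n" m] by simp
  qed
next
  show "pair (reflect F) w = pair F (\<lambda>n m. ((- 1) powi m) *\<^sub>C w (- n) m)"
    unfolding pair_def cf_reflect
    by (rule sum.reindex_bij_witness[where i = "\<lambda>(n, m). (- n, m)" and j = "\<lambda>(n, m). (- n, m)"]) auto
qed

lemma vop_skew_symmetry:
  assumes ker: "singular_kernel (V.Y_S g f) ws"
  shows "vop f G g = V.R_apply ws (V.Y_S g f) G"
proof -
  \<comment> \<open>The Laurent coefficients of \<open>V.Y_S g f\<close>. Reflection contributes the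
    sign (-1)^m and the index -n; the minus sign in front of Y accounts for the exponent m +
    1.\<close>
  define w where "w n m = ((- 1) powi (m + 1) :: complex) *\<^sub>C field_of (vshift (- n) g) m f" for n m
  have w_eta: "w = (\<lambda>n m. ((- 1) powi (m + 1) :: complex) *\<^sub>C field_of (vshift (- n) g) m f)"
    by (simp add: w_def fun_eq_iff)
  have lw: "laurent_family w"
    unfolding w_eta by (rule laurent_family_reflect[OF field_of_family])
  have Dw: "V.Y_S g f F = pair F w" for F
  proof -
    have "V.Y_S g f F = - pair F (\<lambda>n m. ((- 1) powi m) *\<^sub>C field_of (vshift (- n) g) m f)"
      unfolding V.Y_S_def vop_def pair_reflect ..
    also have "\<dots> = pair F (\<lambda>n m. - (((- 1) powi m) *\<^sub>C field_of (vshift (- n) g) m f))"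
      by (rule pair_minus_right[OF laurent_family_reflect[OF field_of_family], symmetric])
    also have "(\<lambda>n m. - (((- 1) powi m) *\<^sub>C field_of (vshift (- n) g) m f)) = w"
      by (simp add: w_def fun_eq_iff power_int_add)
    finally show ?thesis .
  qed
  define u where "u = kernels_family ws"
  have lu: "laurent_family u" unfolding u_def by (rule kernels_family)
  define h where "h = (\<lambda>n m. w n m - u n m)"
  have lh: "laurent_family h" unfolding h_def by (rule laurent_family_diff[OF lw lu])
  have w: "w = (\<lambda>n m. u n m + h n m)" by (simp add: h_def)
  \<comment> \<open>On polynomials the kernel reproduces the distribution, so uniqueness leaves
    \<open>h\<close> only negative indices.\<close>
  have "pair (of_poly p) h = 0" for p
    using ker unfolding singular_kernel_def Dw h_def
    by (simp add: pair_diff_right lw lu) (simp add: u_def kernels_family)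
  then have h0: "h n m = 0" if "m \<ge> 0" for n m
    using pair_unique_regular[OF lh _ that] by blast
  have D: "clinear (V.Y_S g f)"
    unfolding Dw[abs_def] by (rule clinear_pair[OF lw])
  \<comment> \<open>By the vanishing of traces on products from \<open>K_sing\<close>, the kernel
    contributes nothing here. Hence \<open>h\<close> records exactly the values of the distribution
    on \<open>K_sing\<close>.\<close>
  have Dh: "V.Y_S g f (pole (- n) ^ Suc k) = h n (- 1 - int k)" for n k
  proof -
    have "pair (pole (- n) ^ Suc k) u = (\<Sum>(v, F)\<leftarrow>ws. Tr (F * pole (- n) ^ Suc k) *\<^sub>C v)"
      unfolding u_def by (rule kernels_family)
    also have "\<dots> = (\<Sum>x\<leftarrow>ws. 0)"
    proof (rule arg_cong[where f = sum_list], rule map_cong[OF refl])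
      fix x assume "x \<in> set ws"
      then have "snd x \<in> K_sing" using ker unfolding singular_kernel_def by blast
      then show "(case x of (v, F) \<Rightarrow> Tr (F * pole (- n) ^ Suc k) *\<^sub>C v) = 0"
        unfolding case_prod_beta by (simp only: Tr_sing_pole_power complex_vector.scale_zero_left)
    qed
    finally have u0: "pair (pole (- n) ^ Suc k) u = 0" by simp
    have "pair (pole (- n) ^ Suc k) h = h n (- 1 - int k)"
      by (rule pair_pole_power) (rule h0)
    then show ?thesis
      unfolding Dw w pair_add_right[OF lu lh] u0 by simp
  qed
  have "field_of (vshift n f) m g = rop w n m" for n m
  proof -
    obtain J where J: "\<And>p. p \<ge> J \<Longrightarrow> field_of g p (vshift n f) = 0"
      by (rule formal_field_bound[OF state_field_formal[OF state_field_field_of]]) (rule that)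
    \<comment> \<open>Translation invariance shifts n from f to -n on g, matching the index produced
      by the reflection.\<close>
    have e: "field_of g p (vshift n f) = vshift n (field_of (vshift (- n) g) p f)" for p
    proof -
      have "field_of g = conj n (field_of (vshift (- n) g))"
        by (simp add: vshift_vshift vshift_0 flip: field_of_vshift)
      then show ?thesis by (simp add: conj_def vshift_vshift vshift_0)
    qed
    have inj: "x = 0" if "vshift n x = 0" for x :: "'a vacuum_module"
      using arg_cong[OF that, of "vshift (- n)"] by (simp add: vshift_vshift vshift_0 clinear_zero[OF clinear_vshift])
    have "field_of (vshift n f) m g
        = (\<Sum>p\<in>{m..<J}. ((- 1) powi (p + 1)) *\<^sub>C dpow vderiv (p - m) (field_of g p (vshift n f)))"
      by (rule field_of_skew[OF J])
    also have "\<dots> = (\<Sum>p\<in>{m..<J}. dpow vderiv (p - m) (vshift n (w n p)))"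
      by (simp only: e w_def clinear_scale[OF clinear_vshift] clinear_scale[OF clinear_dpow[OF clinear_vderiv]])
    also have "\<dots> = rop w n m"
    proof (rule rop_superset[symmetric])
      fix p assume "m \<le> p" "w n p \<noteq> 0"
      moreover have "w n p = 0" if "p \<ge> J"
        using J[OF that] inj unfolding e w_def by simp
      ultimately show "p \<in> {m..<J}" by force
    qed simp
    finally show ?thesis .
  qed
  then have "vop f G g = pair G (rop w)" unfolding vop_def by simp
  also have "rop w = (\<lambda>n m. rop u n m + rop h n m)"
    unfolding w by (intro ext rop_add lu lh)
  also have "pair G \<dots> = pair G (rop u) + pair G (rop h)"
    by (rule pair_add_right) (intro laurent_family_rop lu lh)+
  also have "pair G (rop u) = (\<Sum>(v, F)\<leftarrow>ws. V.R_V v (F * G))"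
    unfolding u_def by (rule pair_rop_kernels_family)
  also have "pair G (rop h) = V.R_hol (V.Y_S g f) G"
    using R_hol_eq[where h = h, OF D _ Dh] h0 by simp
  also have "(\<Sum>(v, F)\<leftarrow>ws. V.R_V v (F * G)) + V.R_hol (V.Y_S g f) G = V.R_apply ws (V.Y_S g f) G"
    unfolding V.R_apply_def ..
  finally show ?thesis .
qed

theorem mainTheorem3:
  shows "\<exists>Y :: 'g::complex_lie_algebra vacuum_module \<Rightarrow> kfun \<Rightarrow> 'g vacuum_module \<Rightarrow> 'g vacuum_module.
           HT_vertex_algebra vacuum_vector Y \<and>
           (\<forall>(X :: 'g) F. Y (current X inv_tau vacuum_vector) F = current X F)"
proof (intro exI conjI allI)
  show "HT_vertex_algebra (vacuum_vector :: 'g vacuum_module) vop"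
  proof (rule HT_vertex_algebra.intro)
    show "is_field (vop f)" for f :: "'g vacuum_module"
      unfolding is_field_def
    proof (intro conjI allI)
      show "clinear (vop f F)" for F by (rule clinear_vop(2))
      show "rational_singularities (\<lambda>G. vop f G v)" for v
        unfolding vop_def by (rule rational_singularities_pair[OF field_of_family])
    qed
    show "vop f inv_tau vacuum_vector = f" for f :: "'g vacuum_module"
      using vop_creation(2)[of f 0 0] by (simp add: dpow_def vshift_0 scaleC_one)
    show "clinear (\<lambda>f. vop f F v)" for F and v :: "'g vacuum_module" by (rule clinear_vop(3))
    show "vop vacuum_vector F v = Tr F *\<^sub>C v" for F and v :: "'g vacuum_module" by (rule vop_vacuum)
    show "vop f (of_poly p) vacuum_vector = 0" for p and f :: "'g vacuum_module" by (rule vop_creation(1))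
    show "vop f (hact (antipode h) F) = vop (V.state_act h f) F" if "h \<in> H_T" for h F and f :: "'g vacuum_module"
      using that by (rule vop_covariant)
    show "vop f G g = V.R_apply ws (V.Y_S g f) G" if "singular_kernel (V.Y_S g f) ws" for f g :: "'g vacuum_module" and G ws
      using that by (rule vop_skew_symmetry)
    show "mutually_rational (vop f) (vop g)" for f g :: "'g vacuum_module" by (rule vop_mutually_rational)
  qed
  show "vop (current X inv_tau vacuum_vector) F = current X F" for X :: 'g and F
    by (rule vop_current)
qed

end
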